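(* Let $\alpha\in(0,2)$ and let $\mu$ be a symmetric probability law on $\mathbb{R}$ that is regularly varying with index $\alpha$. Let $p=p_n$ be a sequence of positive integers such that $p_n/n\to\gamma\in(0,\infty)$ as $n\to\infty$. For each $n$ let $\boldsymbol{X}_1,\dots,\boldsymbol{X}_n$ be i.i.d. random vectors drawn from the symmetric $\alpha$-spherical distribution $\mu_{\alpha,p_n}$ on $\mathbb{S}^{p_n-1}$ associated with $\mu$, and let $$B_n=\frac{p_n}{n}\sum_{1\le i<j\le n}\left[(\boldsymbol{X}_i^{\top}\boldsymbol{X}_j)^2-\frac1{p_n}\right].$$ Then, as $n\to\infty$, $$\frac{\sqrt n}{p_n}B_n\ \stackrel{d}{\to}\ N\left(0,\frac{(2-\alpha)^2}{8\gamma}\right).$$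
   Context: $\mathbb{S}^{p-1}=\{x\in\mathbb{R}^p:\|x\|_2=1\}$. A probability law $\mu$ on $\mathbb{R}$ is regularly varying with index $\alpha\in(0,2)$ if, for $X\sim\mu$, $\mathbb{P}(|X|\ge x)\sim L(x)x^{-\alpha}$ as $x\to\infty$ for some slowly varying function $L$, i.e. $\lim_{x\to\infty}L(ax)/L(x)=1$ for all $a>0$. The $\alpha$-spherical distribution $\mu_{\alpha,p}$ associated with such a $\mu$ is the distribution on $\mathbb{S}^{p-1}$ of the random vector $$\left(\frac{X_1}{\sqrt{\sum_{k=1}^pX_k^2}},\dots,\frac{X_p}{\sqrt{\sum_{k=1}^pX_k^2}}\right),$$ where $X_1,\dots,X_p$ are i.i.d. with law $\mu$ (it being understood that this is a distribution supported on $\mathbb{S}^{p-1}$, i.e. the denominator is almost surely nonzero). If $\mu$ is symmetric ($X$ and $-X$ have the same law), $\mu_{\alpha,p}$ is called a symmetric $\alpha$-spherical distribution. $N(m,s)$ is the normal law with mean $m$ and variance $s$. *)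

theory Defs
  imports "HOL-Probability.Probability" "HOL-Library.Landau_Symbols"
begin

text \<open>
  Vectors in \<open>\<real>\<^sup>p\<close> with varying \<open>p\<close> are rendered as extensional functions on
  the index set \<open>{1..p}\<close>, with the product sigma-algebra of \<open>Pi\<^sub>M {1..p} (\<lambda>_. borel)\<close>.
\<close>

definition vec_norm :: "nat \<Rightarrow> (nat \<Rightarrow> real) \<Rightarrow> real" where
  "vec_norm p x = sqrt (\<Sum>k=1..p. (x k)\<^sup>2)"

definition vec_inner :: "nat \<Rightarrow> (nat \<Rightarrow> real) \<Rightarrow> (nat \<Rightarrow> real) \<Rightarrow> real" where
  "vec_inner p x y = (\<Sum>k=1..p. x k * y k)"

definition unit_sphere :: "nat \<Rightarrow> (nat \<Rightarrow> real) set" where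
  "unit_sphere p = {x \<in> extensional {1..p}. vec_norm p x = 1}"

definition real_law :: "real measure \<Rightarrow> bool" where
  "real_law \<mu> \<longleftrightarrow> prob_space \<mu> \<and> sets \<mu> = sets borel"

definition symmetric_law :: "real measure \<Rightarrow> bool" where
  "symmetric_law \<mu> \<longleftrightarrow> distr \<mu> borel uminus = \<mu>"

text \<open>
  The limit \<open>1\<close> forces \<open>L\<close> to be eventually nonzero, since \<open>0 / 0 = 0\<close>. Positivity
  near infinity follows once \<open>L\<close> is tied to a tail probability in \<open>regularly_varying\<close>.
\<close>

definition slowly_varying :: "(real \<Rightarrow> real) \<Rightarrow> bool" where
  "slowly_varying L \<longleftrightarrow> (\<forall>a>0. ((\<lambda>x. L (a * x) / L x) \<longlongrightarrow> 1) at_top)"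

definition regularly_varying :: "real measure \<Rightarrow> real \<Rightarrow> bool" where
  "regularly_varying \<mu> \<alpha> \<longleftrightarrow>
     (\<exists>L. slowly_varying L \<and>
        (\<lambda>x. measure \<mu> {y. \<bar>y\<bar> \<ge> x}) \<sim>[at_top] (\<lambda>x. L x * x powr (- \<alpha>)))"

text \<open>
  The law of the self-normalised i.i.d. vector. Division by zero yields zero, so a
  vanishing denominator produces the zero vector; this measure is therefore concentrated
  on \<open>unit_sphere p\<close> exactly when the denominator is almost surely nonzero.
\<close>

definition spherical_law :: "real measure \<Rightarrow> nat \<Rightarrow> (nat \<Rightarrow> real) measure" where
  "spherical_law \<mu> p =
     distr (Pi\<^sub>M {1..p} (\<lambda>_. \<mu>)) (Pi\<^sub>M {1..p} (\<lambda>_. borel))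
       (\<lambda>x. \<lambda>k\<in>{1..p}. x k / vec_norm p x)"

definition B_stat :: "nat \<Rightarrow> nat \<Rightarrow> (nat \<Rightarrow> nat \<Rightarrow> real) \<Rightarrow> real" where
  "B_stat p n v =
     real p / real n *
       (\<Sum>(i, j) \<in> {(i, j). 1 \<le> i \<and> i < j \<and> j \<le> n}. (vec_inner p (v i) (v j))\<^sup>2 - 1 / real p)"

text \<open>
  The second parameter is the variance, whereas \<open>normal_density\<close> takes the standard
  deviation. Only meaningful for positive variance.
\<close>

definition normal_law :: "real \<Rightarrow> real \<Rightarrow> real measure" where
  "normal_law m s = density lborel (\<lambda>x. ennreal (normal_density m (sqrt s) x))"

end

theory Submission
  imports Defs "HOL-Real_Asymp.Real_Asymp" "HOL-Combinatorics.Permutations"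
begin

text \<open>
  The normalised statistic is \<open>n\<^bsup>-1/2\<^esup> \<Sum>\<^bsub>i<j\<^esub> H(X\<^sub>i, X\<^sub>j)\<close> with
  \<open>H(x, y) = (x \<bullet> y)\<^sup>2 - 1/p\<close>. Symmetry and exchangeability of the coordinates
  give \<open>E[X X\<^sup>T] = I/p\<close>, so \<open>H\<close> averages to zero in each argument: the statistic is
  a degenerate U-statistic, and its successive increments
  \<open>D\<^sub>j = n\<^bsup>-1/2\<^esup> \<Sum>\<^bsub>i<j\<^esub> H(X\<^sub>i, X\<^sub>j)\<close> are martingale differences.

  The conditional variance of \<open>D\<^sub>j\<close> given the past is so close to the constant
  \<open>(j-1) E[H\<^sup>2]/n\<close> that the \<open>L\<^sup>1\<close> errors, summed over all \<open>j\<close>, still tend to zero. Hence the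
  characteristic function can be followed one increment at a time: up to errors of vanishing sum,
  adding \<open>D\<^sub>j\<close> multiplies it by \<open>1 - t\<^sup>2 (j-1) E[H\<^sup>2]/(2n)\<close>. This is
  \<open>char_step\<close>; summing the errors gives \<open>degenerate_U_statistic_clt\<close>, whose hypotheses are
  four moment conditions on the kernel. The fourth moments of the increments enter through both
  \<open>E[H\<^sup>4]\<close> and \<open>E[H(X\<^sub>1,X\<^sub>2)\<^sup>2 H(X\<^sub>1,X\<^sub>3)\<^sup>2]\<close>, and the two must be kept apart: for
  the present kernel the first is of order \<open>1/p\<close>, the second of order \<open>1/p\<^sup>2\<close>, and
  bounding the second by the first would not suffice when \<open>p\<close> and \<open>n\<close> are comparable.

  All kernel moments follow from the fourth order moment tensor of the spherical law, which
  symmetry and exchangeability reduce to the two numbers \<open>e4 = E[X\<^bsub>1\<^esub>\<^sup>4]\<close> and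
  \<open>e22 = E[X\<^bsub>1\<^esub>\<^sup>2 X\<^bsub>2\<^esub>\<^sup>2]\<close> (\<open>fourth_moment_tensor\<close>), with
  \<open>e22 = O(p\<^bsup>-2\<^esup>)\<close> because the squared coordinates sum to one. In particular
  \<open>p E[H\<^sup>2] = (p e4)\<^sup>2 + o(1)\<close>, and the limiting variance is
  \<open>lim (p e4)\<^sup>2 / (2 \<gamma>)\<close>.

  The tail index enters only through \<open>p e4 \<longlonglongrightarrow> 1 - \<alpha>/2\<close>
  (\<open>self_normalised_fourth_moment_limit\<close>). With \<open>1/S\<^sup>2 = \<integral> s e\<^bsup>-sS\<^esup> ds\<close>
  the quantity \<open>p e4\<close> becomes an integral over \<open>s > 0\<close>, which can be compared with the analogous
  representation of \<open>1 = E[\<Sum>X\<^sub>k\<^sup>2/S]\<close>. Both integrals concentrate at \<open>s = 0\<close> as \<open>p\<close>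
  grows, and there the ratio of the integrands tends to \<open>1 - \<alpha>/2\<close> by dominated convergence,
  with the domination supplied by a bound of Potter type for the tail.
\<close>

section \<open>Sums of bounded independent variables\<close>

(* Index sets {1..n} keep this form under simplification. *)
declare One_nat_def [simp del]

lemma (in finite_measure) integrable_bounded:
  fixes f :: "'a \<Rightarrow> 'b :: {banach, second_countable_topology}"
  assumes "f \<in> borel_measurable M" "\<And>x. x \<in> space M \<Longrightarrow> norm (f x) \<le> C"
  shows "integrable M f"
  using assms by (intro integrable_const_bound[where B = C]) auto

lemma (in prob_space) norm_integral_le_bound:
  fixes f :: "'a \<Rightarrow> 'b :: {banach, second_countable_topology}"
  assumes [measurable]: "f \<in> borel_measurable M" and b: "\<And>x. x \<in> space M \<Longrightarrow> norm (f x) \<le> C"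
  shows "norm (\<integral>x. f x \<partial>M) \<le> C"
proof -
  have "norm (\<integral>x. f x \<partial>M) \<le> (\<integral>x. norm (f x) \<partial>M)" by simp
  also have "\<dots> \<le> C"
    by (rule integral_le_const) (auto intro!: integrable_bounded[where C = C] b AE_I2)
  finally show ?thesis .
qed

lemma abs_sum_le_bound:
  assumes "\<And>i. \<bar>g i :: real\<bar> \<le> C"
  shows "\<bar>\<Sum>i=1..k. g i\<bar> \<le> real k * C"
proof -
  have "\<bar>\<Sum>i=1..k. g i\<bar> \<le> (\<Sum>i=1..k. \<bar>g i\<bar>)" by (rule sum_abs)
  also have "\<dots> \<le> (\<Sum>i=1..k. C)" by (intro sum_mono assms)
  finally show ?thesis by simp
qed

abbreviation (input) powM :: "'a measure \<Rightarrow> nat \<Rightarrow> (nat \<Rightarrow> 'a) measure" where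
  "powM P k \<equiv> Pi\<^sub>M {1..k} (\<lambda>_. P)"

context prob_space
begin

lemma prob_space_powM: "prob_space (powM M k)"
  by (intro prob_space_PiM prob_space_axioms)

text \<open>
  Integrating out the last coordinate is what replaces conditioning on the first \<open>k\<close> variables
  throughout.
\<close>

lemma integral_powM_Suc:
  fixes F :: "(nat \<Rightarrow> 'a) \<Rightarrow> 'b :: {banach, second_countable_topology}"
  assumes [measurable]: "F \<in> borel_measurable (powM M (Suc k))"
    and b: "\<And>x. x \<in> space (powM M (Suc k)) \<Longrightarrow> norm (F x) \<le> C"
  shows "(\<integral>x. F x \<partial>powM M (Suc k)) = (\<integral>x. (\<integral>y. F (x(Suc k := y)) \<partial>M) \<partial>powM M k)"
proof -
  interpret P: product_sigma_finite "\<lambda>_ :: nat. M"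
    by (simp add: product_sigma_finite_def sigma_finite_measure_axioms)
  interpret N: prob_space "powM M (Suc k)" by (rule prob_space_powM)
  have "integrable (powM M (Suc k)) F"
    by (rule N.integrable_bounded[OF _ b]) auto
  moreover have "{1..Suc k} = insert (Suc k) {1..k}" by auto
  ultimately show ?thesis
    using P.product_integral_insert[of "{1..k}" "Suc k" F] by simp
qed

context
  fixes f :: "'a \<Rightarrow> real" and C :: real
  assumes f[measurable]: "f \<in> borel_measurable M"
    and bnd: "\<And>x. \<bar>f x\<bar> \<le> C"
    and centred: "(\<integral>x. f x \<partial>M) = 0"
begin

private lemma intf: "integrable M (\<lambda>y. f y ^ r)"
  by (rule integrable_bounded[where C = "C ^ r"]) (auto simp: power_abs intro!: power_mono bnd)

private lemma intS: "integrable (powM M k) (\<lambda>x. (\<Sum>i=1..k. f (x i)) ^ r)"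
proof -
  interpret N: prob_space "powM M k" by (rule prob_space_powM)
  show ?thesis
    by (rule N.integrable_bounded[where C = "(real k * C) ^ r"])
       (auto simp: power_abs intro!: power_mono abs_sum_le_bound bnd)
qed

private lemma step:
  "(\<integral>x. (\<Sum>i=1..Suc k. f (x i)) ^ r \<partial>powM M (Suc k)) =
   (\<integral>x. (\<integral>y. ((\<Sum>i=1..k. f (x i)) + f y) ^ r \<partial>M) \<partial>powM M k)"
proof -
  have *: "(\<Sum>i=1..Suc k. f ((x(Suc k := y)) i)) = (\<Sum>i=1..k. f (x i)) + f y" for x y
  proof -
    have "(\<Sum>i=1..k. f ((x(Suc k := y)) i)) = (\<Sum>i=1..k. f (x i))"
      by (rule sum.cong) auto
    then show ?thesis by simp
  qed
  show ?thesis
    by (subst integral_powM_Suc[where C = "(real (Suc k) * C) ^ r"])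
       (auto simp only: * real_norm_def power_abs intro!: power_mono abs_sum_le_bound bnd, measurable)
qed

lemma iid_sum_mean: "(\<integral>x. (\<Sum>i=1..k. f (x i)) \<partial>powM M k) = 0"
proof (induction k)
  case (Suc k)
  interpret N: prob_space "powM M k" by (rule prob_space_powM)
  have "(\<integral>y. (\<Sum>i=1..k. f (x i)) + f y \<partial>M) = (\<Sum>i=1..k. f (x i))" for x
    using intf[of 1] by (simp add: centred prob_space)
  with step[of k 1] Suc show ?case by simp
qed simp

lemma iid_sum_second_moment:
  "(\<integral>x. (\<Sum>i=1..k. f (x i))\<^sup>2 \<partial>powM M k) = real k * (\<integral>y. (f y)\<^sup>2 \<partial>M)"
proof (induction k)
  case (Suc k)
  interpret N: prob_space "powM M k" by (rule prob_space_powM)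
  have "(\<integral>y. (a + f y)\<^sup>2 \<partial>M) = a\<^sup>2 + (\<integral>y. (f y)\<^sup>2 \<partial>M)" for a
    using intf[of 1] intf[of 2] by (simp add: power2_sum centred prob_space)
  then have "(\<integral>x. (\<Sum>i=1..Suc k. f (x i))\<^sup>2 \<partial>powM M (Suc k)) =
     (\<integral>x. (\<Sum>i=1..k. f (x i))\<^sup>2 + (\<integral>y. (f y)\<^sup>2 \<partial>M) \<partial>powM M k)"
    using step[of k 2] by simp
  also have "\<dots> = real k * (\<integral>y. (f y)\<^sup>2 \<partial>M) + (\<integral>y. (f y)\<^sup>2 \<partial>M)"
    using intS[of k 2] Suc by (simp add: N.prob_space)
  finally show ?case by (simp add: algebra_simps)
qed simp

text \<open>
  When one more summand is added, the odd cross terms vanish and the term \<open>6 m2 (k m2)\<close> is absorbed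
  by the growth of \<open>3 k\<^sup>2 m2\<^sup>2\<close>.
\<close>

lemma iid_sum_fourth_moment:
  "(\<integral>x. (\<Sum>i=1..k. f (x i)) ^ 4 \<partial>powM M k) \<le>
     real k * (\<integral>y. (f y) ^ 4 \<partial>M) + 3 * (real k)\<^sup>2 * (\<integral>y. (f y)\<^sup>2 \<partial>M)\<^sup>2"
proof (induction k)
  case (Suc k)
  interpret N: prob_space "powM M k" by (rule prob_space_powM)
  let ?m2 = "\<integral>y. (f y)\<^sup>2 \<partial>M" and ?m3 = "\<integral>y. (f y) ^ 3 \<partial>M" and ?m4 = "\<integral>y. (f y) ^ 4 \<partial>M"
  have pow4: "(a + b) ^ 4 = a ^ 4 + 4 * a ^ 3 * b + 6 * a\<^sup>2 * b\<^sup>2 + 4 * a * b ^ 3 + b ^ 4" for a b :: real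
    by algebra
  have "(\<integral>y. (a + f y) ^ 4 \<partial>M) = a ^ 4 + 6 * ?m2 * a\<^sup>2 + 4 * ?m3 * a + ?m4" for a
    unfolding pow4 using intf[of 1] intf[of 2] intf[of 3] intf[of 4] by (simp add: centred prob_space)
  then have "(\<integral>x. (\<Sum>i=1..Suc k. f (x i)) ^ 4 \<partial>powM M (Suc k)) =
     (\<integral>x. (\<Sum>i=1..k. f (x i)) ^ 4 + 6 * ?m2 * (\<Sum>i=1..k. f (x i))\<^sup>2 + 4 * ?m3 * (\<Sum>i=1..k. f (x i)) + ?m4 \<partial>powM M k)"
    using step[of k 4] by simp
  also have "\<dots> = (\<integral>x. (\<Sum>i=1..k. f (x i)) ^ 4 \<partial>powM M k) + 6 * ?m2 * (real k * ?m2) + ?m4"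
    using intS[of k 1] intS[of k 2] intS[of k 4] iid_sum_mean[of k] iid_sum_second_moment[of k]
    by (simp add: N.prob_space)
  also have "\<dots> \<le> real k * ?m4 + 3 * (real k)\<^sup>2 * ?m2\<^sup>2 + 6 * ?m2 * (real k * ?m2) + ?m4"
    using Suc by simp
  also have "\<dots> \<le> real (Suc k) * ?m4 + 3 * (real (Suc k))\<^sup>2 * ?m2\<^sup>2"
    by (simp add: algebra_simps power2_eq_square)
  finally show ?case .
qed simp

end
end

section \<open>A central limit theorem for degenerate U-statistics\<close>

lemma sum_sym_split:
  fixes g :: "nat \<Rightarrow> nat \<Rightarrow> real"
  assumes "\<And>i j. g i j = g j i"
  shows "(\<Sum>i=1..k. \<Sum>j=1..k. g i j) = (\<Sum>i=1..k. g i i) + 2 * (\<Sum>j=1..k. \<Sum>i=1..<j. g i j)"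
proof (induction k)
  case (Suc k)
  have "(\<Sum>j=1..k. g (Suc k) j) = (\<Sum>i=1..<Suc k. g i (Suc k))"
    by (rule sum.cong) (auto simp: assms[of "Suc k"])
  moreover have "(\<Sum>i=1..k. g i (Suc k)) = (\<Sum>i=1..<Suc k. g i (Suc k))"
    by (rule sum.cong) auto
  ultimately show ?case using Suc by (simp add: sum.distrib)
qed simp

lemma abs_le_am_gm: "0 < r \<Longrightarrow> \<bar>a :: real\<bar> \<le> (r + a\<^sup>2 / r) / 2"
  using zero_le_power2[of "\<bar>a\<bar> - r"] by (simp add: field_simps power2_eq_square)

text \<open>
  Third absolute moments are traded for second and fourth ones, which can be computed. The free
  parameter \<open>s\<close> is chosen in the limit theorem.
\<close>

lemma cube_le_am_gm: assumes "0 < s" shows "\<bar>a :: real\<bar> ^ 3 \<le> (s * a\<^sup>2 + a ^ 4 / s) / 2"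
proof -
  have "0 \<le> a\<^sup>2 * (\<bar>a\<bar> - s)\<^sup>2" by simp
  also have "\<dots> = a ^ 4 - 2 * s * \<bar>a\<bar> ^ 3 + s\<^sup>2 * a\<^sup>2"
    by (simp add: power2_diff algebra_simps power3_eq_cube power2_eq_square power4_eq_xxxx abs_mult_self_eq)
  finally show ?thesis using assms by (simp add: field_simps power2_eq_square)
qed

lemma iexp_taylor2:
  "cmod (iexp x - (complex_of_real (1 - x\<^sup>2 / 2) + \<i> * complex_of_real x)) \<le> \<bar>x\<bar> ^ 3 / 6"
proof -
  have "{..2 :: nat} = {0, 1, 2}" by auto
  then have "(\<Sum>m\<le>2. (\<i> * complex_of_real x) ^ m / fact m) =
      complex_of_real (1 - x\<^sup>2 / 2) + \<i> * complex_of_real x"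
    by (simp add: power_mult_distrib)
  moreover have "fact (Suc 2) = (6 :: real)" "Suc 2 = 3" by (simp_all add: fact_numeral)
  ultimately show ?thesis using iexp_approx1[of x 2] by simp
qed

lemma exp_minus_quadratic: "0 \<le> x \<Longrightarrow> \<bar>1 - x - exp (- x)\<bar> \<le> x\<^sup>2 / 2" for x :: real
proof -
  assume x: "0 \<le> x"
  have "1 - x \<le> exp (- x)" using exp_ge_add_one_self[of "- x"] by simp
  moreover have "exp (- x) \<le> 1 - x + x\<^sup>2 / 2"
  proof -
    let ?f = "\<lambda>u :: real. 1 - u + u\<^sup>2 / 2 - exp (- u)"
    have "?f 0 \<le> ?f x"
    proof (rule DERIV_nonneg_imp_nondecreasing[OF x])
      fix u :: real
      have "(?f has_real_derivative (- 1 + u + exp (- u))) (at u)"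
        by (auto intro!: derivative_eq_intros)
      moreover have "0 \<le> - 1 + u + exp (- u)" using exp_ge_add_one_self[of "- u"] by simp
      ultimately show "\<exists>y. (?f has_real_derivative y) (at u) \<and> 0 \<le> y" by blast
    qed
    then show ?thesis by simp
  qed
  ultimately show ?thesis by simp
qed

text \<open>
  Boundedness makes every integral below exist; the quantitative information about the kernel is in
  its moments \<open>\<tau>\<close>, \<open>m4\<close>, \<open>\<kappa>\<close> and \<open>g2\<close>.
\<close>

locale degenerate_kernel = prob_space P for P :: "'a measure" +
  fixes h :: "'a \<Rightarrow> 'a \<Rightarrow> real" and B :: real
  assumes h_measurable: "case_prod h \<in> borel_measurable (P \<Otimes>\<^sub>M P)"
    and h_bound: "\<And>x y. \<bar>h x y\<bar> \<le> B"
    and h_sym: "\<And>x y. h x y = h y x"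
    and h_degenerate: "\<And>x. x \<in> space P \<Longrightarrow> (\<integral>y. h x y \<partial>P) = 0"
begin

text \<open>
  \<open>U k\<close> is the U-statistic of the first \<open>k\<close> variables and \<open>D k x\<close> its increment as a function
  of the next variable.
\<close>

definition D :: "nat \<Rightarrow> (nat \<Rightarrow> 'a) \<Rightarrow> 'a \<Rightarrow> real" where
  "D k x y = (\<Sum>i=1..k. h (x i) y)"

definition U :: "nat \<Rightarrow> (nat \<Rightarrow> 'a) \<Rightarrow> real" where
  "U k x = (\<Sum>j=1..k. \<Sum>i=1..<j. h (x i) (x j))"

text \<open>
  \<open>G\<close> is the kernel of the squared integral operator of \<open>h\<close>. It expresses the conditional variance of
  an increment as a quadratic form in the past variables.
\<close>

definition G :: "'a \<Rightarrow> 'a \<Rightarrow> real" where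
  "G x y = (\<integral>z. h x z * h y z \<partial>P)"

definition \<tau> :: real where "\<tau> = (\<integral>x. \<integral>y. (h x y)\<^sup>2 \<partial>P \<partial>P)"

lemma h_meas [measurable (raw)]:
  assumes [measurable]: "f \<in> N \<rightarrow>\<^sub>M P" "g \<in> N \<rightarrow>\<^sub>M P"
  shows "(\<lambda>x. h (f x) (g x)) \<in> borel_measurable N"
proof -
  note h_measurable [measurable]
  have "(\<lambda>x. case_prod h (f x, g x)) \<in> borel_measurable N" by measurable
  then show ?thesis by simp
qed

lemma B_nonneg: "0 \<le> B" using h_bound[of undefined undefined] by linarith

lemma D_meas [measurable]: "case_prod (D k) \<in> borel_measurable (powM P k \<Otimes>\<^sub>M P)"
  unfolding D_def by measurable

lemma D_meas1 [measurable]: "x \<in> space (powM P k) \<Longrightarrow> D k x \<in> borel_measurable P"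
  unfolding D_def by (auto simp: space_PiM intro!: borel_measurable_sum h_meas measurable_const)

lemma D_meas2 [measurable]: "y \<in> space P \<Longrightarrow> (\<lambda>x. D k x y) \<in> borel_measurable (powM P k)"
  unfolding D_def by measurable

lemma U_meas [measurable]: "U k \<in> borel_measurable (powM P k)"
  unfolding U_def by measurable

lemma D_bound: "\<bar>D k x y\<bar> \<le> real k * B"
  unfolding D_def by (rule abs_sum_le_bound) (rule h_bound)

lemma D_pow_bound: "\<bar>D k x y\<bar> ^ r \<le> (real k * B) ^ r"
  by (rule power_mono[OF D_bound]) simp

lemma U_Suc_upd: "U (Suc k) (x(Suc k := y)) = U k x + D k x y"
proof -
  have "(\<Sum>i=1..<j. h ((x(Suc k := y)) i) ((x(Suc k := y)) j)) = (\<Sum>i=1..<j. h (x i) (x j))"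
    if "j \<le> k" for j
    using that by (intro sum.cong) auto
  then have "(\<Sum>j=1..k. \<Sum>i=1..<j. h ((x(Suc k := y)) i) ((x(Suc k := y)) j)) = U k x"
    unfolding U_def by (intro sum.cong) auto
  moreover have "(\<Sum>i=1..<Suc k. h ((x(Suc k := y)) i) ((x(Suc k := y)) (Suc k))) = D k x y"
    unfolding D_def by (rule sum.cong) auto
  ultimately show ?thesis by (simp add: U_def)
qed

lemma U_bound: "\<bar>U k x\<bar> \<le> (real k)\<^sup>2 * B"
proof (induction k)
  case (Suc k)
  have "\<bar>U (Suc k) x\<bar> \<le> \<bar>U k x\<bar> + \<bar>D k x (x (Suc k))\<bar>"
    using U_Suc_upd[of k x "x (Suc k)"] by simp
  also have "\<dots> \<le> (real k)\<^sup>2 * B + real k * B" using Suc D_bound by (intro add_mono)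
  also have "\<dots> \<le> (real (Suc k))\<^sup>2 * B"
    using B_nonneg by (simp add: power2_eq_square algebra_simps)
  finally show ?case .
qed (simp add: U_def)

lemma U_pow_bound: "\<bar>U k x\<bar> ^ r \<le> ((real k)\<^sup>2 * B) ^ r"
  by (rule power_mono[OF U_bound]) simp

lemma U_sq_bound: "(U k x)\<^sup>2 \<le> ((real k)\<^sup>2 * B)\<^sup>2"
  using U_pow_bound[of k x 2] by simp

lemma h_degenerate': "y \<in> space P \<Longrightarrow> (\<integral>x. h x y \<partial>P) = 0"
  using h_degenerate[of y] by (simp add: h_sym[of _ y])

lemma int_h: "x \<in> space P \<Longrightarrow> integrable P (h x)"
  by (rule integrable_bounded[where C = B]) (auto intro: h_bound)

lemma int_D: "x \<in> space (powM P k) \<Longrightarrow> integrable P (\<lambda>y. D k x y ^ r)"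
  by (rule integrable_bounded[where C = "(real k * B) ^ r"]) (auto simp: power_abs intro: D_pow_bound)

lemma D_int_bound: "x \<in> space (powM P k) \<Longrightarrow> \<bar>\<integral>y. D k x y ^ r \<partial>P\<bar> \<le> (real k * B) ^ r"
  using norm_integral_le_bound[of "\<lambda>y. D k x y ^ r" "(real k * B) ^ r"]
  by (simp add: power_abs D_pow_bound)

lemma D_mean: "x \<in> space (powM P k) \<Longrightarrow> (\<integral>y. D k x y \<partial>P) = 0"
  unfolding D_def by (subst Bochner_Integration.integral_sum) (auto simp: space_PiM PiE_iff int_h h_degenerate)

lemma D_second_moment:
  "y \<in> space P \<Longrightarrow> (\<integral>x. (D k x y)\<^sup>2 \<partial>powM P k) = real k * (\<integral>x. (h x y)\<^sup>2 \<partial>P)"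
  unfolding D_def by (rule iid_sum_second_moment[where C = B]) (auto simp: h_bound h_degenerate')

lemma D_fourth_moment:
  "y \<in> space P \<Longrightarrow> (\<integral>x. (D k x y) ^ 4 \<partial>powM P k) \<le>
     real k * (\<integral>x. (h x y) ^ 4 \<partial>P) + 3 * (real k)\<^sup>2 * (\<integral>x. (h x y)\<^sup>2 \<partial>P)\<^sup>2"
  unfolding D_def by (rule iid_sum_fourth_moment[where C = B]) (auto simp: h_bound h_degenerate')

lemma fubini_D:
  "integrable (powM P k \<Otimes>\<^sub>M P) (\<lambda>(x, y). D k x y ^ r)"
  "(\<integral>x. \<integral>y. D k x y ^ r \<partial>P \<partial>powM P k) = (\<integral>y. \<integral>x. D k x y ^ r \<partial>powM P k \<partial>P)"
proof -
  interpret N: prob_space "powM P k" by (rule prob_space_powM)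
  interpret PP: pair_prob_space "powM P k" P ..
  show *: "integrable (powM P k \<Otimes>\<^sub>M P) (\<lambda>(x, y). D k x y ^ r)"
    by (rule PP.P.integrable_bounded[where C = "(real k * B) ^ r"])
       (auto simp: power_abs intro: D_pow_bound)
  show "(\<integral>x. \<integral>y. D k x y ^ r \<partial>P \<partial>powM P k) = (\<integral>y. \<integral>x. D k x y ^ r \<partial>powM P k \<partial>P)"
    using PP.Fubini_integral[OF *] by simp
qed

lemma D_total_second_moment: "(\<integral>x. \<integral>y. (D k x y)\<^sup>2 \<partial>P \<partial>powM P k) = real k * \<tau>"
proof -
  have "(\<integral>x. \<integral>y. (D k x y)\<^sup>2 \<partial>P \<partial>powM P k) = (\<integral>y. real k * (\<integral>x. (h x y)\<^sup>2 \<partial>P) \<partial>P)"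
    unfolding fubini_D by (intro Bochner_Integration.integral_cong D_second_moment) auto
  then show ?thesis by (simp add: \<tau>_def h_sym)
qed

lemma \<tau>_nonneg: "0 \<le> \<tau>"
  unfolding \<tau>_def by (intro Bochner_Integration.integral_nonneg) simp

lemma U_second_moment: "(\<integral>x. (U k x)\<^sup>2 \<partial>powM P k) \<le> (real k)\<^sup>2 * \<tau>"
proof (induction k)
  case (Suc k)
  interpret N: prob_space "powM P k" by (rule prob_space_powM)
  have "(\<integral>x. (U (Suc k) x)\<^sup>2 \<partial>powM P (Suc k)) = (\<integral>x. \<integral>y. (U k x + D k x y)\<^sup>2 \<partial>P \<partial>powM P k)"
    by (subst integral_powM_Suc[where C = "((real (Suc k))\<^sup>2 * B)\<^sup>2"])
       (auto simp: U_Suc_upd simp del: of_nat_Suc intro: U_sq_bound)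
  also have "\<dots> = (\<integral>x. (U k x)\<^sup>2 + (\<integral>y. (D k x y)\<^sup>2 \<partial>P) \<partial>powM P k)"
  proof (rule Bochner_Integration.integral_cong)
    fix x assume x: "x \<in> space (powM P k)"
    show "(\<integral>y. (U k x + D k x y)\<^sup>2 \<partial>P) = (U k x)\<^sup>2 + (\<integral>y. (D k x y)\<^sup>2 \<partial>P)"
      using int_D[OF x, of 1] int_D[OF x, of 2] D_mean[OF x] by (simp add: power2_sum prob_space)
  qed simp
  also have "\<dots> = (\<integral>x. (U k x)\<^sup>2 \<partial>powM P k) + (\<integral>x. \<integral>y. (D k x y)\<^sup>2 \<partial>P \<partial>powM P k)"
  proof (rule Bochner_Integration.integral_add)
    show "integrable (powM P k) (\<lambda>x. (U k x)\<^sup>2)"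
      by (rule N.integrable_bounded[where C = "((real k)\<^sup>2 * B)\<^sup>2"])
         (auto intro: U_sq_bound)
    show "integrable (powM P k) (\<lambda>x. \<integral>y. (D k x y)\<^sup>2 \<partial>P)"
      by (rule N.integrable_bounded[where C = "(real k * B)\<^sup>2"])
         (use D_int_bound[of _ k 2] in auto)
  qed
  also have "\<dots> \<le> (real k)\<^sup>2 * \<tau> + real k * \<tau>" using Suc by (simp add: D_total_second_moment)
  also have "\<dots> \<le> (real (Suc k))\<^sup>2 * \<tau>"
    using \<tau>_nonneg by (simp add: power2_eq_square algebra_simps)
  finally show ?case .
qed (simp add: U_def)

text \<open>
  Degeneracy is inherited by \<open>G\<close>, so the bounds for U-statistics apply to the off-diagonal
  part of the conditional variance as well.
\<close>

lemma G_kernel: "degenerate_kernel P G (B\<^sup>2)"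
proof
  show "(\<lambda>(x, y). G x y) \<in> borel_measurable (P \<Otimes>\<^sub>M P)" unfolding G_def by measurable
  have b: "\<bar>h x z * h y z\<bar> \<le> B\<^sup>2" for x y z
    using mult_mono[OF h_bound[of x z] h_bound[of y z]] B_nonneg by (simp add: abs_mult power2_eq_square)
  show "G x y = G y x" for x y by (simp add: G_def mult.commute)
  show "\<bar>G x y\<bar> \<le> B\<^sup>2" for x y
  proof (cases "(\<lambda>z. h x z * h y z) \<in> borel_measurable P")
    case True then show ?thesis unfolding G_def
      using norm_integral_le_bound[of "\<lambda>z. h x z * h y z" "B\<^sup>2"] b by simp
  next
    case False
    then have "\<not> integrable P (\<lambda>z. h x z * h y z)" using borel_measurable_integrable by blast
    then show ?thesis by (simp add: G_def not_integrable_integral_eq)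
  qed
  fix x assume x: "x \<in> space P"
  interpret PP: pair_prob_space P P ..
  have "(\<integral>y. G x y \<partial>P) = (\<integral>z. \<integral>y. h x z * h y z \<partial>P \<partial>P)" unfolding G_def
    using x by (intro PP.Fubini_integral[symmetric] PP.P.integrable_bounded[where C = "B\<^sup>2"]) (auto simp: b)
  also have "\<dots> = (\<integral>z. 0 \<partial>P)"
    by (intro Bochner_Integration.integral_cong) (auto simp: h_degenerate')
  finally show "(\<integral>y. G x y \<partial>P) = 0" by simp
qed

text \<open>
  Besides \<open>\<tau>\<close>, three moments control the normal approximation: \<open>m4\<close> and \<open>\<kappa>\<close> govern
  the fourth moments of the increments, \<open>\<kappa>\<close> and \<open>g2\<close> the fluctuation of their conditional variances.
\<close>

definition \<kappa> :: real where "\<kappa> = (\<integral>x. (\<integral>y. (h x y)\<^sup>2 \<partial>P)\<^sup>2 \<partial>P)"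
definition m4 :: real where "m4 = (\<integral>x. \<integral>y. (h x y) ^ 4 \<partial>P \<partial>P)"
definition g2 :: real where "g2 = (\<integral>x. \<integral>y. (G x y)\<^sup>2 \<partial>P \<partial>P)"

abbreviation V :: "nat \<Rightarrow> (nat \<Rightarrow> 'a) \<Rightarrow> real" where
  "V k x \<equiv> (\<integral>y. (D k x y)\<^sup>2 \<partial>P) - real k * \<tau>"

lemma int_hh: "x \<in> space P \<Longrightarrow> w \<in> space P \<Longrightarrow> integrable P (\<lambda>y. h x y * h w y)"
  using B_nonneg
  by (intro integrable_bounded[where C = "B * B"]) (auto simp: abs_mult intro!: mult_mono h_bound)

text \<open>
  The fluctuation \<open>V\<close> of the conditional variance splits into a sum of independent centred terms and
  a degenerate U-statistic with kernel \<open>G\<close>; both have explicit second moments.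
\<close>

lemma V_eq:
  assumes x: "x \<in> space (powM P k)"
  shows "V k x = (\<Sum>i=1..k. G (x i) (x i) - \<tau>) + 2 * degenerate_kernel.U G k x"
proof -
  interpret K: degenerate_kernel P G "B\<^sup>2" by (rule G_kernel)
  have "(\<integral>y. (D k x y)\<^sup>2 \<partial>P) = (\<integral>y. (\<Sum>i=1..k. \<Sum>j=1..k. h (x i) y * h (x j) y) \<partial>P)"
    unfolding D_def power2_eq_square sum_product ..
  also have "\<dots> = (\<Sum>i=1..k. \<Sum>j=1..k. G (x i) (x j))"
    using x unfolding G_def space_PiM PiE_iff
    by (subst Bochner_Integration.integral_sum, force intro!: Bochner_Integration.integrable_sum int_hh)
       (auto intro!: sum.cong Bochner_Integration.integral_sum int_hh)
  also have "\<dots> = (\<Sum>i=1..k. G (x i) (x i)) + 2 * K.U k x"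
    unfolding K.U_def by (rule sum_sym_split) (rule K.h_sym)
  finally show ?thesis by (simp add: sum_subtractf)
qed

lemma G_diag: "G x x = (\<integral>y. (h x y)\<^sup>2 \<partial>P)"
  by (simp add: G_def power2_eq_square)

lemma V_meas [measurable]: "V k \<in> borel_measurable (powM P k)" by measurable

lemma V_bound: "x \<in> space (powM P k) \<Longrightarrow> \<bar>V k x\<bar> \<le> (real k * B)\<^sup>2 + real k * \<bar>\<tau>\<bar>"
  using norm_integral_le_bound[of "\<lambda>y. (D k x y)\<^sup>2" "(real k * B)\<^sup>2"] D_pow_bound[of k x _ 2]
    abs_triangle_ineq4[of "\<integral>y. (D k x y)\<^sup>2 \<partial>P" "real k * \<tau>"]
  by (simp add: abs_mult)

lemma V_second_moment: "(\<integral>x. (V k x)\<^sup>2 \<partial>powM P k) \<le> 2 * real k * \<kappa> + 8 * (real k)\<^sup>2 * g2"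
proof -
  interpret K: degenerate_kernel P G "B\<^sup>2" by (rule G_kernel)
  interpret N: prob_space "powM P k" by (rule prob_space_powM)
  let ?f = "\<lambda>u. G u u - \<tau>" and ?C = "B\<^sup>2 + \<bar>\<tau>\<bar>"
  have fb: "\<bar>?f u\<bar> \<le> ?C" for u using K.h_bound[of u u] by linarith
  have intG: "integrable P (\<lambda>u. G u u)"
    by (rule integrable_bounded[where C = "B\<^sup>2"]) (auto intro: K.h_bound)
  have intG2: "integrable P (\<lambda>u. (G u u)\<^sup>2)"
    using power_mono[OF K.h_bound, where n = 2]
    by (intro integrable_bounded[where C = "(B\<^sup>2)\<^sup>2"]) auto
  have fm: "(\<integral>u. ?f u \<partial>P) = 0" using intG by (simp add: prob_space \<tau>_def G_diag)
  have fS: "(\<integral>x. (\<Sum>i=1..k. ?f (x i))\<^sup>2 \<partial>powM P k) = real k * (\<integral>u. (?f u)\<^sup>2 \<partial>P)"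
    by (rule iid_sum_second_moment[where C = ?C]) (auto intro: fb fm)
  have "(\<integral>u. (?f u)\<^sup>2 \<partial>P) = (\<integral>u. (G u u)\<^sup>2 \<partial>P) - \<tau>\<^sup>2"
    using intG intG2 by (simp add: power2_diff prob_space)
      (simp add: \<tau>_def G_diag power2_eq_square)
  then have f2: "(\<integral>u. (?f u)\<^sup>2 \<partial>P) \<le> \<kappa>" by (simp add: \<kappa>_def G_diag)
  have iS: "integrable (powM P k) (\<lambda>x. (\<Sum>i=1..k. ?f (x i))\<^sup>2)"
    using power_mono[OF abs_sum_le_bound[OF fb], where n = 2]
    by (intro N.integrable_bounded[where C = "(real k * ?C)\<^sup>2"]) auto
  have iU: "integrable (powM P k) (\<lambda>x. (K.U k x)\<^sup>2)"
    using power_mono[OF K.U_bound, where n = 2]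
    by (intro N.integrable_bounded[where C = "((real k)\<^sup>2 * B\<^sup>2)\<^sup>2"]) auto
  have "(\<integral>x. (V k x)\<^sup>2 \<partial>powM P k) \<le> (\<integral>x. 2 * (\<Sum>i=1..k. ?f (x i))\<^sup>2 + 8 * (K.U k x)\<^sup>2 \<partial>powM P k)"
  proof (rule integral_mono)
    show "integrable (powM P k) (\<lambda>x. (V k x)\<^sup>2)"
      using power_mono[OF V_bound, where n = 2]
      by (intro N.integrable_bounded[where C = "((real k * B)\<^sup>2 + real k * \<bar>\<tau>\<bar>)\<^sup>2"]) auto
    show "integrable (powM P k) (\<lambda>x. 2 * (\<Sum>i=1..k. ?f (x i))\<^sup>2 + 8 * (K.U k x)\<^sup>2)"
      using iS iU by simp
    have "(a + 2 * b)\<^sup>2 \<le> 2 * a\<^sup>2 + 8 * b\<^sup>2" for a b :: real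
      using zero_le_power2[of "a - 2 * b"] by (simp add: power2_eq_square algebra_simps)
    then show "(V k x)\<^sup>2 \<le> 2 * (\<Sum>i=1..k. ?f (x i))\<^sup>2 + 8 * (K.U k x)\<^sup>2"
      if "x \<in> space (powM P k)" for x
      unfolding V_eq[OF that] by blast
  qed
  also have "\<dots> = 2 * (real k * (\<integral>u. (?f u)\<^sup>2 \<partial>P)) + 8 * (\<integral>x. (K.U k x)\<^sup>2 \<partial>powM P k)"
    using iS iU by (simp add: fS)
  also have "\<dots> \<le> 2 * (real k * \<kappa>) + 8 * ((real k)\<^sup>2 * g2)"
    using f2 K.U_second_moment[of k] unfolding K.\<tau>_def g2_def
    by (intro add_mono mult_left_mono) auto
  finally show ?thesis by simp
qed

definition \<phi> :: "nat \<Rightarrow> real \<Rightarrow> complex" where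
  "\<phi> k t = (\<integral>x. iexp (t * U k x) \<partial>powM P k)"

text \<open>
  Conditionally on the past, \<open>E[exp(itD)]\<close> is expanded to second order: the linear term vanishes by
  degeneracy, the quadratic term is the conditional variance, here replaced by its mean
  \<open>k \<tau>\<close> at the cost of \<open>E\<bar>V\<bar>\<close>, and the cubic remainder is bounded by second and fourth
  moments.
\<close>

lemma char_step:
  assumes s: "0 < s"
  shows "cmod (\<phi> (Suc k) t - (1 - t\<^sup>2 * real k * \<tau> / 2) * \<phi> k t) \<le>
    t\<^sup>2 / 2 * (\<integral>x. \<bar>V k x\<bar> \<partial>powM P k)
    + \<bar>t\<bar> ^ 3 / 12 * (s * (real k * \<tau>) + (real k * m4 + 3 * (real k)\<^sup>2 * \<kappa>) / s)"
proof -
  interpret N: prob_space "powM P k" by (rule prob_space_powM)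
  let ?E = "\<lambda>x. \<integral>y. (s * (D k x y)\<^sup>2 + (D k x y) ^ 4 / s) / 2 \<partial>P"
  have inner: "cmod ((\<integral>y. iexp (t * D k x y) \<partial>P) - (1 - t\<^sup>2 * (\<integral>y. (D k x y)\<^sup>2 \<partial>P) / 2))
      \<le> \<bar>t\<bar> ^ 3 / 6 * ?E x" if x: "x \<in> space (powM P k)" for x
  proof -
    note [measurable] = D_meas1[OF x]
    have i1: "integrable P (\<lambda>y. iexp (t * D k x y))"
      by (rule integrable_bounded[where C = 1]) auto
    note i2 = int_D[OF x, of 1, simplified] int_D[OF x, of 2] int_D[OF x, of 4]
    have i3: "integrable P (\<lambda>y. complex_of_real (1 - t\<^sup>2 * (D k x y)\<^sup>2 / 2) + \<i> * complex_of_real (t * D k x y))"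
      using i2 by (intro Bochner_Integration.integrable_add integrable_mult_right integrable_of_real) auto
    have "(\<integral>y. complex_of_real (1 - t\<^sup>2 * (D k x y)\<^sup>2 / 2) + \<i> * complex_of_real (t * D k x y) \<partial>P)
        = complex_of_real (1 - t\<^sup>2 * (\<integral>y. (D k x y)\<^sup>2 \<partial>P) / 2) + \<i> * complex_of_real (t * (\<integral>y. D k x y \<partial>P))"
      using i2 by (simp del: of_real_diff of_real_mult of_real_divide of_real_power add: prob_space integral_complex_of_real)
    then have eq: "(\<integral>y. iexp (t * D k x y) \<partial>P) - (1 - t\<^sup>2 * (\<integral>y. (D k x y)\<^sup>2 \<partial>P) / 2)
      = (\<integral>y. iexp (t * D k x y) - (complex_of_real (1 - t\<^sup>2 * (D k x y)\<^sup>2 / 2) + \<i> * complex_of_real (t * D k x y)) \<partial>P)"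
      unfolding Bochner_Integration.integral_diff[OF i1 i3] using D_mean[OF x] by simp
    have "cmod ((\<integral>y. iexp (t * D k x y) \<partial>P) - (1 - t\<^sup>2 * (\<integral>y. (D k x y)\<^sup>2 \<partial>P) / 2)) \<le> (\<integral>y. cmod (iexp (t * D k x y) - (complex_of_real (1 - t\<^sup>2 * (D k x y)\<^sup>2 / 2) + \<i> * complex_of_real (t * D k x y))) \<partial>P)"
      unfolding eq by (rule integral_norm_bound)
    also have "\<dots> \<le> (\<integral>y. \<bar>t\<bar> ^ 3 / 6 * ((s * (D k x y)\<^sup>2 + (D k x y) ^ 4 / s) / 2) \<partial>P)"
    proof (rule integral_mono)
      fix y
      have "cmod (iexp (t * D k x y) - (complex_of_real (1 - t\<^sup>2 * (D k x y)\<^sup>2 / 2) + \<i> * complex_of_real (t * D k x y)))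
        \<le> \<bar>t * D k x y\<bar> ^ 3 / 6"
        using iexp_taylor2[of "t * D k x y"] by (simp only: power_mult_distrib)
      also have "\<dots> = \<bar>t\<bar> ^ 3 / 6 * \<bar>D k x y\<bar> ^ 3" by (simp add: abs_mult power_mult_distrib)
      also have "\<dots> \<le> \<bar>t\<bar> ^ 3 / 6 * ((s * (D k x y)\<^sup>2 + (D k x y) ^ 4 / s) / 2)"
        by (intro mult_left_mono cube_le_am_gm s) auto
      finally show "cmod (iexp (t * D k x y) - (complex_of_real (1 - t\<^sup>2 * (D k x y)\<^sup>2 / 2) + \<i> * complex_of_real (t * D k x y)))
        \<le> \<bar>t\<bar> ^ 3 / 6 * ((s * (D k x y)\<^sup>2 + (D k x y) ^ 4 / s) / 2)" .
    next
      show "integrable P (\<lambda>y. \<bar>t\<bar> ^ 3 / 6 * ((s * (D k x y)\<^sup>2 + (D k x y) ^ 4 / s) / 2))" using i2 by auto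
      show "integrable P (\<lambda>y. cmod (iexp (t * D k x y) - (complex_of_real (1 - t\<^sup>2 * (D k x y)\<^sup>2 / 2) + \<i> * complex_of_real (t * D k x y))))"
        by (intro integrable_norm Bochner_Integration.integrable_diff i1 i3)
    qed
    also have "\<dots> = \<bar>t\<bar> ^ 3 / 6 * ?E x" by simp
    finally show ?thesis .
  qed
  have Eint: "integrable (powM P k) (\<lambda>x. \<integral>y. D k x y ^ r \<partial>P)" for r
    by (rule N.integrable_bounded[where C = "(real k * B) ^ r"])
       (use D_int_bound in auto)
  have E_eq: "?E x = (s * (\<integral>y. (D k x y)\<^sup>2 \<partial>P) + (\<integral>y. (D k x y) ^ 4 \<partial>P) / s) / 2"
    if x: "x \<in> space (powM P k)" for x
    using int_D[OF x, of 2] int_D[OF x, of 4] by simp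
  have m4_int: "integrable P (\<lambda>y. \<integral>x. (h x y) ^ 4 \<partial>P)"
  proof (rule integrable_bounded[where C = "B ^ 4"])
    show "norm (\<integral>x. (h x y) ^ 4 \<partial>P) \<le> B ^ 4" if y: "y \<in> space P" for y
      using power_mono[OF h_bound, where n = 4] y by (intro norm_integral_le_bound) (auto simp: power_abs)
  qed measurable
  have k_int: "integrable P (\<lambda>y. (\<integral>x. (h x y)\<^sup>2 \<partial>P)\<^sup>2)"
  proof (rule integrable_bounded[where C = "(B\<^sup>2)\<^sup>2"])
    fix y assume y: "y \<in> space P"
    have "norm (\<integral>x. (h x y)\<^sup>2 \<partial>P) \<le> B\<^sup>2"
      using power_mono[OF h_bound, where n = 2] y by (intro norm_integral_le_bound) auto
    from power_mono[OF this, where n = 2] show "norm ((\<integral>x. (h x y)\<^sup>2 \<partial>P)\<^sup>2) \<le> (B\<^sup>2)\<^sup>2" by simp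
  qed measurable
  have "(\<integral>x. \<integral>y. (D k x y) ^ 4 \<partial>P \<partial>powM P k) \<le>
      (\<integral>y. real k * (\<integral>x. (h x y) ^ 4 \<partial>P) + 3 * (real k)\<^sup>2 * (\<integral>x. (h x y)\<^sup>2 \<partial>P)\<^sup>2 \<partial>P)"
    unfolding fubini_D
  proof (rule integral_mono)
    show "integrable P (\<lambda>y. \<integral>x. (D k x y) ^ 4 \<partial>powM P k)"
    proof (rule integrable_bounded[where C = "(real k * B) ^ 4"])
      show "norm (\<integral>x. (D k x y) ^ 4 \<partial>powM P k) \<le> (real k * B) ^ 4" if y: "y \<in> space P" for y
        using D_meas2[OF y] D_pow_bound[of k _ y 4]
        by (intro N.norm_integral_le_bound) (auto simp: power_abs)
    qed measurable
  qed (use m4_int k_int D_fourth_moment in auto)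
  also have "\<dots> = real k * m4 + 3 * (real k)\<^sup>2 * \<kappa>"
    using m4_int k_int by (simp add: m4_def \<kappa>_def h_sym)
  finally have D4: "(\<integral>x. \<integral>y. (D k x y) ^ 4 \<partial>P \<partial>powM P k) \<le> real k * m4 + 3 * (real k)\<^sup>2 * \<kappa>" .
  have "\<phi> (Suc k) t = (\<integral>x. \<integral>y. iexp (t * (U k x + D k x y)) \<partial>P \<partial>powM P k)"
    unfolding \<phi>_def by (subst integral_powM_Suc[where C = 1]) (auto simp: U_Suc_upd)
  also have "\<dots> = (\<integral>x. iexp (t * U k x) * (\<integral>y. iexp (t * D k x y) \<partial>P) \<partial>powM P k)"
    by (simp add: distrib_left exp_add)
  finally have phi_Suc: "\<phi> (Suc k) t = \<dots>" .
  have m1 [measurable]: "(\<lambda>x. \<integral>y. iexp (t * D k x y) \<partial>P) \<in> borel_measurable (powM P k)" by measurable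
  have "cmod (\<integral>y. iexp (t * D k x y) \<partial>P) \<le> 1" if x: "x \<in> space (powM P k)" for x
    using D_meas1[OF x] by (intro norm_integral_le_bound) auto
  then have i1: "integrable (powM P k) (\<lambda>x. iexp (t * U k x) * (\<integral>y. iexp (t * D k x y) \<partial>P))"
    by (intro N.integrable_bounded[where C = 1]) (auto simp: norm_mult)
  have i2: "integrable (powM P k) (\<lambda>x. (1 - t\<^sup>2 * real k * \<tau> / 2) * iexp (t * U k x))"
    by (intro N.integrable_bounded[where C = "cmod (1 - t\<^sup>2 * real k * \<tau> / 2)"]) (auto simp: norm_mult)
  have iV: "integrable (powM P k) (\<lambda>x. \<bar>V k x\<bar>)"
    by (rule N.integrable_bounded[OF _ order_trans[OF _ V_bound]]) auto
  have iE: "integrable (powM P k) ?E"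
    using Eint[of 2] Eint[of 4]  by (subst Bochner_Integration.integrable_cong[OF refl E_eq]) auto
  have eq: "\<phi> (Suc k) t - (1 - t\<^sup>2 * real k * \<tau> / 2) * \<phi> k t =
     (\<integral>x. iexp (t * U k x) * (\<integral>y. iexp (t * D k x y) \<partial>P) - (1 - t\<^sup>2 * real k * \<tau> / 2) * iexp (t * U k x) \<partial>powM P k)"
    unfolding phi_Suc using i1 i2 by (subst Bochner_Integration.integral_diff) (auto simp: \<phi>_def)
  have "cmod (\<phi> (Suc k) t - (1 - t\<^sup>2 * real k * \<tau> / 2) * \<phi> k t) \<le> (\<integral>x. cmod (iexp (t * U k x) * (\<integral>y. iexp (t * D k x y) \<partial>P) - (1 - t\<^sup>2 * real k * \<tau> / 2) * iexp (t * U k x)) \<partial>powM P k)"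
    unfolding eq by (rule integral_norm_bound)
  also have "\<dots> \<le> (\<integral>x. t\<^sup>2 / 2 * \<bar>V k x\<bar> + \<bar>t\<bar> ^ 3 / 6 * ?E x \<partial>powM P k)"
  proof (rule integral_mono)
    show "integrable (powM P k) (\<lambda>x. cmod (iexp (t * U k x) * (\<integral>y. iexp (t * D k x y) \<partial>P) - (1 - t\<^sup>2 * real k * \<tau> / 2) * iexp (t * U k x)))"
      using i1 i2 by (intro integrable_norm Bochner_Integration.integrable_diff)
    show "integrable (powM P k) (\<lambda>x. t\<^sup>2 / 2 * \<bar>V k x\<bar> + \<bar>t\<bar> ^ 3 / 6 * ?E x)"
      by (intro Bochner_Integration.integrable_add integrable_mult_right iV iE)
    fix x assume x: "x \<in> space (powM P k)"
    let ?I = "\<integral>y. iexp (t * D k x y) \<partial>P"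
    have eq: "iexp (t * U k x) * ?I - (1 - t\<^sup>2 * real k * \<tau> / 2) * iexp (t * U k x)
      = iexp (t * U k x) * ((?I - (1 - t\<^sup>2 * (\<integral>y. (D k x y)\<^sup>2 \<partial>P) / 2)) + complex_of_real (- (t\<^sup>2 / 2) * V k x))"
      by (simp add: algebra_simps)
    have "cmod (iexp (t * U k x) * ?I - (1 - t\<^sup>2 * real k * \<tau> / 2) * iexp (t * U k x)) = cmod ((?I - (1 - t\<^sup>2 * (\<integral>y. (D k x y)\<^sup>2 \<partial>P) / 2)) + complex_of_real (- (t\<^sup>2 / 2) * V k x))"
      unfolding eq by (simp only: norm_mult norm_exp_i_times mult_1)
    also have "\<dots> \<le> \<bar>t\<bar> ^ 3 / 6 * ?E x + \<bar>- (t\<^sup>2 / 2) * V k x\<bar>"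
      by (intro norm_triangle_mono inner x) (simp only: norm_of_real)
    finally show "cmod (iexp (t * U k x) * ?I - (1 - t\<^sup>2 * real k * \<tau> / 2) * iexp (t * U k x))
       \<le> t\<^sup>2 / 2 * \<bar>V k x\<bar> + \<bar>t\<bar> ^ 3 / 6 * ?E x"
      by (simp add: abs_mult)
  qed
  also have "\<dots> = t\<^sup>2 / 2 * (\<integral>x. \<bar>V k x\<bar> \<partial>powM P k) + \<bar>t\<bar> ^ 3 / 6 * (\<integral>x. ?E x \<partial>powM P k)"
    by (subst Bochner_Integration.integral_add)
       (auto intro!: integrable_mult_right iV iE simp only: integral_mult_right_zero)
  also have "\<dots> = t\<^sup>2 / 2 * (\<integral>x. \<bar>V k x\<bar> \<partial>powM P k) + \<bar>t\<bar> ^ 3 / 6 *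
      ((s * (real k * \<tau>) + (\<integral>x. \<integral>y. (D k x y) ^ 4 \<partial>P \<partial>powM P k) / s) / 2)"
  proof -
    have "(\<integral>x. ?E x \<partial>powM P k) = (s * (real k * \<tau>) + (\<integral>x. \<integral>y. (D k x y) ^ 4 \<partial>P \<partial>powM P k) / s) / 2"
    using Eint[of 2] Eint[of 4]
    by (subst Bochner_Integration.integral_cong[OF refl E_eq]) (auto simp: D_total_second_moment)
    then show ?thesis by simp
  qed
  also have "\<dots> \<le> t\<^sup>2 / 2 * (\<integral>x. \<bar>V k x\<bar> \<partial>powM P k) + \<bar>t\<bar> ^ 3 / 6 * ((s * (real k * \<tau>) + (real k * m4 + 3 * (real k)\<^sup>2 * \<kappa>) / s) / 2)"
    using s by (intro add_left_mono mult_left_mono divide_right_mono D4) auto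
  finally show ?thesis by simp
qed

lemma \<kappa>_nonneg: "0 \<le> \<kappa>" and m4_nonneg: "0 \<le> m4" and g2_nonneg: "0 \<le> g2"
  unfolding \<kappa>_def m4_def g2_def by (intro Bochner_Integration.integral_nonneg; simp)+

lemma norm_\<phi>_le_1: "cmod (\<phi> k t) \<le> 1"
proof -
  interpret N: prob_space "powM P k" by (rule prob_space_powM)
  show ?thesis unfolding \<phi>_def by (rule N.norm_integral_le_bound) auto
qed

lemma V_abs_moment:
  assumes r: "0 < r"
  shows "(\<integral>x. \<bar>V k x\<bar> \<partial>powM P k) \<le> (r + (2 * real k * \<kappa> + 8 * (real k)\<^sup>2 * g2) / r) / 2"
proof -
  interpret N: prob_space "powM P k" by (rule prob_space_powM)
  have iV: "integrable (powM P k) (\<lambda>x. \<bar>V k x\<bar>)"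
    by (rule N.integrable_bounded[OF _ order_trans[OF _ V_bound]]) auto
  have iV2: "integrable (powM P k) (\<lambda>x. (V k x)\<^sup>2)"
    using power_mono[OF V_bound, where n = 2]
    by (intro N.integrable_bounded[where C = "((real k * B)\<^sup>2 + real k * \<bar>\<tau>\<bar>)\<^sup>2"]) auto
  have "(\<integral>x. \<bar>V k x\<bar> \<partial>powM P k) \<le> (\<integral>x. (r + (V k x)\<^sup>2 / r) / 2 \<partial>powM P k)"
    using iV iV2 by (intro integral_mono abs_le_am_gm r) auto
  also have "\<dots> = (r + (\<integral>x. (V k x)\<^sup>2 \<partial>powM P k) / r) / 2"
    using iV2 by (simp add: N.prob_space)
  also have "\<dots> \<le> (r + (2 * real k * \<kappa> + 8 * (real k)\<^sup>2 * g2) / r) / 2"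
    using r by (intro divide_right_mono add_left_mono V_second_moment) auto
  finally show ?thesis .
qed

text \<open>
  The errors of the \<open>n\<close> steps add up because the factors \<open>1 - x\<close> may be replaced by
  \<open>exp(-x)\<close>, whose modulus is at most one. The last term is the cost of this replacement.
\<close>

theorem char_error_bound:
  assumes \<epsilon>: "0 < \<epsilon>" and n: "0 < n"
  shows "cmod (\<phi> n t - exp (- (t\<^sup>2 / 2) * (\<tau> * (\<Sum>k<n. real k)))) \<le>
    t\<^sup>2 / 4 * (\<epsilon> + (2 * real n ^ 3 * \<kappa> + 8 * real n ^ 4 * g2) / \<epsilon>)
    + \<bar>t\<bar> ^ 3 / 12 * (\<epsilon> * ((real n)\<^sup>2 * \<tau>) + ((real n)\<^sup>2 * m4 + 3 * real n ^ 3 * \<kappa>) / \<epsilon>)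
    + t ^ 4 * (real n ^ 3 * \<tau>\<^sup>2) / 8"
proof -
  let ?N = "real n"
  (* A bound for the error of every single step; the parameter of the bound on E\<bar>V\<bar> is
     \<epsilon> / n, since n such errors are added. *)
  define E where "E = t\<^sup>2 / 4 * (\<epsilon> / ?N + (2 * ?N * \<kappa> + 8 * ?N\<^sup>2 * g2) / (\<epsilon> / ?N))
     + \<bar>t\<bar> ^ 3 / 12 * (\<epsilon> * (?N * \<tau>) + (?N * m4 + 3 * ?N\<^sup>2 * \<kappa>) / \<epsilon>) + (t\<^sup>2 * ?N * \<tau> / 2)\<^sup>2 / 2"
  have main: "m \<le> n \<Longrightarrow> cmod (\<phi> m t - exp (- (t\<^sup>2 / 2) * (\<tau> * (\<Sum>k<m. real k)))) \<le> real m * E" for m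
  proof (induction m)
    case 0
    interpret N: prob_space "powM P 0" by (rule prob_space_powM)
    have "\<phi> 0 t = 1" unfolding \<phi>_def U_def using N.prob_space by simp
    then show ?case by simp
  next
    case (Suc m)
    let ?x = "t\<^sup>2 * real m * \<tau> / 2" and ?L = "exp (- (t\<^sup>2 / 2) * (\<tau> * (\<Sum>k<m. real k)))"
    have x0: "0 \<le> ?x" using \<tau>_nonneg by simp
    have mn: "real m \<le> ?N" using Suc.prems by simp
    have m2: "(real m)\<^sup>2 \<le> ?N\<^sup>2" using mn by (simp add: power_mono)
    have "cmod (\<phi> (Suc m) t - (1 - t\<^sup>2 * real m * \<tau> / 2) * \<phi> m t) \<le>
        t\<^sup>2 / 2 * (\<integral>x. \<bar>V m x\<bar> \<partial>powM P m)
        + \<bar>t\<bar> ^ 3 / 12 * (\<epsilon> * (real m * \<tau>) + (real m * m4 + 3 * (real m)\<^sup>2 * \<kappa>) / \<epsilon>)"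
      by (rule char_step[OF \<epsilon>])
    also have "\<dots> \<le> t\<^sup>2 / 2 * ((\<epsilon> / ?N + (2 * real m * \<kappa> + 8 * (real m)\<^sup>2 * g2) / (\<epsilon> / ?N)) / 2)
        + \<bar>t\<bar> ^ 3 / 12 * (\<epsilon> * (real m * \<tau>) + (real m * m4 + 3 * (real m)\<^sup>2 * \<kappa>) / \<epsilon>)"
      using \<epsilon> n by (intro add_right_mono mult_left_mono V_abs_moment) auto
    also have "\<dots> \<le> t\<^sup>2 / 2 * ((\<epsilon> / ?N + (2 * ?N * \<kappa> + 8 * ?N\<^sup>2 * g2) / (\<epsilon> / ?N)) / 2)
        + \<bar>t\<bar> ^ 3 / 12 * (\<epsilon> * (?N * \<tau>) + (?N * m4 + 3 * ?N\<^sup>2 * \<kappa>) / \<epsilon>)"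
      using \<epsilon> n mn m2 \<kappa>_nonneg m4_nonneg g2_nonneg \<tau>_nonneg
      by (intro add_mono mult_mono divide_right_mono order_refl) auto
    also have "\<dots> = t\<^sup>2 / 4 * (\<epsilon> / ?N + (2 * ?N * \<kappa> + 8 * ?N\<^sup>2 * g2) / (\<epsilon> / ?N))
        + \<bar>t\<bar> ^ 3 / 12 * (\<epsilon> * (?N * \<tau>) + (?N * m4 + 3 * ?N\<^sup>2 * \<kappa>) / \<epsilon>)" by simp
    finally have s1: "cmod (\<phi> (Suc m) t - (1 - ?x) * \<phi> m t) \<le> \<dots>" .
    have "cmod (complex_of_real (1 - ?x - exp (- ?x)) * \<phi> m t) \<le> ?x\<^sup>2 / 2 * 1"
      unfolding norm_mult norm_of_real
      by (intro mult_mono exp_minus_quadratic x0 norm_\<phi>_le_1) auto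
    also have "\<dots> \<le> (t\<^sup>2 * ?N * \<tau> / 2)\<^sup>2 / 2 * 1"
      using x0 mn \<tau>_nonneg by (intro mult_right_mono divide_right_mono power_mono mult_left_mono) auto
    finally have s2: "cmod (complex_of_real (1 - ?x - exp (- ?x)) * \<phi> m t) \<le> (t\<^sup>2 * ?N * \<tau> / 2)\<^sup>2 / 2" by simp
    have "cmod (complex_of_real (exp (- ?x)) * (\<phi> m t - ?L)) \<le> 1 * (real m * E)"
      unfolding norm_mult norm_of_real using x0 Suc by (intro mult_mono) auto
    then have s3: "cmod (complex_of_real (exp (- ?x)) * (\<phi> m t - ?L)) \<le> real m * E" by simp
    have "- (t\<^sup>2 / 2) * (\<tau> * (\<Sum>k<Suc m. real k)) = - ?x + - (t\<^sup>2 / 2) * (\<tau> * (\<Sum>k<m. real k))"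
      by (simp add: field_simps)
    then have "exp (- (t\<^sup>2 / 2) * (\<tau> * (\<Sum>k<Suc m. real k))) = exp (- ?x) * ?L"
      by (simp only: exp_add)
    then have "\<phi> (Suc m) t - exp (- (t\<^sup>2 / 2) * (\<tau> * (\<Sum>k<Suc m. real k))) =
       (\<phi> (Suc m) t - (1 - ?x) * \<phi> m t) +
         (complex_of_real (1 - ?x - exp (- ?x)) * \<phi> m t + complex_of_real (exp (- ?x)) * (\<phi> m t - ?L))"
      by (simp only: of_real_mult of_real_diff of_real_1) (simp add: algebra_simps)
    then have "cmod (\<phi> (Suc m) t - exp (- (t\<^sup>2 / 2) * (\<tau> * (\<Sum>k<Suc m. real k)))) \<le>
       cmod (\<phi> (Suc m) t - (1 - ?x) * \<phi> m t) +
         (cmod (complex_of_real (1 - ?x - exp (- ?x)) * \<phi> m t) + cmod (complex_of_real (exp (- ?x)) * (\<phi> m t - ?L)))"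
      by (simp only:) (intro norm_triangle_mono norm_triangle_ineq order_refl)
    also have "\<dots> \<le> E + real m * E" using add_mono[OF s1 s2, folded E_def] s3 by linarith
    finally show ?case by (simp add: algebra_simps)
  qed
  have "?N * E = t\<^sup>2 / 4 * (\<epsilon> + (2 * ?N ^ 3 * \<kappa> + 8 * ?N ^ 4 * g2) / \<epsilon>)
    + \<bar>t\<bar> ^ 3 / 12 * (\<epsilon> * (?N\<^sup>2 * \<tau>) + (?N\<^sup>2 * m4 + 3 * ?N ^ 3 * \<kappa>) / \<epsilon>)
    + t ^ 4 * (?N ^ 3 * \<tau>\<^sup>2) / 8"
    using n \<epsilon> unfolding E_def
    by (simp add: field_simps power2_eq_square power3_eq_cube power4_eq_xxxx)
  with main[of n] show ?thesis by simp
qed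

end

text \<open>
  The first hypothesis fixes the variance of the limit. The other three say that no single pair of
  variables matters, that no single variable matters, and that the conditional variances
  concentrate.
\<close>

theorem degenerate_U_statistic_clt:
  fixes P :: "nat \<Rightarrow> 'a measure" and h :: "nat \<Rightarrow> 'a \<Rightarrow> 'a \<Rightarrow> real" and v :: real
  assumes K: "\<And>n. degenerate_kernel (P n) (h n) (B n)"
    and \<tau>: "(\<lambda>n. (real n)\<^sup>2 * degenerate_kernel.\<tau> (P n) (h n) / 2) \<longlonglongrightarrow> v"
    and m4: "(\<lambda>n. (real n)\<^sup>2 * degenerate_kernel.m4 (P n) (h n)) \<longlonglongrightarrow> 0"
    and \<kappa>: "(\<lambda>n. real n ^ 3 * degenerate_kernel.\<kappa> (P n) (h n)) \<longlonglongrightarrow> 0"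
    and g2: "(\<lambda>n. real n ^ 4 * degenerate_kernel.g2 (P n) (h n)) \<longlonglongrightarrow> 0"
  shows "(\<lambda>n. degenerate_kernel.\<phi> (P n) (h n) n t) \<longlonglongrightarrow> exp (- (t\<^sup>2 / 2) * v)"
proof -
  let ?\<tau> = "\<lambda>n. degenerate_kernel.\<tau> (P n) (h n)" and ?m4 = "\<lambda>n. degenerate_kernel.m4 (P n) (h n)"
  let ?\<kappa> = "\<lambda>n. degenerate_kernel.\<kappa> (P n) (h n)" and ?g = "\<lambda>n. degenerate_kernel.g2 (P n) (h n)"
  let ?\<phi> = "\<lambda>n. degenerate_kernel.\<phi> (P n) (h n) n t"
  let ?L = "\<lambda>n. exp (- (t\<^sup>2 / 2) * (?\<tau> n * (\<Sum>k<n. real k)))"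
  define c where "c n = 2 * (real n ^ 3 * ?\<kappa> n) + 8 * (real n ^ 4 * ?g n)" for n
  define b where "b n = (real n)\<^sup>2 * ?m4 n + 3 * (real n ^ 3 * ?\<kappa> n)" for n
  (* With this choice both \<epsilon> and (c + b) / \<epsilon> vanish in the limit; the summand 1 / n only ensures
     that \<epsilon> is positive. *)
  define \<epsilon> where "\<epsilon> n = sqrt (c n + b n) + 1 / real n" for n
  have c0: "0 \<le> c n" and b0: "0 \<le> b n" for n
    using degenerate_kernel.\<kappa>_nonneg[OF K] degenerate_kernel.g2_nonneg[OF K] degenerate_kernel.m4_nonneg[OF K]
    by (auto simp: c_def b_def)
  have cb: "(\<lambda>n. sqrt (c n + b n)) \<longlonglongrightarrow> 0"
  proof -
    have "(\<lambda>n. c n + b n) \<longlonglongrightarrow> (2 * 0 + 8 * 0) + (0 + 3 * 0)"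
      unfolding c_def b_def by (intro m4 \<kappa> g2 tendsto_add tendsto_mult_left)
    from tendsto_real_sqrt[OF this] show ?thesis by simp
  qed
  have inv: "(\<lambda>n. 1 / real n) \<longlonglongrightarrow> 0" by (rule lim_1_over_n)
  have \<epsilon>: "\<epsilon> \<longlonglongrightarrow> 0" unfolding \<epsilon>_def using tendsto_add[OF cb inv] by simp
  have quot: "z / \<epsilon> n \<le> sqrt (c n + b n)" if "0 < n" "0 \<le> z" "z \<le> c n + b n" for z n
  proof -
    let ?r = "sqrt (c n + b n)"
    have "z \<le> ?r * ?r" using that by simp
    also have "\<dots> \<le> ?r * \<epsilon> n" using c0[of n] b0[of n] by (intro mult_left_mono) (auto simp: \<epsilon>_def)
    finally have "z \<le> ?r * \<epsilon> n" .
    moreover have "0 < \<epsilon> n"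
      unfolding \<epsilon>_def using that c0[of n] b0[of n] by (intro add_nonneg_pos) auto
    ultimately show ?thesis by (simp add: pos_divide_le_eq)
  qed
  have n2: "(\<lambda>n. (real n)\<^sup>2 * ?\<tau> n) \<longlonglongrightarrow> 2 * v" using tendsto_mult_left[OF \<tau>, of 2] by simp
  define R where "R n = t\<^sup>2 / 4 * (\<epsilon> n + sqrt (c n + b n))
    + \<bar>t\<bar> ^ 3 / 12 * (\<epsilon> n * ((real n)\<^sup>2 * ?\<tau> n) + sqrt (c n + b n))
    + t ^ 4 * (((real n)\<^sup>2 * ?\<tau> n)\<^sup>2 * (1 / real n)) / 8" for n
  have "R \<longlonglongrightarrow> t\<^sup>2 / 4 * (0 + 0) + \<bar>t\<bar> ^ 3 / 12 * (0 * (2 * v) + 0) + t ^ 4 * ((2 * v)\<^sup>2 * 0) / 8"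
    unfolding R_def by (intro tendsto_intros \<epsilon> cb n2 inv) auto
  then have R: "R \<longlonglongrightarrow> 0" by simp
  have "eventually (\<lambda>n. cmod (?\<phi> n - ?L n) \<le> R n) sequentially"
    using eventually_gt_at_top[of 0]
  proof eventually_elim
    case (elim n)
    interpret degenerate_kernel "P n" "h n" "B n" by (rule K)
    have e: "0 < \<epsilon> n" using elim c0[of n] b0[of n] by (auto simp: \<epsilon>_def intro!: add_nonneg_pos)
    have "cmod (\<phi> n t - ?L n) \<le> t\<^sup>2 / 4 * (\<epsilon> n + c n / \<epsilon> n)
      + \<bar>t\<bar> ^ 3 / 12 * (\<epsilon> n * ((real n)\<^sup>2 * \<tau>) + b n / \<epsilon> n) + t ^ 4 * (real n ^ 3 * \<tau>\<^sup>2) / 8"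
      using char_error_bound[OF e elim, of t] by (simp add: c_def b_def mult.assoc)
    also have "real n ^ 3 * \<tau>\<^sup>2 = ((real n)\<^sup>2 * \<tau>)\<^sup>2 * (1 / real n)"
      using elim by (simp add: power2_eq_square power3_eq_cube)
    also have "t\<^sup>2 / 4 * (\<epsilon> n + c n / \<epsilon> n) + \<bar>t\<bar> ^ 3 / 12 * (\<epsilon> n * ((real n)\<^sup>2 * \<tau>) + b n / \<epsilon> n)
       + t ^ 4 * (((real n)\<^sup>2 * \<tau>)\<^sup>2 * (1 / real n)) / 8 \<le> R n"
      unfolding R_def using elim c0 b0
      by (intro add_right_mono add_mono mult_left_mono add_left_mono quot) auto
    finally show ?case .
  qed
  then have "(\<lambda>n. ?\<phi> n - ?L n) \<longlonglongrightarrow> 0"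
    by (rule Lim_null_comparison[OF _ R])
  moreover have "?L \<longlonglongrightarrow> exp (- (t\<^sup>2 / 2) * v)"
  proof -
    have gs: "(\<Sum>k<n. real k) = ((real n)\<^sup>2 - real n) / 2" for n
      by (induction n) (auto simp: power2_eq_square field_simps)
    have "(\<lambda>n. ((real n)\<^sup>2 * ?\<tau> n) / 2 - ((real n)\<^sup>2 * ?\<tau> n) * (1 / real n) / 2) \<longlonglongrightarrow> 2 * v / 2 - (2 * v) * 0 / 2"
      by (intro tendsto_intros n2 inv) auto
    moreover have "((real n)\<^sup>2 * ?\<tau> n) / 2 - ((real n)\<^sup>2 * ?\<tau> n) * (1 / real n) / 2 = ?\<tau> n * (\<Sum>k<n. real k)" for n
      unfolding gs by (cases "n = 0") (auto simp: power2_eq_square field_simps)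
    ultimately have "(\<lambda>n. ?\<tau> n * (\<Sum>k<n. real k)) \<longlonglongrightarrow> v" by simp
    then show ?thesis by (intro tendsto_intros) 
  qed
  ultimately show ?thesis
    using tendsto_add[of "\<lambda>n. ?\<phi> n - ?L n" 0 sequentially "\<lambda>n. complex_of_real (?L n)"] tendsto_of_real
    by fastforce
qed

section \<open>Regular variation and Laplace integrals\<close>

definition tail :: "real measure \<Rightarrow> real \<Rightarrow> real" where
  "tail \<mu> x = measure \<mu> {y. \<bar>y\<bar> \<ge> x}"

text \<open>
  The slowly varying factor \<open>L\<close> cancels in ratios of tails. Only these ratios are
  used afterwards.
\<close>

lemma regularly_varying_tail:
  assumes "regularly_varying \<mu> \<alpha>"
  shows "eventually (\<lambda>x. tail \<mu> x \<noteq> 0) at_top"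
    and "\<And>c. 0 < c \<Longrightarrow> ((\<lambda>x. tail \<mu> (c * x) / tail \<mu> x) \<longlongrightarrow> c powr (- \<alpha>)) at_top"
proof -
  from assms obtain L where L: "slowly_varying L" and "tail \<mu> \<sim>[at_top] (\<lambda>x. L x * x powr (- \<alpha>))"
    by (auto simp: regularly_varying_def tail_def[abs_def])
  define g where "g x = L x * x powr (- \<alpha>)" for x
  have eq: "tail \<mu> \<sim>[at_top] g" using \<open>tail \<mu> \<sim>[at_top] _\<close> by (simp add: g_def[abs_def])
  have "((\<lambda>x. L (2 * x) / L x) \<longlongrightarrow> 1) at_top" using L by (simp add: slowly_varying_def)
  then have "eventually (\<lambda>x. L (2 * x) / L x > 0) at_top" by (rule order_tendstoD) simp
  then have L0: "eventually (\<lambda>x. L x \<noteq> 0) at_top" by eventually_elim auto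
  then have g0: "eventually (\<lambda>x. g x \<noteq> 0) at_top"
    using eventually_gt_at_top[of 0] by eventually_elim (auto simp: g_def)
  with asymp_equiv_eventually_zeros[OF eq]
  show t0: "eventually (\<lambda>x. tail \<mu> x \<noteq> 0) at_top" by eventually_elim auto
  have q: "((\<lambda>x. tail \<mu> x / g x) \<longlongrightarrow> 1) at_top"
    by (rule Lim_transform_eventually[OF asymp_equivD[OF eq]]) (use g0 in eventually_elim, auto)
  fix c :: real assume c: "0 < c"
  have m: "filterlim (\<lambda>x. c * x) at_top at_top"
    by (rule filterlim_tendsto_pos_mult_at_top[OF tendsto_const c filterlim_ident])
  have "((\<lambda>x. (tail \<mu> (c * x) / g (c * x)) * (L (c * x) / L x) * c powr (- \<alpha>) / (tail \<mu> x / g x)) \<longlongrightarrow>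
      1 * 1 * c powr (- \<alpha>) / 1) at_top"
    using L c by (intro tendsto_intros filterlim_compose[OF q m] q) (auto simp: slowly_varying_def)
  moreover have "eventually (\<lambda>x. (tail \<mu> (c * x) / g (c * x)) * (L (c * x) / L x) * c powr (- \<alpha>) / (tail \<mu> x / g x)
      = tail \<mu> (c * x) / tail \<mu> x) at_top"
    using L0 g0 t0 filterlim_iff[THEN iffD1, OF m, rule_format, OF g0] eventually_gt_at_top[of 0]
    by eventually_elim (use c in \<open>simp add: g_def powr_mult field_simps\<close>)
  ultimately show "((\<lambda>x. tail \<mu> (c * x) / tail \<mu> x) \<longlongrightarrow> c powr (- \<alpha>)) at_top"
    by (auto dest: Lim_transform_eventually)
qed

text \<open>
  The lower incomplete gamma function with integer parameter \<open>k + 1\<close>.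
\<close>

definition igam :: "nat \<Rightarrow> real \<Rightarrow> real" where
  "igam k u = (1 - (\<Sum>n\<le>k. (u ^ n * exp (- u)) / fact n)) * fact k"

lemma igam_bounds: assumes "0 \<le> u" shows "0 \<le> igam k u" "igam k u \<le> fact k"
proof -
  have le: "(\<Sum>n\<le>k. u ^ n / fact n) \<le> exp u"
  proof -
    have "(\<Sum>n\<le>k. u ^ n / fact n) \<le> (\<Sum>n. u ^ n / fact n)"
      using summable_exp[of u] assms by (intro sum_le_suminf) (auto simp: divide_inverse mult.commute)
    also have "\<dots> = exp u" by (simp add: exp_def divide_inverse mult.commute)
    finally show ?thesis .
  qed
  have s: "(\<Sum>n\<le>k. (u ^ n * exp (- u)) / fact n) = exp (- u) * (\<Sum>n\<le>k. u ^ n / fact n)"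
    by (simp add: sum_distrib_left mult.commute)
  have "(\<Sum>n\<le>k. (u ^ n * exp (- u)) / fact n) \<le> exp (- u) * exp u"
    unfolding s by (rule mult_left_mono[OF le]) simp
  then show "0 \<le> igam k u" by (simp add: igam_def exp_minus)
  have "0 \<le> (\<Sum>n\<le>k. (u ^ n * exp (- u)) / fact n)"
    using assms by (intro sum_nonneg) auto
  then show "igam k u \<le> fact k" by (simp add: igam_def mult_left_le_one_le)
qed

text \<open>
  The functions to be integrated against \<open>\<mu>\<close> are not monotone. Writing them in terms of the
  increasing functions \<open>igam k\<close> allows the tail formula to be used without signed integrands.
\<close>

lemma igam_eqs:
  "u * exp (- u) = igam 0 u - igam 1 u"
  "u\<^sup>2 * exp (- u) = 2 * igam 1 u - igam 2 u"
proof -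
  have a: "{..0::nat} = {0}" "{..1::nat} = {0, 1}" "{..2::nat} = {0, 1, 2}" by auto
  show "u * exp (- u) = igam 0 u - igam 1 u" "u\<^sup>2 * exp (- u) = 2 * igam 1 u - igam 2 u"
    by (simp_all add: igam_def a field_simps)
qed

lemma igam_meas [measurable]: "igam k \<in> borel_measurable borel"
  unfolding igam_def by measurable

lemma Gamma_density:
  fixes s :: real
  assumes "0 < s"
  shows "integrable lborel (\<lambda>y. indicator {0<..} y * (y powr (s - 1) * exp (- y)))"
    and "(\<integral>y. indicator {0<..} y * (y powr (s - 1) * exp (- y)) \<partial>lborel) = Gamma s"
proof -
  let ?f = "\<lambda>y :: real. indicator {0<..} y * (y powr (s - 1) * exp (- y))"
  have n: "(\<integral>\<^sup>+y. ennreal (?f y) \<partial>lborel) = ennreal (Gamma s)"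
    unfolding Gamma_conv_nn_integral_real[OF assms]
    by (rule nn_integral_cong) (auto simp: indicator_def exp_minus field_simps)
  show i: "integrable lborel ?f"
  proof (rule integrableI_nonneg)
    show "(\<integral>\<^sup>+y. ennreal (?f y) \<partial>lborel) < \<infinity>" unfolding n by simp
  qed (auto simp: indicator_def)
  show "integral\<^sup>L lborel ?f = Gamma s"
    using n assms by (subst integral_eq_nn_integral) (auto simp: indicator_def intro: Gamma_real_pos less_imp_le)
qed

locale rv_law = prob_space \<mu> for \<mu> :: "real measure" +
  fixes \<alpha> :: real
  assumes sets_mu [measurable_cong, simp]: "sets \<mu> = sets borel"
    and rv: "regularly_varying \<mu> \<alpha>"
    and \<alpha>: "0 < \<alpha>" "\<alpha> < 2"
begin

abbreviation T :: "real \<Rightarrow> real" where "T \<equiv> tail \<mu>"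

lemma space_mu [simp]: "space \<mu> = UNIV"
  using sets_eq_imp_space_eq[OF sets_mu] by simp

lemma T_antimono: "x \<le> y \<Longrightarrow> T y \<le> T x"
  unfolding tail_def by (rule finite_measure_mono) auto

lemma T_le_1: "T x \<le> 1" and T_nonneg: "0 \<le> T x"
  by (auto simp: tail_def)

lemma T_pos: "0 < T x"
proof -
  have "eventually (\<lambda>y. T y \<noteq> 0 \<and> x \<le> y) at_top"
    by (intro eventually_conj regularly_varying_tail[OF rv] eventually_ge_at_top)
  then obtain y where "T y \<noteq> 0" "x \<le> y" by (auto simp: eventually_at_top_linorder)
  with T_antimono[of x y] T_nonneg[of y] show ?thesis by linarith
qed

lemma T_meas [measurable]: "T \<in> borel_measurable borel"
proof -
  have "(\<lambda>x. - T x) \<in> borel_measurable borel"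
    by (rule borel_measurable_mono) (auto simp: mono_def T_antimono)
  then show ?thesis by simp
qed

text \<open>
  Any exponent strictly between \<open>\<alpha>\<close> and \<open>2\<close> would do: above \<open>\<alpha>\<close> for the bound on the tail to
  hold, below \<open>2\<close> for \<open>y powr (- \<eta> / 2)\<close> to be integrable at zero.
\<close>

definition \<eta> :: real where "\<eta> = (\<alpha> + 2) / 2"

lemma \<eta>: "\<alpha> < \<eta>" "\<eta> < 2" "0 < \<eta>" using \<alpha> by (auto simp: \<eta>_def)

text \<open>
  Beyond some \<open>x0\<close> doubling the argument leaves at least the fraction \<open>2 powr (- \<eta>)\<close>
  of the tail. Iterating this and filling the gaps between powers of two by monotonicity gives the bound
  for \<open>u \<ge> x0\<close>; smaller \<open>u\<close> are compared with \<open>x0\<close> itself.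
\<close>

lemma potter_bound:
  obtains C x0 where "0 < C" "0 < x0" "\<And>u z. x0 \<le> z \<Longrightarrow> 0 < u \<Longrightarrow> u \<le> z \<Longrightarrow> T u \<le> C * (z / u) powr \<eta> * T z"
proof -
  have "((\<lambda>x. T (2 * x) / T x) \<longlongrightarrow> 2 powr (- \<alpha>)) at_top"
    by (rule regularly_varying_tail[OF rv]) simp
  moreover have "2 powr (- \<eta>) < (2 :: real) powr (- \<alpha>)" using \<eta> by simp
  ultimately have "eventually (\<lambda>x. 2 powr (- \<eta>) < T (2 * x) / T x \<and> 0 < x) at_top"
    by (intro eventually_conj order_tendstoD eventually_gt_at_top)
  then obtain x0 where x0: "0 < x0" "\<And>x. x0 \<le> x \<Longrightarrow> 2 powr (- \<eta>) < T (2 * x) / T x"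
    by (auto simp: eventually_at_top_linorder)
  have doubling: "T u \<le> 2 powr \<eta> * T (2 * u)" if "x0 \<le> u" for u
    using x0(2)[OF that] T_pos[of u] by (simp add: field_simps powr_minus)
  have iter: "T u \<le> (2 ^ k) powr \<eta> * T (2 ^ k * u)" if u: "x0 \<le> u" for u k
  proof (induction k)
    case (Suc k)
    have "u \<le> 2 ^ k * u" using u x0(1) mult_right_mono[of 1 "2 ^ k" u] by simp
    then have "T (2 ^ k * u) \<le> 2 powr \<eta> * T (2 * (2 ^ k * u))" using u by (intro doubling) linarith
    then have "(2 ^ k) powr \<eta> * T (2 ^ k * u) \<le> (2 ^ k) powr \<eta> * (2 powr \<eta> * T (2 * (2 ^ k * u)))"
      by (rule mult_left_mono) simp
    from order_trans[OF Suc this] show ?case by (simp add: powr_mult mult_ac)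
  qed simp
  have far: "T u \<le> 2 powr \<eta> * (z / u) powr \<eta> * T z" if u: "x0 \<le> u" "u \<le> z" for u z
  proof -
    have zu: "1 \<le> z / u" using u x0(1) by simp
    (* The least number of doublings that carries u beyond z. *)
    define k where "k = nat \<lceil>log 2 (z / u)\<rceil>"
    have l0: "0 \<le> log 2 (z / u)" using zu by simp
    have "log 2 (z / u) \<le> real k" unfolding k_def by linarith
    then have k1: "z / u \<le> 2 ^ k" using zu by (simp add: log_le_iff powr_realpow)
    have "real k \<le> log 2 (z / u) + 1" unfolding k_def using l0 by linarith
    then have "2 powr real k \<le> 2 powr (log 2 (z / u) + 1)" by simp
    then have k2: "2 ^ k \<le> 2 * (z / u)" using zu by (simp add: powr_add powr_realpow mult.commute)
    have "T u \<le> (2 ^ k) powr \<eta> * T (2 ^ k * u)" by (rule iter[OF u(1)])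
    also have "\<dots> \<le> (2 * (z / u)) powr \<eta> * T z"
      using k1 k2 \<eta> u x0(1)
      by (intro mult_mono powr_mono2 T_antimono) (auto simp: T_nonneg field_simps)
    also have "(2 * (z / u)) powr \<eta> = 2 powr \<eta> * (z / u) powr \<eta>"
      by (rule powr_mult; use zu in linarith)
    finally show ?thesis .
  qed
  define C where "C = 2 powr \<eta> / T x0"
  have C0: "0 < C" using T_pos[of x0] by (simp add: C_def)
  have C1: "2 powr \<eta> \<le> C"
    using T_pos[of x0] T_le_1[of x0] mult_left_mono[of "T x0" 1 "2 powr \<eta>"] by (simp add: C_def pos_le_divide_eq)
  show thesis
  proof (rule that[OF C0 x0(1)])
    fix u z assume *: "x0 \<le> z" "0 < u" "u \<le> z"
    show "T u \<le> C * (z / u) powr \<eta> * T z"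
    proof (cases "x0 \<le> u")
      case True
      then have "T u \<le> 2 powr \<eta> * (z / u) powr \<eta> * T z" using * by (intro far)
      also have "\<dots> \<le> C * (z / u) powr \<eta> * T z"
        using C1 by (intro mult_right_mono) (auto simp: T_nonneg)
      finally show ?thesis .
    next
      case False
      have "T u \<le> T x0 / T x0" using T_le_1[of u] T_pos[of x0] by simp
      also have "\<dots> \<le> (2 powr \<eta> * (z / x0) powr \<eta> * T z) / T x0"
        using * T_pos[of x0] by (intro divide_right_mono far) auto
      also have "\<dots> = C * (z / x0) powr \<eta> * T z" by (simp add: C_def)
      also have "\<dots> \<le> C * (z / u) powr \<eta> * T z"
        using * False C0 x0(1) \<eta>
        by (intro mult_right_mono mult_left_mono powr_mono2 divide_left_mono) (auto simp: T_nonneg)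
      finally show ?thesis .
    qed
  qed
qed

abbreviation W :: "nat \<Rightarrow> real \<Rightarrow> real \<Rightarrow> real" where
  "W k t y \<equiv> indicator {0<..} y * (y ^ k * exp (- y) * T (t * sqrt y))"

lemma W_integrable: "integrable lborel (W k t)"
proof (rule Bochner_Integration.integrable_bound)
  show "integrable lborel (\<lambda>y :: real. y ^ k * exp (- y) * indicator {0..} y)"
  proof (rule integrableI_nonneg)
    show "(\<integral>\<^sup>+y. ennreal (y ^ k * exp (- y) * indicator {0..} y) \<partial>lborel) < \<infinity>"
      using nn_intergal_power_times_exp_Ici[of k]
      by (simp add: ennreal_mult'' ennreal_indicator[symmetric] del: ennreal_indicator)
  qed (auto simp: indicator_def)
  show "AE y in lborel. norm (W k t y) \<le> norm (y ^ k * exp (- y) * indicator {0..} y)"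
    by (rule AE_I2) (auto simp: indicator_def abs_mult T_nonneg T_le_1 mult_left_le_one_le intro!: mult_left_le)
qed measurable

text \<open>
  Write \<open>igam k\<close> as the integral of its derivative \<open>y ^ k * exp (- y)\<close> and exchange the integrals;
  the event \<open>y \<le> x\<^sup>2 / t\<^sup>2\<close> is \<open>\<bar>x\<bar> \<ge> t * sqrt y\<close>.
\<close>

lemma layer_cake:
  assumes t: "0 < t"
  shows "(\<integral>x. igam k (x\<^sup>2 / t\<^sup>2) \<partial>\<mu>) = (\<integral>y. W k t y \<partial>lborel)"
proof -
  interpret PL: pair_sigma_finite \<mu> lborel ..
  let ?A = "\<lambda>x y :: real. ennreal (y ^ k * exp (- y)) * indicator {0 .. x\<^sup>2 / t\<^sup>2} y"
  have A_meas: "(\<lambda>(x, y). ?A x y) \<in> borel_measurable (\<mu> \<Otimes>\<^sub>M lborel)"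
  proof -
    have "(\<lambda>(x, y). ?A x y) = (\<lambda>(x, y). ennreal (y ^ k * exp (- y)) * (if 0 \<le> y \<and> y \<le> x\<^sup>2 / t\<^sup>2 then 1 else 0))"
      by (auto simp: fun_eq_iff indicator_def)
    then show ?thesis by simp
  qed
  have "ennreal (\<integral>x. igam k (x\<^sup>2 / t\<^sup>2) \<partial>\<mu>) = (\<integral>\<^sup>+x. ennreal (igam k (x\<^sup>2 / t\<^sup>2)) \<partial>\<mu>)"
    by (rule nn_integral_eq_integral[symmetric])
       (auto intro!: integrable_const_bound[where B = "fact k"] simp: igam_bounds)
  also have "\<dots> = (\<integral>\<^sup>+x. \<integral>\<^sup>+y. ?A x y \<partial>lborel \<partial>\<mu>)"
    by (simp add: nn_intergal_power_times_exp_Icc igam_def)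
  also have "\<dots> = (\<integral>\<^sup>+y. \<integral>\<^sup>+x. ?A x y \<partial>\<mu> \<partial>lborel)"
    using PL.Fubini'[OF A_meas] by simp
  also have "\<dots> = (\<integral>\<^sup>+y. ennreal (W k t y) \<partial>lborel)"
  proof (rule nn_integral_cong_AE)
    have "AE y in lborel. y \<noteq> (0 :: real)" by (rule AE_lborel_singleton)
    then show "AE y in lborel. (\<integral>\<^sup>+x. ?A x y \<partial>\<mu>) = ennreal (W k t y)"
    proof eventually_elim
      case (elim y)
      show ?case
      proof (cases "0 < y")
        case True
        have iff: "y \<le> x\<^sup>2 / t\<^sup>2 \<longleftrightarrow> t * sqrt y \<le> \<bar>x\<bar>" for x
        proof -
          have "y \<le> x\<^sup>2 / t\<^sup>2 \<longleftrightarrow> (t * sqrt y)\<^sup>2 \<le> \<bar>x\<bar>\<^sup>2"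
            using t True by (simp add: pos_le_divide_eq power_mult_distrib mult.commute)
          also have "\<dots> \<longleftrightarrow> t * sqrt y \<le> \<bar>x\<bar>"
            using t True by (intro power_mono_iff) auto
          finally show ?thesis .
        qed
        have "(\<integral>\<^sup>+x. ?A x y \<partial>\<mu>) = (\<integral>\<^sup>+x. ennreal (y ^ k * exp (- y)) * indicator {x. t * sqrt y \<le> \<bar>x\<bar>} x \<partial>\<mu>)"
          using True by (intro nn_integral_cong) (auto simp: indicator_def iff)
        also have "\<dots> = ennreal (y ^ k * exp (- y)) * ennreal (T (t * sqrt y))"
          by (subst nn_integral_cmult_indicator) (auto simp: tail_def emeasure_eq_measure)
        finally show ?thesis using True by (simp add: ennreal_mult T_nonneg)
      qed (use elim in simp)
    qed
  qed
  also have "\<dots> = ennreal (\<integral>y. W k t y \<partial>lborel)"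
    by (rule nn_integral_eq_integral[OF W_integrable]) (auto simp: T_nonneg indicator_def)
  finally show ?thesis
    by (subst (asm) ennreal_inj)
       (auto intro!: Bochner_Integration.integral_nonneg simp: igam_bounds T_nonneg indicator_def)
qed

text \<open>
  Pointwise \<open>T (t * sqrt y) / T t\<close> tends to \<open>y powr (- \<alpha> / 2)\<close>, which leaves a gamma integral.
  The domination for \<open>y \<le> 1\<close> is Potter's bound, and for \<open>y > 1\<close> monotonicity of the tail.
\<close>

lemma W_asymptotics:
  "((\<lambda>t. (\<integral>y. W k t y \<partial>lborel) / T t) \<longlongrightarrow> Gamma (real k + 1 - \<alpha> / 2)) at_top"
proof -
  obtain C x0 where C: "0 < C" and x0: "0 < x0"
    and pot: "\<And>u z. x0 \<le> z \<Longrightarrow> 0 < u \<Longrightarrow> u \<le> z \<Longrightarrow> T u \<le> C * (z / u) powr \<eta> * T z"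
    by (rule potter_bound) blast
  let ?f = "\<lambda>y :: real. indicator {0<..} y * (y powr ((real k + 1 - \<alpha> / 2) - 1) * exp (- y))"
  let ?w = "\<lambda>y :: real. C * (indicator {0<..} y * (y powr ((real k + 1 - \<eta> / 2) - 1) * exp (- y)))
        + indicator {0<..} y * (y powr ((real k + 1) - 1) * exp (- y))"
  have "((\<lambda>t. \<integral>y. W k t y / T t \<partial>lborel) \<longlongrightarrow> (\<integral>y. ?f y \<partial>lborel)) at_top"
  proof (rule integral_dominated_convergence_at_top[where w = ?w])
    show "integrable lborel ?w"
      using \<eta> by (intro Bochner_Integration.integrable_add integrable_mult_right Gamma_density) auto
    show "\<forall>\<^sub>F t in at_top. AE y in lborel. norm (W k t y / T t) \<le> ?w y"
      using eventually_ge_at_top[of x0]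
    proof eventually_elim
      case (elim t)
      show ?case
      proof (rule AE_I2)
        fix y :: real
        show "norm (W k t y / T t) \<le> ?w y"
        proof (cases "0 < y")
          case y: True
          have "T (t * sqrt y) / T t \<le> C * y powr (- \<eta> / 2) + 1"
          proof (cases "y \<le> 1")
            case True
            have st: "t * sqrt y \<le> t" using True y elim x0 by (intro mult_left_le) auto
            have "T (t * sqrt y) \<le> C * (t / (t * sqrt y)) powr \<eta> * T t"
              using elim x0 y st by (intro pot) auto
            also have "(t / (t * sqrt y)) powr \<eta> = y powr (- \<eta> / 2)"
              using elim x0 y by (simp add: powr_half_sqrt[symmetric] powr_powr powr_minus powr_divide divide_simps)
            finally show ?thesis using T_pos[of t] by (simp add: pos_divide_le_eq algebra_simps)
          next
            case False
            then have "t \<le> t * sqrt y" using elim x0 by (intro mult_left_le_one_le mult_le_cancel_left1[THEN iffD2]) auto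
            then have "T (t * sqrt y) / T t \<le> 1" using T_pos[of t] by (simp add: T_antimono)
            moreover have "0 \<le> C * y powr (- \<eta> / 2)" using C by simp
            ultimately show ?thesis by linarith
          qed
          then have "y ^ k * exp (- y) * (T (t * sqrt y) / T t) \<le> y ^ k * exp (- y) * (C * y powr (- \<eta> / 2) + 1)"
            using y by (intro mult_left_mono) auto
          also have "\<dots> = ?w y"
          proof -
            have "y powr ((real k + 1 - \<eta> / 2) - 1) = y ^ k * y powr (- \<eta> / 2)"
              using y by (simp add: powr_realpow[symmetric] powr_add[symmetric])
            moreover have "y powr ((real k + 1) - 1) = y ^ k" using y by (simp add: powr_realpow)
            ultimately show ?thesis using y by (simp add: algebra_simps)
          qed
          finally show ?thesis using y by (simp add: T_nonneg abs_mult)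
        qed simp
      qed
    qed
    show "AE y in lborel. ((\<lambda>t. W k t y / T t) \<longlongrightarrow> ?f y) at_top"
    proof (rule AE_I2)
      fix y :: real
      show "((\<lambda>t. W k t y / T t) \<longlongrightarrow> ?f y) at_top"
      proof (cases "0 < y")
        case y: True
        have L: "((\<lambda>t. y ^ k * exp (- y) * (T (sqrt y * t) / T t)) \<longlongrightarrow> y ^ k * exp (- y) * sqrt y powr (- \<alpha>)) at_top"
          using y by (intro tendsto_mult_left regularly_varying_tail[OF rv]) simp
        have "y ^ k * sqrt y powr (- \<alpha>) = y powr ((real k + 1 - \<alpha> / 2) - 1)"
          using y by (simp add: powr_half_sqrt[symmetric] powr_powr powr_realpow[symmetric] powr_add[symmetric])
        then have eq: "y ^ k * exp (- y) * sqrt y powr (- \<alpha>) = y powr ((real k + 1 - \<alpha> / 2) - 1) * exp (- y)"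
          by (simp add: mult.commute mult.left_commute)
        from L[unfolded eq] y show ?thesis by (simp add: mult_ac)
      qed simp
    qed
  qed measurable
  then show ?thesis using Gamma_density(2)[of "real k + 1 - \<alpha> / 2"] \<alpha> by simp
qed

lemma igam_asymptotics:
  "((\<lambda>t. (\<integral>x. igam k (x\<^sup>2 / t\<^sup>2) \<partial>\<mu>) / T t) \<longlongrightarrow> Gamma (real k + 1 - \<alpha> / 2)) at_top"
  by (rule Lim_transform_eventually[OF W_asymptotics[of k]])
     (use eventually_gt_at_top[of 0] in eventually_elim, simp add: layer_cake)

lemma igam_integrable: "integrable \<mu> (\<lambda>x. igam k (x\<^sup>2 / t\<^sup>2))"
  by (rule integrable_const_bound[where B = "fact k"]) (auto simp: igam_bounds)

text \<open>
  These are \<open>-L'\<close> and \<open>L''\<close> for the Laplace transform \<open>L\<close> of the squared variable.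
\<close>

definition a :: "real \<Rightarrow> real" where "a s = (\<integral>x. x\<^sup>2 * exp (- s * x\<^sup>2) \<partial>\<mu>)"
definition b :: "real \<Rightarrow> real" where "b s = (\<integral>x. x ^ 4 * exp (- s * x\<^sup>2) \<partial>\<mu>)"

text \<open>
  With \<open>\<beta> = \<alpha>/2\<close> and \<open>s = 1/t\<^sup>2\<close>, both \<open>s * b s\<close> and \<open>a s\<close> are asymptotically
  gamma values times the same factor \<open>t\<^sup>2 * T t\<close>. The functional equation of the
  gamma function turns the quotient of these values into \<open>1 - \<beta>\<close>.
\<close>

lemma laplace_ratio_limit: "((\<lambda>s. s * b s / a s) \<longlongrightarrow> 1 - \<alpha> / 2) (at_right 0)"
proof -
  let ?I = "\<lambda>k t. \<integral>x. igam k (x\<^sup>2 / t\<^sup>2) \<partial>\<mu>"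
  define \<beta> where "\<beta> = \<alpha> / 2"
  have \<beta>: "0 < \<beta>" "\<beta> < 1" using \<alpha> by (auto simp: \<beta>_def)
  have G0: "Gamma (1 - \<beta>) > 0" using \<beta> by (intro Gamma_real_pos) auto
  have G1: "Gamma (2 - \<beta>) = (1 - \<beta>) * Gamma (1 - \<beta>)"
    using Gamma_plus1[of "1 - \<beta>"] nonpos_Ints_nonpos[of "1 - \<beta>"] \<beta> by (auto simp: algebra_simps)
  have G2: "Gamma (3 - \<beta>) = (2 - \<beta>) * (1 - \<beta>) * Gamma (1 - \<beta>)"
    using Gamma_plus1[of "2 - \<beta>"] nonpos_Ints_nonpos[of "2 - \<beta>"] \<beta> G1 by (auto simp: algebra_simps)
  have d: "Gamma (1 - \<beta>) - Gamma (2 - \<beta>) = \<beta> * Gamma (1 - \<beta>)" unfolding G1 by algebra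
  have ne: "Gamma (real 0 + 1 - \<alpha> / 2) - Gamma (real 1 + 1 - \<alpha> / 2) \<noteq> 0"
  proof -
    have "Gamma (1 - \<beta>) - Gamma (2 - \<beta>) \<noteq> 0" unfolding d using mult_pos_pos[OF \<beta>(1) G0] by linarith
    then show ?thesis by (simp add: \<beta>_def)
  qed
  have as: "a (1 / t\<^sup>2) = t\<^sup>2 * (?I 0 t - ?I 1 t)" if "0 < t" for t
  proof -
    have "?I 0 t - ?I 1 t = (\<integral>x. (x\<^sup>2 / t\<^sup>2) * exp (- (x\<^sup>2 / t\<^sup>2)) \<partial>\<mu>)"
      unfolding igam_eqs by (rule Bochner_Integration.integral_diff[symmetric]) (rule igam_integrable)+
    also have "\<dots> = (\<integral>x. (1 / t\<^sup>2) * (x\<^sup>2 * exp (- (1 / t\<^sup>2) * x\<^sup>2)) \<partial>\<mu>)" by simp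
    also have "\<dots> = a (1 / t\<^sup>2) / t\<^sup>2" unfolding a_def by (subst integral_mult_right_zero) simp
    finally show ?thesis using that by simp
  qed
  have bs: "b (1 / t\<^sup>2) = t ^ 4 * (2 * ?I 1 t - ?I 2 t)" if "0 < t" for t
  proof -
    have "2 * ?I 1 t - ?I 2 t = (\<integral>x. (x\<^sup>2 / t\<^sup>2)\<^sup>2 * exp (- (x\<^sup>2 / t\<^sup>2)) \<partial>\<mu>)"
      unfolding igam_eqs
      by (subst Bochner_Integration.integral_diff) (auto intro!: igam_integrable)
    also have "\<dots> = (\<integral>x. (1 / t ^ 4) * (x ^ 4 * exp (- (1 / t\<^sup>2) * x\<^sup>2)) \<partial>\<mu>)"
      by (simp add: power_divide flip: power_mult)
    also have "\<dots> = b (1 / t\<^sup>2) / t ^ 4" unfolding b_def by (subst integral_mult_right_zero) simp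
    finally show ?thesis using that by simp
  qed
  have "((\<lambda>t. (2 * (?I 1 t / T t) - ?I 2 t / T t) / (?I 0 t / T t - ?I 1 t / T t)) \<longlongrightarrow>
      (2 * Gamma (real 1 + 1 - \<alpha> / 2) - Gamma (real 2 + 1 - \<alpha> / 2)) /
      (Gamma (real 0 + 1 - \<alpha> / 2) - Gamma (real 1 + 1 - \<alpha> / 2))) at_top"
    by (intro tendsto_intros igam_asymptotics ne)
  also have "(2 * Gamma (real 1 + 1 - \<alpha> / 2) - Gamma (real 2 + 1 - \<alpha> / 2)) /
      (Gamma (real 0 + 1 - \<alpha> / 2) - Gamma (real 1 + 1 - \<alpha> / 2))
    = (\<beta> * (1 - \<beta>) * Gamma (1 - \<beta>)) / (\<beta> * Gamma (1 - \<beta>))"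
  proof -
    have args: "real 1 + 1 - \<alpha> / 2 = 2 - \<beta>" "real 2 + 1 - \<alpha> / 2 = 3 - \<beta>" "real 0 + 1 - \<alpha> / 2 = 1 - \<beta>"
      by (simp_all add: \<beta>_def)
    have e: "2 * Gamma (2 - \<beta>) - Gamma (3 - \<beta>) = \<beta> * (1 - \<beta>) * Gamma (1 - \<beta>)"
      unfolding G1 G2 by algebra
    show ?thesis unfolding args d e ..
  qed
  also have "\<dots> = 1 - \<beta>"
  proof -
    have "Gamma (1 - \<beta>) \<noteq> 0" using G0 by linarith
    with \<beta> show ?thesis by (simp only: nonzero_mult_div_cancel_left mult.assoc mult_divide_mult_cancel_left) simp
  qed
  also have "\<dots> = 1 - \<alpha> / 2" by (simp add: \<beta>_def)
  finally have lim: "((\<lambda>t. (2 * (?I 1 t / T t) - ?I 2 t / T t) / (?I 0 t / T t - ?I 1 t / T t)) \<longlongrightarrow> 1 - \<alpha> / 2) at_top" .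
  have "((\<lambda>t. (1 / t\<^sup>2) * b (1 / t\<^sup>2) / a (1 / t\<^sup>2)) \<longlongrightarrow> 1 - \<alpha> / 2) at_top"
  proof (rule Lim_transform_eventually[OF lim])
    show "\<forall>\<^sub>F t in at_top. (2 * (?I 1 t / T t) - ?I 2 t / T t) / (?I 0 t / T t - ?I 1 t / T t) =
        (1 / t\<^sup>2) * b (1 / t\<^sup>2) / a (1 / t\<^sup>2)"
      using eventually_gt_at_top[of 0]
    proof eventually_elim
      case (elim t)
      have "(2 * (?I 1 t / T t) - ?I 2 t / T t) / (?I 0 t / T t - ?I 1 t / T t) =
        ((2 * ?I 1 t - ?I 2 t) / T t) / ((?I 0 t - ?I 1 t) / T t)" by (simp add: diff_divide_distrib)
      also have "\<dots> = (2 * ?I 1 t - ?I 2 t) / (?I 0 t - ?I 1 t)" using T_pos[of t] by simp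
      also have "\<dots> = (1 / t\<^sup>2) * b (1 / t\<^sup>2) / a (1 / t\<^sup>2)"
        unfolding as[OF elim] bs[OF elim] using elim by (simp add: power2_eq_square power4_eq_xxxx)
      finally show ?case .
    qed
  qed
  moreover have "filterlim (\<lambda>s :: real. 1 / sqrt s) at_top (at_right 0)" by real_asymp
  ultimately have "((\<lambda>s. (1 / (1 / sqrt s)\<^sup>2) * b (1 / (1 / sqrt s)\<^sup>2) / a (1 / (1 / sqrt s)\<^sup>2)) \<longlongrightarrow> 1 - \<alpha> / 2) (at_right 0)"
    by (rule filterlim_compose)
  then show ?thesis
    by (rule Lim_transform_eventually) (auto simp: eventually_at_right_field power_divide intro!: exI[of _ 1])
qed

end

section \<open>Self-normalised sums\<close>

lemma nn_integral_power_times_exp: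
  assumes S: "0 < (S :: real)"
  shows "(\<integral>\<^sup>+s. ennreal (indicator {0<..} s * (s ^ k * exp (- s * S))) \<partial>lborel) = ennreal (fact k / S ^ Suc k)"
proof -
  have "(\<integral>\<^sup>+s. ennreal (indicator {0<..} s * (s ^ k * exp (- s * S))) \<partial>lborel) =
     (\<integral>\<^sup>+s. ennreal (fact k / S ^ Suc k) * ennreal (erlang_density k S s * s ^ 0) \<partial>lborel)"
  proof (rule nn_integral_cong_AE)
    have "AE s in lborel. s \<noteq> (0 :: real)" by (rule AE_lborel_singleton)
    then show "AE s in lborel. ennreal (indicator {0<..} s * (s ^ k * exp (- s * S))) =
        ennreal (fact k / S ^ Suc k) * ennreal (erlang_density k S s * s ^ 0)"
      by eventually_elim
        (use S in \<open>auto simp: erlang_density_def indicator_def ennreal_mult[symmetric] field_simps\<close>)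
  qed
  also have "\<dots> = ennreal (fact k / S ^ Suc k)"
    using S nn_integral_erlang_ith_moment[OF S, of k 0] by (subst nn_integral_cmult) auto
  finally show ?thesis .
qed

locale nonzero_rv_law = rv_law +
  assumes AE_nonzero: "AE x in \<mu>. x \<noteq> 0"
begin

definition lap :: "real \<Rightarrow> real" where "lap s = (\<integral>x. exp (- s * x\<^sup>2) \<partial>\<mu>)"

text \<open>
  The common form of \<open>a\<close> (for \<open>k = 0\<close>) and \<open>b\<close> (for \<open>k = 1\<close>), so that the powers \<open>1/S\<close> and
  \<open>1/S\<^sup>2\<close> are treated together.
\<close>

definition c :: "nat \<Rightarrow> real \<Rightarrow> real" where
  "c k s = (\<integral>x. (x\<^sup>2) ^ Suc k * exp (- s * x\<^sup>2) \<partial>\<mu>)"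

lemma a_eq: "a s = c 0 s" and b_eq: "b s = c 1 s"
proof -
  have "(x\<^sup>2) ^ Suc 1 = x ^ 4" for x :: real by (simp add: One_nat_def flip: power_mult)
  then show "a s = c 0 s" "b s = c 1 s" by (simp_all add: a_def b_def c_def)
qed

lemma lap_integrable: "0 \<le> s \<Longrightarrow> integrable \<mu> (\<lambda>x. exp (- s * x\<^sup>2))"
  by (rule integrable_const_bound[where B = 1]) auto

lemma c_integrable: "0 < s \<Longrightarrow> integrable \<mu> (\<lambda>x. (x\<^sup>2) ^ m * exp (- s * x\<^sup>2))"
proof (rule integrable_const_bound[where B = "fact m / s ^ m"])
  assume s: "0 < s"
  show "AE x in \<mu>. norm ((x\<^sup>2) ^ m * exp (- s * x\<^sup>2)) \<le> fact m / s ^ m"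
  proof (rule AE_I2)
    fix x :: real
    have sm: "summable (\<lambda>n. (s * x\<^sup>2) ^ n / fact n)" using summable_exp[of "s * x\<^sup>2"] by (simp add: divide_inverse mult.commute)
    have "(s * x\<^sup>2) ^ m / fact m \<le> (\<Sum>n. (s * x\<^sup>2) ^ n / fact n)"
      using sum_le_suminf[OF sm, of "{m}"] s by simp
    also have "\<dots> = exp (s * x\<^sup>2)" by (simp add: exp_def divide_inverse mult.commute)
    finally have "(s * x\<^sup>2) ^ m \<le> fact m * exp (s * x\<^sup>2)" by (simp add: field_simps)
    then show "norm ((x\<^sup>2) ^ m * exp (- s * x\<^sup>2)) \<le> fact m / s ^ m"
      using s by (simp add: exp_minus field_simps)
  qed
qed measurable

lemma c_nonneg: "0 \<le> c k s" unfolding c_def by (intro Bochner_Integration.integral_nonneg) simp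
lemma lap_nonneg: "0 \<le> lap s" unfolding lap_def by (intro Bochner_Integration.integral_nonneg) simp

lemma c_meas [measurable]: "c k \<in> borel_measurable borel"
  unfolding c_def by measurable

lemma lap_meas [measurable]: "lap \<in> borel_measurable borel"
  unfolding lap_def by measurable

lemma lap_antimono: "0 \<le> s \<Longrightarrow> s \<le> t \<Longrightarrow> lap t \<le> lap s"
  unfolding lap_def by (intro integral_mono lap_integrable) (auto intro: mult_right_mono)

lemma lap_less_1: assumes "0 < s" shows "lap s < 1"
proof -
  have "lap s < (\<integral>x. 1 \<partial>\<mu>)" unfolding lap_def
    using assms AE_nonzero emeasure_space_1
    by (intro integral_less_AE_space lap_integrable) auto
  then show ?thesis by (simp add: prob_space[simplified])
qed

abbreviation S :: "nat \<Rightarrow> (nat \<Rightarrow> real) \<Rightarrow> real" where "S p x \<equiv> \<Sum>i=1..p. (x i)\<^sup>2"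

lemma AE_S_pos: assumes "0 < p" shows "AE x in powM \<mu> p. 0 < S p x"
proof -
  have "AE x in powM \<mu> p. x 1 \<noteq> 0"
    by (rule AE_PiM_component) (use assms AE_nonzero prob_space_axioms in auto)
  then show ?thesis
  proof eventually_elim
    case (elim x)
    then have "0 < (x 1)\<^sup>2" by simp
    also have "\<dots> \<le> S p x" using assms by (intro member_le_sum) auto
    finally show ?case .
  qed
qed

text \<open>
  The density in \<open>s\<close> obtained by writing \<open>1/S\<^bsup>k+1\<^esup>\<close> as a gamma integral and using independence of
  the coordinates.
\<close>

definition F :: "nat \<Rightarrow> nat \<Rightarrow> real \<Rightarrow> real" where
  "F k p s = indicator {0<..} s * (s ^ k * (c k s * lap s ^ (p - 1)))"

lemma F_nonneg: "0 \<le> F k p s"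
  by (auto simp: F_def indicator_def c_nonneg lap_nonneg)

lemma F_meas [measurable]: "F k p \<in> borel_measurable borel" unfolding F_def by measurable

text \<open>
  Insert \<open>k! / S\<^bsup>k+1\<^esup> = \<integral> s\<^sup>k e\<^bsup>-sS\<^esup> ds\<close>, exchange the integrals, and factorise the
  expectation of \<open>x\<^sub>j\<^bsup>2k+2\<^esup> \<Prod>\<^sub>i exp(-s x\<^sub>i\<^sup>2)\<close>.
\<close>

lemma laplace_nn:
  assumes j: "j \<in> {1..p}"
  shows "(\<integral>\<^sup>+x. ennreal (fact k * ((x j)\<^sup>2 / S p x) ^ Suc k) \<partial>powM \<mu> p) = (\<integral>\<^sup>+s. ennreal (F k p s) \<partial>lborel)"
proof -
  interpret N: prob_space "powM \<mu> p" by (rule prob_space_powM)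
  interpret PS: product_sigma_finite "\<lambda>_ :: nat. \<mu>"
    by (simp add: product_sigma_finite_def sigma_finite_measure_axioms)
  interpret PL: pair_sigma_finite "powM \<mu> p" lborel ..
  let ?I = "indicator {0<..} :: real \<Rightarrow> real"
  let ?g = "\<lambda>s i y. if i = j then (y\<^sup>2) ^ Suc k * exp (- s * y\<^sup>2) else exp (- s * y\<^sup>2)"
  have p: "0 < p" using j by auto
  have "(\<integral>\<^sup>+x. ennreal (fact k * ((x j)\<^sup>2 / S p x) ^ Suc k) \<partial>powM \<mu> p) =
     (\<integral>\<^sup>+x. \<integral>\<^sup>+s. ennreal (((x j)\<^sup>2) ^ Suc k * (?I s * (s ^ k * exp (- s * S p x)))) \<partial>lborel \<partial>powM \<mu> p)"
  proof (rule nn_integral_cong_AE)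
    show "AE x in powM \<mu> p. ennreal (fact k * ((x j)\<^sup>2 / S p x) ^ Suc k) =
      (\<integral>\<^sup>+s. ennreal (((x j)\<^sup>2) ^ Suc k * (?I s * (s ^ k * exp (- s * S p x)))) \<partial>lborel)"
      using AE_S_pos[OF p]
    proof eventually_elim
      case (elim x)
      have "(\<integral>\<^sup>+s. ennreal (((x j)\<^sup>2) ^ Suc k * (?I s * (s ^ k * exp (- s * S p x)))) \<partial>lborel) =
        ennreal (((x j)\<^sup>2) ^ Suc k) * (\<integral>\<^sup>+s. ennreal (?I s * (s ^ k * exp (- s * S p x))) \<partial>lborel)"
        by (subst nn_integral_cmult[symmetric]) (auto simp: ennreal_mult'' ennreal_mult' indicator_def intro!: nn_integral_cong)
      also have "\<dots> = ennreal (((x j)\<^sup>2) ^ Suc k) * ennreal (fact k / S p x ^ Suc k)"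
        by (subst nn_integral_power_times_exp[OF elim]) simp
      also have "\<dots> = ennreal (fact k * ((x j)\<^sup>2 / S p x) ^ Suc k)"
        using elim by (subst ennreal_mult[symmetric]) (auto simp: power_divide mult_ac)
      finally show ?case by simp
    qed
  qed
  also have "\<dots> = (\<integral>\<^sup>+s. \<integral>\<^sup>+x. ennreal (((x j)\<^sup>2) ^ Suc k * (?I s * (s ^ k * exp (- s * S p x)))) \<partial>powM \<mu> p \<partial>lborel)"
    using j by (intro PL.Fubini'[symmetric]) measurable
  also have "\<dots> = (\<integral>\<^sup>+s. ennreal (F k p s) \<partial>lborel)"
  proof (rule nn_integral_cong)
    fix s :: real
    show "(\<integral>\<^sup>+x. ennreal (((x j)\<^sup>2) ^ Suc k * (?I s * (s ^ k * exp (- s * S p x)))) \<partial>powM \<mu> p) = ennreal (F k p s)"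
    proof (cases "0 < s")
      case s: True
      have pr: "((x j)\<^sup>2) ^ Suc k * exp (- s * S p x) = (\<Prod>i=1..p. ?g s i (x i))" for x
      proof -
        have "(\<Prod>i=1..p. ?g s i (x i)) = (\<Prod>i=1..p. (if i = j then ((x i)\<^sup>2) ^ Suc k else 1) * exp (- s * (x i)\<^sup>2))"
          by (intro prod.cong) auto
        also have "\<dots> = ((x j)\<^sup>2) ^ Suc k * exp (- s * S p x)"
          using j by (simp only: prod.distrib) (simp add: exp_sum[symmetric] sum_distrib_left sum_negf)
        finally show ?thesis by simp
      qed
      have gint: "integrable \<mu> (?g s i)" for i
        using c_integrable[OF s, of "Suc k"] lap_integrable[of s] s by (cases "i = j") auto
      have "(\<integral>x. (\<Prod>i=1..p. ?g s i (x i)) \<partial>powM \<mu> p) = (\<Prod>i=1..p. integral\<^sup>L \<mu> (?g s i))"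
        by (rule PS.product_integral_prod) (auto intro: gint)
      also have "\<dots> = (\<Prod>i=1..p. if i = j then c k s else lap s)"
        by (intro prod.cong) (auto simp: c_def lap_def)
      also have "\<dots> = c k s * lap s ^ (p - 1)"
        using j by (subst prod.remove[of _ j]) (auto simp: card_Diff_singleton)
      finally have e: "(\<integral>x. (\<Prod>i=1..p. ?g s i (x i)) \<partial>powM \<mu> p) = c k s * lap s ^ (p - 1)" .
      have pint: "integrable (powM \<mu> p) (\<lambda>x. \<Prod>i=1..p. ?g s i (x i))"
        by (rule PS.product_integrable_prod) (auto intro: gint)
      have "(\<integral>\<^sup>+x. ennreal (((x j)\<^sup>2) ^ Suc k * (?I s * (s ^ k * exp (- s * S p x)))) \<partial>powM \<mu> p)
         = (\<integral>\<^sup>+x. ennreal (s ^ k * (\<Prod>i=1..p. ?g s i (x i))) \<partial>powM \<mu> p)"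
        using s by (intro nn_integral_cong) (simp only: pr[symmetric], simp add: mult_ac)
      also have "\<dots> = ennreal (\<integral>x. s ^ k * (\<Prod>i=1..p. ?g s i (x i)) \<partial>powM \<mu> p)"
        using s by (intro nn_integral_eq_integral integrable_mult_right pint AE_I2 mult_nonneg_nonneg prod_nonneg) auto
      also have "\<dots> = ennreal (F k p s)"
        unfolding integral_mult_right_zero e using s by (simp add: F_def)
      finally show ?thesis .
    qed (simp add: F_def)
  qed
  finally show ?thesis .
qed

abbreviation w :: "nat \<Rightarrow> nat \<Rightarrow> (nat \<Rightarrow> real) \<Rightarrow> real" where "w p j x \<equiv> (x j)\<^sup>2 / S p x"

lemma w_bounds: assumes "j \<in> {1..p}" shows "0 \<le> w p j x" "w p j x \<le> 1"
proof -
  have 1: "(x j)\<^sup>2 \<le> S p x" using assms by (intro member_le_sum) auto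
  have 2: "0 \<le> S p x" by (rule sum_nonneg) simp
  from 1 2 show "0 \<le> w p j x" "w p j x \<le> 1" by (auto simp: divide_le_eq_1)
qed

lemma w_integrable: "j \<in> {1..p} \<Longrightarrow> integrable (powM \<mu> p) (\<lambda>x. w p j x ^ m)"
proof -
  assume j: "j \<in> {1..p}"
  interpret N: prob_space "powM \<mu> p" by (rule prob_space_powM)
  show ?thesis
  proof (rule N.integrable_bounded[where C = 1])
    show "norm (w p j x ^ m) \<le> 1" for x
      using zero_le_power[OF w_bounds(1)[OF j], of x m] power_le_one[OF w_bounds[OF j], of x m]
      by (simp only: real_norm_def abs_of_nonneg)
  qed (use j in measurable)
qed

lemma laplace:
  assumes j: "j \<in> {1..p}"
  shows "integrable lborel (F k p)"
    and "(\<integral>s. F k p s \<partial>lborel) = fact k * (\<integral>x. w p j x ^ Suc k \<partial>powM \<mu> p)"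
proof -
  have fin: "(\<integral>\<^sup>+s. ennreal (F k p s) \<partial>lborel) = ennreal (\<integral>x. fact k * w p j x ^ Suc k \<partial>powM \<mu> p)"
    unfolding laplace_nn[OF j, symmetric]
    by (intro nn_integral_eq_integral integrable_mult_right w_integrable j AE_I2
        mult_nonneg_nonneg zero_le_power w_bounds[OF j]) simp
  show i: "integrable lborel (F k p)"
    by (rule integrableI_nonneg) (auto simp: F_nonneg fin)
  have "ennreal (\<integral>s. F k p s \<partial>lborel) = ennreal (\<integral>x. fact k * w p j x ^ Suc k \<partial>powM \<mu> p)"
    unfolding fin[symmetric] by (rule nn_integral_eq_integral[symmetric, OF i]) (simp add: F_nonneg)
  moreover have "0 \<le> (\<integral>s. F k p s \<partial>lborel)"
    by (intro Bochner_Integration.integral_nonneg F_nonneg)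
  moreover have "0 \<le> (\<integral>x. fact k * w p j x ^ Suc k \<partial>powM \<mu> p)"
    by (intro Bochner_Integration.integral_nonneg mult_nonneg_nonneg zero_le_power w_bounds[OF j]) simp
  ultimately have "(\<integral>s. F k p s \<partial>lborel) = (\<integral>x. fact k * w p j x ^ Suc k \<partial>powM \<mu> p)"
    by (simp only: ennreal_inj)
  then show "(\<integral>s. F k p s \<partial>lborel) = fact k * (\<integral>x. w p j x ^ Suc k \<partial>powM \<mu> p)"
    by (simp only: integral_mult_right_zero)
qed

lemma sum_w_moments:
  assumes p: "0 < p"
  shows "real p * (\<integral>s. F 0 p s \<partial>lborel) = 1" "real p * (\<integral>s. F 1 p s \<partial>lborel) \<le> 1"
proof -
  interpret N: prob_space "powM \<mu> p" by (rule prob_space_powM)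
  have sumw: "AE x in powM \<mu> p. (\<Sum>j=1..p. w p j x) = 1"
    using AE_S_pos[OF p] by eventually_elim (simp add: sum_divide_distrib[symmetric])
  have F0: "(\<integral>s. F 0 p s \<partial>lborel) = (\<integral>x. w p j x \<partial>powM \<mu> p)" if "j \<in> {1..p}" for j
    using laplace(2)[OF that, of 0] by simp
  have F1: "(\<integral>s. F 1 p s \<partial>lborel) = (\<integral>x. w p j x ^ 2 \<partial>powM \<mu> p)" if "j \<in> {1..p}" for j
    using laplace(2)[OF that, of 1] by (simp add: numeral_2_eq_2)
  have "real p * (\<integral>s. F 0 p s \<partial>lborel) = (\<Sum>j=1..p. \<integral>x. w p j x \<partial>powM \<mu> p)"
  proof -
    have "(\<Sum>j=1..p. \<integral>x. w p j x \<partial>powM \<mu> p) = (\<Sum>j=1..p. \<integral>s. F 0 p s \<partial>lborel)"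
      by (intro sum.cong refl F0[symmetric])
    then show ?thesis by simp
  qed
  also have "\<dots> = (\<integral>x. (\<Sum>j=1..p. w p j x) \<partial>powM \<mu> p)"
    using w_integrable[of _ p 1] by (subst Bochner_Integration.integral_sum) auto
  also have "\<dots> = (\<integral>x. 1 \<partial>powM \<mu> p)" by (rule integral_cong_AE) (use sumw in auto)
  finally show *: "real p * (\<integral>s. F 0 p s \<partial>lborel) = 1" by (simp add: N.prob_space)
  have j: "1 \<in> {1..p}" using p by auto
  have "(\<integral>s. F 1 p s \<partial>lborel) \<le> (\<integral>s. F 0 p s \<partial>lborel)"
    unfolding F0[OF j] F1[OF j]
  proof (rule integral_mono)
    show "w p 1 x ^ 2 \<le> w p 1 x" for x
      unfolding power2_eq_square[of "w p 1 x"] by (intro mult_left_le w_bounds[OF j])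
  qed (use w_integrable[OF j, of 1] w_integrable[OF j, of 2] in auto)
  then show "real p * (\<integral>s. F 1 p s \<partial>lborel) \<le> 1"
    using mult_left_mono[of _ _ "real p"] * by fastforce
qed

text \<open>
  Near zero the integrand \<open>F 1 p\<close> is \<open>1 - \<alpha>/2\<close> times \<open>F 0 p\<close> up to a small factor, and
  \<open>F 0 p\<close> has mass \<open>1/p\<close>. Away from zero both are dominated by the corresponding integrands for
  two coordinates times \<open>q\<^bsup>p-2\<^esup>\<close> with \<open>q < 1\<close>, so that their contribution is exponentially small.
\<close>

theorem self_normalised_fourth_moment_limit:
  "(\<lambda>p. real p * (\<integral>x. w p 1 x ^ 2 \<partial>powM \<mu> p)) \<longlonglongrightarrow> 1 - \<alpha> / 2"
proof (rule LIMSEQ_I)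
  fix r :: real assume r: "0 < r"
  define \<beta> where "\<beta> = 1 - \<alpha> / 2"
  have \<beta>: "0 < \<beta>" "\<beta> < 1" using \<alpha> by (auto simp: \<beta>_def)
  define \<epsilon> where "\<epsilon> = r / 2"
  have \<epsilon>: "0 < \<epsilon>" using r by (simp add: \<epsilon>_def)
  from tendstoD[OF laplace_ratio_limit \<epsilon>]
  obtain \<delta> where \<delta>: "0 < \<delta>" and near: "\<And>s. 0 < s \<Longrightarrow> s < \<delta> \<Longrightarrow> dist (s * b s / a s) \<beta> < \<epsilon>"
    by (auto simp: eventually_at_right_field \<beta>_def)
  define q where "q = lap \<delta>"
  have q: "0 \<le> q" "q < 1" using lap_nonneg lap_less_1[OF \<delta>] by (auto simp: q_def)
  have a_pos: "0 < a s" if "0 < s" for s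
  proof -
    have "(\<integral>x. 0 \<partial>\<mu>) < a s" unfolding a_def
      using that AE_nonzero c_integrable[OF that, of 1] emeasure_space_1
      by (intro integral_less_AE_space) auto
    then show ?thesis by simp
  qed
  have pw: "\<bar>F 1 p s - \<beta> * F 0 p s\<bar> \<le> \<epsilon> * F 0 p s + q ^ (p - 2) * (F 1 2 s + F 0 2 s)"
    if p: "2 \<le> p" for p s
  proof (cases "0 < s")
    case s: True
    let ?l = "lap s ^ (p - 1)"
    have l0: "0 \<le> ?l" using lap_nonneg by simp
    have F0: "F 0 p s = a s * ?l" and F1: "F 1 p s = s * b s * ?l"
      using s by (simp_all add: F_def a_eq b_eq)
    show ?thesis
    proof (cases "s < \<delta>")
      case True
      have "\<bar>s * b s - \<beta> * a s\<bar> \<le> \<epsilon> * a s"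
        using near[OF s True] a_pos[OF s] by (simp add: dist_real_def abs_less_iff field_simps abs_le_iff)
      from mult_right_mono[OF this l0]
      have "\<bar>F 1 p s - \<beta> * F 0 p s\<bar> \<le> \<epsilon> * F 0 p s"
      proof -
        have "F 1 p s - \<beta> * F 0 p s = (s * b s - \<beta> * a s) * ?l" unfolding F0 F1 by algebra
        then have "\<bar>F 1 p s - \<beta> * F 0 p s\<bar> = \<bar>s * b s - \<beta> * a s\<bar> * ?l"
          by (simp only: abs_mult abs_of_nonneg[OF l0])
        with \<open>_ * ?l \<le> _\<close> show ?thesis unfolding F0 by (simp only: mult.assoc)
      qed
      moreover have "0 \<le> q ^ (p - 2) * (F 1 2 s + F 0 2 s)"
        using q F_nonneg by (intro mult_nonneg_nonneg add_nonneg_nonneg) auto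
      ultimately show ?thesis by linarith
    next
      case False
      have "p - 1 = Suc (p - 2)" using p by linarith
      then have l1: "?l = lap s * lap s ^ (p - 2)" by simp
      have "lap s ^ (p - 2) \<le> q ^ (p - 2)"
        unfolding q_def using False \<delta> lap_nonneg by (intro power_mono lap_antimono) auto
      then have l2: "?l \<le> q ^ (p - 2) * lap s"
        unfolding l1 using lap_nonneg[of s] by (simp add: mult.commute mult_left_mono)
      have b0: "0 \<le> s * b s" using s c_nonneg by (simp add: b_eq)
      have a0: "0 \<le> a s" using a_pos[OF s] by simp
      have "0 \<le> \<beta> * F 0 p s" "\<beta> * F 0 p s \<le> F 0 p s"
        using mult_nonneg_nonneg[OF less_imp_le[OF \<beta>(1)] F_nonneg] \<beta> F_nonneg
        by (blast, intro mult_left_le_one_le) auto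
      then have "\<bar>F 1 p s - \<beta> * F 0 p s\<bar> \<le> F 1 p s + F 0 p s"
        using F_nonneg[of 1 p s] by linarith
      also have "\<dots> = (s * b s + a s) * ?l" unfolding F0 F1 by (simp add: algebra_simps)
      also have "\<dots> \<le> (s * b s + a s) * (q ^ (p - 2) * lap s)"
        using a0 b0 by (intro mult_left_mono l2) auto
      also have "\<dots> = q ^ (p - 2) * (F 1 2 s + F 0 2 s)"
        using s by (simp add: F_def a_eq b_eq algebra_simps)
      finally show ?thesis using \<epsilon> F_nonneg[of 0 p s] mult_nonneg_nonneg[of \<epsilon> "F 0 p s"] by linarith
    qed
  qed (simp add: F_def)
  have bound: "\<bar>real p * (\<integral>s. F 1 p s \<partial>lborel) - \<beta>\<bar> \<le> \<epsilon> + real p * q ^ (p - 2)" if p: "2 \<le> p" for p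
  proof -
    have j: "1 \<in> {1..p}" "1 \<in> {1..2::nat}" using p by auto
    note int = laplace(1)[OF j(1)] laplace(1)[OF j(2)]
    have "\<bar>\<integral>s. F 1 p s - \<beta> * F 0 p s \<partial>lborel\<bar> \<le> (\<integral>s. \<bar>F 1 p s - \<beta> * F 0 p s\<bar> \<partial>lborel)"
      by (rule integral_abs_bound)
    also have "\<dots> \<le> (\<integral>s. \<epsilon> * F 0 p s + q ^ (p - 2) * (F 1 2 s + F 0 2 s) \<partial>lborel)"
      by (intro integral_mono pw p Bochner_Integration.integrable_add Bochner_Integration.integrable_diff
          integrable_mult_right integrable_abs int)
    also have "\<dots> = \<epsilon> * (\<integral>s. F 0 p s \<partial>lborel) + q ^ (p - 2) * ((\<integral>s. F 1 2 s \<partial>lborel) + (\<integral>s. F 0 2 s \<partial>lborel))"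
      using int by simp
    also have "\<dots> \<le> \<epsilon> * (\<integral>s. F 0 p s \<partial>lborel) + q ^ (p - 2) * 1"
      using sum_w_moments[of 2] q by (intro add_left_mono mult_left_mono) auto
    finally have le: "\<bar>(\<integral>s. F 1 p s \<partial>lborel) - \<beta> * (\<integral>s. F 0 p s \<partial>lborel)\<bar> \<le>
        \<epsilon> * (\<integral>s. F 0 p s \<partial>lborel) + q ^ (p - 2)"
      using int by simp
    have one: "real p * (\<integral>s. F 0 p s \<partial>lborel) = 1" using p by (intro sum_w_moments) simp
    have scale: "\<bar>u - \<beta> * v\<bar> \<le> \<epsilon> * v + z \<Longrightarrow> real p * v = 1 \<Longrightarrow> \<bar>real p * u - \<beta>\<bar> \<le> \<epsilon> + real p * z" for u v z
    proof -
      assume h: "\<bar>u - \<beta> * v\<bar> \<le> \<epsilon> * v + z" and v: "real p * v = 1"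
      have "real p * u - \<beta> = real p * (u - \<beta> * v)" using v by (simp add: right_diff_distrib mult.left_commute)
      then have "\<bar>real p * u - \<beta>\<bar> = real p * \<bar>u - \<beta> * v\<bar>" by (simp only: abs_mult abs_of_nat)
      also have "\<dots> \<le> real p * (\<epsilon> * v + z)" using h by (rule mult_left_mono) simp
      also have "\<dots> = \<epsilon> + real p * z" using v by (simp add: distrib_left mult.left_commute)
      finally show ?thesis .
    qed
    show ?thesis by (rule scale[OF le one])
  qed
  have "(\<lambda>p. real p * q ^ (p - 2)) \<longlonglongrightarrow> 0"
  proof (rule LIMSEQ_offset[where k = 2])
    have "(\<lambda>p. real p * q ^ p + 2 * q ^ p) \<longlonglongrightarrow> 0 + 2 * 0"
      using q by (intro tendsto_add tendsto_mult_left powser_times_n_limit_0 LIMSEQ_power_zero) auto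
    then show "(\<lambda>p. real (p + 2) * q ^ (p + 2 - 2)) \<longlonglongrightarrow> 0" by (simp add: algebra_simps)
  qed
  then have "\<exists>n0. \<forall>p\<ge>n0. norm (real p * q ^ (p - 2) - 0) < r / 2"
    by (rule LIMSEQ_D) (use r in simp)
  then obtain n0 where n0: "\<And>p. n0 \<le> p \<Longrightarrow> norm (real p * q ^ (p - 2) - 0) < r / 2"
    by blast
  show "\<exists>no. \<forall>p\<ge>no. norm (real p * (\<integral>x. w p 1 x ^ 2 \<partial>powM \<mu> p) - (1 - \<alpha> / 2)) < r"
  proof (intro exI[of _ "max 2 n0"] allI impI)
    fix p assume p: "max 2 n0 \<le> p"
    then have j: "1 \<in> {1..p}" by auto
    have "(\<integral>s. F 1 p s \<partial>lborel) = (\<integral>x. w p 1 x ^ 2 \<partial>powM \<mu> p)"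
      using laplace(2)[OF j, of 1] by (simp add: numeral_2_eq_2)
    then show "norm (real p * (\<integral>x. w p 1 x ^ 2 \<partial>powM \<mu> p) - (1 - \<alpha> / 2)) < r"
      using bound[of p] n0[of p] p unfolding \<beta>_def \<epsilon>_def by simp
  qed
qed

end

section \<open>Moments of the spherical law\<close>

locale spherical = prob_space \<mu> for \<mu> :: "real measure" +
  fixes p :: nat
  assumes sets_mu [measurable_cong, simp]: "sets \<mu> = sets borel"
    and sym: "distr \<mu> borel uminus = \<mu>"
    and AE_nonzero: "AE x in \<mu>. x \<noteq> 0"
    and p_pos: "0 < p"
begin

abbreviation Bp :: "(nat \<Rightarrow> real) measure" where "Bp \<equiv> Pi\<^sub>M {1..p} (\<lambda>_. borel)"
abbreviation N :: "(nat \<Rightarrow> real) measure" where "N \<equiv> powM \<mu> p"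
abbreviation Q :: "(nat \<Rightarrow> real) measure" where "Q \<equiv> spherical_law \<mu> p"

definition Y :: "(nat \<Rightarrow> real) \<Rightarrow> nat \<Rightarrow> real" where
  "Y x = (\<lambda>k\<in>{1..p}. x k / vec_norm p x)"

lemma space_mu [simp]: "space \<mu> = UNIV"
  using sets_eq_imp_space_eq[OF sets_mu] by simp

lemma sets_N: "sets N = sets Bp" by (intro sets_PiM_cong) auto

lemma vec_norm_meas [measurable]: "vec_norm p \<in> borel_measurable Bp"
  unfolding vec_norm_def by measurable

lemma Y_meas [measurable]: "Y \<in> Bp \<rightarrow>\<^sub>M Bp"
  unfolding Y_def by measurable

lemma Y_meas_N [measurable]: "Y \<in> N \<rightarrow>\<^sub>M Bp"
  using Y_meas measurable_cong_sets[OF sets_N refl] by blast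

lemma Q_eq: "Q = distr N Bp Y"
  by (simp add: spherical_law_def Y_def[abs_def])

lemma sets_Q [simp, measurable_cong]: "sets Q = sets Bp" by (simp add: Q_eq)

sublocale N: prob_space N by (rule prob_space_powM)
sublocale Q: prob_space Q unfolding Q_eq by (rule N.prob_space_distr) measurable

lemma AE_sphere: "AE y in Q. y \<in> unit_sphere p"
proof -
  have "AE x in N. x 1 \<noteq> 0"
    by (rule AE_PiM_component) (use p_pos AE_nonzero prob_space_axioms in auto)
  then have *: "AE x in N. Y x \<in> unit_sphere p"
  proof eventually_elim
    case (elim x)
    then have "0 < (x 1)\<^sup>2" by simp
    also have "\<dots> \<le> (\<Sum>k=1..p. (x k)\<^sup>2)" using p_pos by (intro member_le_sum) auto
    finally have S: "0 < (\<Sum>k=1..p. (x k)\<^sup>2)" .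
    have "(\<Sum>k=1..p. (Y x k)\<^sup>2) = (\<Sum>k=1..p. (x k)\<^sup>2 / (\<Sum>k=1..p. (x k)\<^sup>2))"
      using S by (intro sum.cong) (auto simp: Y_def vec_norm_def power_divide)
    also have "\<dots> = 1" using S by (simp add: sum_divide_distrib[symmetric])
    finally show ?case by (auto simp: unit_sphere_def vec_norm_def Y_def)
  qed
  have "{y \<in> space Bp. y \<in> unit_sphere p} = {y \<in> space Bp. vec_norm p y = 1}"
    by (auto simp: unit_sphere_def space_PiM PiE_def)
  also have "\<dots> \<in> sets Bp" by measurable
  finally show ?thesis unfolding Q_eq using * by (subst AE_distr_iff) auto
qed

lemma sphere_meas [measurable]: "Measurable.pred Bp (\<lambda>y. y \<in> unit_sphere p)"
proof -
  have "{y \<in> space Bp. y \<in> unit_sphere p} = {y \<in> space Bp. vec_norm p y = 1}"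
    by (auto simp: unit_sphere_def space_PiM PiE_def)
  also have "\<dots> \<in> sets Bp" by measurable
  finally show ?thesis by (simp add: pred_def)
qed

lemma sphere_sum: "y \<in> unit_sphere p \<Longrightarrow> (\<Sum>k=1..p. (y k)\<^sup>2) = 1"
  by (simp add: unit_sphere_def vec_norm_def)

lemma sphere_coord_le_1: assumes "y \<in> unit_sphere p" "k \<in> {1..p}" shows "(y k)\<^sup>2 \<le> 1" "\<bar>y k\<bar> \<le> 1"
proof -
  have "(y k)\<^sup>2 \<le> (\<Sum>k=1..p. (y k)\<^sup>2)" using assms by (intro member_le_sum) auto
  then show "(y k)\<^sup>2 \<le> 1" using sphere_sum[OF assms(1)] by simp
  then show "\<bar>y k\<bar> \<le> 1" by (simp add: abs_square_le_1)
qed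

text \<open>
  It suffices to compare the two measures on boxes.
\<close>

lemma distr_coordinatewise:
  assumes f: "\<And>i. i \<in> {1..p} \<Longrightarrow> f i \<in> borel_measurable borel" "\<And>i. i \<in> {1..p} \<Longrightarrow> distr \<mu> borel (f i) = \<mu>"
  shows "distr N N (\<lambda>x. \<lambda>i\<in>{1..p}. f i (x i)) = N"
proof -
  interpret P: product_sigma_finite "\<lambda>_ :: nat. \<mu>"
    by (simp add: product_sigma_finite_def sigma_finite_measure_axioms)
  have fm: "f i \<in> \<mu> \<rightarrow>\<^sub>M \<mu>" if "i \<in> {1..p}" for i
    using f(1)[OF that] measurable_cong_sets[OF sets_mu sets_mu] by blast
  have Fm: "(\<lambda>x. \<lambda>i\<in>{1..p}. f i (x i)) \<in> N \<rightarrow>\<^sub>M N"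
  proof (rule measurable_restrict)
    fix i assume i: "i \<in> {1..p}"
    show "(\<lambda>x. f i (x i)) \<in> N \<rightarrow>\<^sub>M \<mu>"
      using measurable_compose[OF measurable_component_singleton[OF i] fm[OF i]] .
  qed
  show ?thesis
  proof (rule P.PiM_eqI)
    fix A :: "nat \<Rightarrow> real set" assume A: "\<And>i. i \<in> {1..p} \<Longrightarrow> A i \<in> sets \<mu>"
    have "emeasure (distr N N (\<lambda>x. \<lambda>i\<in>{1..p}. f i (x i))) (Pi\<^sub>E {1..p} A)
      = emeasure N ((\<lambda>x. \<lambda>i\<in>{1..p}. f i (x i)) -` Pi\<^sub>E {1..p} A \<inter> space N)"
      using Fm A by (intro emeasure_distr) (auto intro!: sets_PiM_I_finite)
    also have "(\<lambda>x. \<lambda>i\<in>{1..p}. f i (x i)) -` Pi\<^sub>E {1..p} A \<inter> space N = Pi\<^sub>E {1..p} (\<lambda>i. f i -` A i)"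
      by (auto simp: space_PiM PiE_iff)
    also have "emeasure N \<dots> = (\<Prod>i\<in>{1..p}. emeasure \<mu> (f i -` A i))"
      using measurable_sets[OF fm A] by (intro P.emeasure_PiM) auto
    also have "\<dots> = (\<Prod>i\<in>{1..p}. emeasure \<mu> (A i))"
    proof (rule prod.cong)
      fix i assume i: "i \<in> {1..p}"
      have "emeasure \<mu> (A i) = emeasure (distr \<mu> borel (f i)) (A i)" using f(2)[OF i] by simp
      also have "\<dots> = emeasure \<mu> (f i -` A i)" using f(1)[OF i] A[OF i] by (subst emeasure_distr) auto
      finally show "emeasure \<mu> (f i -` A i) = emeasure \<mu> (A i)" ..
    qed simp
    finally show "emeasure (distr N N (\<lambda>x. \<lambda>i\<in>{1..p}. f i (x i))) (Pi\<^sub>E {1..p} A) = (\<Prod>i\<in>{1..p}. emeasure \<mu> (A i))" .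
  qed auto
qed

text \<open>
  An invariance of the product law passes to the spherical law if it commutes with
  normalisation.
\<close>

lemma invariance_transfer:
  assumes [measurable]: "t \<in> N \<rightarrow>\<^sub>M N" "t \<in> Bp \<rightarrow>\<^sub>M Bp"
    and inv: "distr N N t = N" and equi: "\<And>x. x \<in> space N \<Longrightarrow> Y (t x) = t (Y x)"
    and [measurable]: "f \<in> borel_measurable Bp"
  shows "(\<integral>y. f (t y) \<partial>Q) = (\<integral>y. (f y :: real) \<partial>Q)"
proof -
  have "(\<integral>y. f (t y) \<partial>Q) = (\<integral>x. f (t (Y x)) \<partial>N)" unfolding Q_eq by (subst integral_distr) auto
  also have "\<dots> = (\<integral>x. f (Y (t x)) \<partial>N)" by (intro Bochner_Integration.integral_cong) (auto simp: equi)
  also have "\<dots> = (\<integral>x. f (Y x) \<partial>distr N N t)" by (subst integral_distr) auto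
  also have "\<dots> = (\<integral>y. f y \<partial>Q)" unfolding inv Q_eq by (subst integral_distr) auto
  finally show ?thesis .
qed

lemma sign_flip:
  fixes f :: "(nat \<Rightarrow> real) \<Rightarrow> real"
  assumes "f \<in> borel_measurable Bp"
  shows "(\<integral>y. f (\<lambda>i\<in>{1..p}. if i = k then - y i else y i) \<partial>Q) = (\<integral>y. f y \<partial>Q)"
proof (rule invariance_transfer[OF _ _ _ _ assms])
  let ?t = "\<lambda>x :: nat \<Rightarrow> real. \<lambda>i\<in>{1..p}. if i = k then - x i else x i"
  let ?g = "\<lambda>i x :: real. if i = k then - x else x"
  show tB: "?t \<in> Bp \<rightarrow>\<^sub>M Bp" by measurable
  then show "?t \<in> N \<rightarrow>\<^sub>M N" using measurable_cong_sets[OF sets_N sets_N] by blast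
  have "distr \<mu> borel (\<lambda>x. x) = \<mu>"
    by (rule measure_eqI) (auto simp: emeasure_distr)
  then have "distr \<mu> borel (?g i) = \<mu>" for i
    using sym by (cases "i = k") auto
  then show "distr N N ?t = N"
    by (intro distr_coordinatewise[where f = ?g]) auto
  fix x
  have "vec_norm p (?t x) = vec_norm p x"
    unfolding vec_norm_def by (intro arg_cong[where f = sqrt] sum.cong) auto
  then show "Y (?t x) = ?t (Y x)" by (auto simp: Y_def fun_eq_iff)
qed

lemma permute_coords:
  fixes f :: "(nat \<Rightarrow> real) \<Rightarrow> real"
  assumes \<pi>: "\<pi> permutes {1..p}" and f: "f \<in> borel_measurable Bp"
  shows "(\<integral>y. f (\<lambda>i\<in>{1..p}. y (\<pi> i)) \<partial>Q) = (\<integral>y. f y \<partial>Q)"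
proof (rule invariance_transfer[OF _ _ _ _ f])
  let ?t = "\<lambda>x :: nat \<Rightarrow> real. \<lambda>i\<in>{1..p}. x (\<pi> i)"
  have in_I: "\<pi> i \<in> {1..p}" if "i \<in> {1..p}" for i using permutes_in_image[OF \<pi>] that by blast
  show tB: "?t \<in> Bp \<rightarrow>\<^sub>M Bp"
    by (rule measurable_restrict) (rule measurable_component_singleton[OF in_I])
  then show "?t \<in> N \<rightarrow>\<^sub>M N" using measurable_cong_sets[OF sets_N sets_N] by blast
  show "distr N N ?t = N"
    by (rule distr_PiM_reindex) (use prob_space_axioms in_I permutes_inj_on[OF \<pi>] in auto)
  fix x :: "nat \<Rightarrow> real"
  have "(\<Sum>k=1..p. (?t x k)\<^sup>2) = (\<Sum>k=1..p. (x (\<pi> k))\<^sup>2)" by (rule sum.cong) auto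
  also have "\<dots> = (\<Sum>k=1..p. (x k)\<^sup>2)" using sum.permute[OF \<pi>, of "\<lambda>k. (x k)\<^sup>2"] by (simp add: o_def)
  finally have "vec_norm p (?t x) = vec_norm p x" by (simp add: vec_norm_def)
  then show "Y (?t x) = ?t (Y x)" using in_I by (auto simp: Y_def fun_eq_iff)
qed

lemma int_monomial:
  assumes "a \<in> {1..p}" "b \<in> {1..p}" "c \<in> {1..p}" "d \<in> {1..p}"
  shows "integrable Q (\<lambda>y. y a * y b * y c * y d)" "integrable Q (\<lambda>y. y a * y b)"
proof -
  have "AE y in Q. \<bar>y a * y b * y c * y d\<bar> \<le> 1 \<and> \<bar>y a * y b\<bar> \<le> 1"
    using AE_sphere
    by eventually_elim (auto simp: abs_mult intro!: mult_le_one mult_nonneg_nonneg sphere_coord_le_1 assms)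
  then show "integrable Q (\<lambda>y. y a * y b * y c * y d)" "integrable Q (\<lambda>y. y a * y b)"
    using assms by (auto intro!: Q.integrable_const_bound[where B = 1])
qed

text \<open>
  Off the diagonal a sign flip changes the sign of the integral; on the diagonal all values agree and
  add up to one.
\<close>

lemma second_moment:
  assumes a: "a \<in> {1..p}" and b: "b \<in> {1..p}"
  shows "(\<integral>y. y a * y b \<partial>Q) = (if a = b then 1 / real p else 0)"
proof (cases "a = b")
  case False
  have "(\<integral>y. y a * y b \<partial>Q) = (\<integral>y. - (y a * y b) \<partial>Q)"
    using sign_flip[of "\<lambda>y. y a * y b" a] a b False by simp
  then show ?thesis using False by simp
next
  case True
  have eq: "(\<integral>y. y k * y k \<partial>Q) = (\<integral>y. y a * y a \<partial>Q)" if k: "k \<in> {1..p}" for k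
    using permute_coords[of "Transposition.transpose a k" "\<lambda>y. y a * y a"] permutes_swap_id[OF a k] a by simp
  have "real p * (\<integral>y. y a * y a \<partial>Q) = (\<Sum>k=1..p. \<integral>y. y k * y k \<partial>Q)"
    using eq by simp
  also have "\<dots> = (\<integral>y. (\<Sum>k=1..p. y k * y k) \<partial>Q)"
    using int_monomial(2) by (subst Bochner_Integration.integral_sum) auto
  also have "\<dots> = (\<integral>y. 1 \<partial>Q)"
    using AE_sphere sphere_sum by (intro integral_cong_AE) (auto simp: power2_eq_square)
  finally show ?thesis using True p_pos by (simp add: Q.prob_space field_simps)
qed

definition e4 :: real where "e4 = (\<integral>y. (y 1) ^ 4 \<partial>Q)"
definition e22 :: real where "e22 = (\<integral>y. (y 1)\<^sup>2 * (y 2)\<^sup>2 \<partial>Q)"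

lemma moment_4: "a \<in> {1..p} \<Longrightarrow> (\<integral>y. y a * y a * y a * y a \<partial>Q) = e4"
  using permute_coords[of "Transposition.transpose 1 a" "\<lambda>y. (y 1) ^ 4"] permutes_swap_id[of 1 "{1..p}" a] p_pos
  by (simp add: e4_def power4_eq_xxxx mult.assoc)

text \<open>
  A permutation that carries \<open>1, 2\<close> to \<open>a, b\<close> is composed of two transpositions; the second one has to
  correct where the first one sends \<open>2\<close>.
\<close>

lemma moment_22:
  assumes a: "a \<in> {1..p}" and b: "b \<in> {1..p}" and ab: "a \<noteq> b"
  shows "(\<integral>y. y a * y a * y b * y b \<partial>Q) = e22"
proof -
  have p: "1 \<in> {1..p}" "2 \<in> {1..p}" using a b ab by auto
  define c where "c = Transposition.transpose 1 a (2 :: nat)"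
  define \<pi> where "\<pi> = Transposition.transpose c b \<circ> Transposition.transpose 1 a"
  have t: "Transposition.transpose 1 a permutes {1..p}" by (rule permutes_swap_id[OF p(1) a])
  have c: "c \<in> {1..p}" using permutes_in_image[OF t] p(2) by (simp add: c_def)
  have \<pi>: "\<pi> permutes {1..p}" unfolding \<pi>_def by (intro permutes_compose t permutes_swap_id c b)
  have "c \<noteq> a" by (auto simp: c_def Transposition.transpose_def split: if_splits)
  then have 1: "\<pi> 1 = a" using ab by (simp add: \<pi>_def)
  have 2: "\<pi> 2 = b" by (simp add: \<pi>_def c_def)
  from permute_coords[OF \<pi>, of "\<lambda>y. (y 1)\<^sup>2 * (y 2)\<^sup>2"] p 1 2
  show ?thesis by (simp add: e22_def power2_eq_square mult.assoc)
qed

lemma odd_moment: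
  assumes "a \<in> {1..p}" "b \<in> {1..p}" "c \<in> {1..p}" "d \<in> {1..p}" "a \<notin> {b, c, d}"
  shows "(\<integral>y. y a * y b * y c * y d \<partial>Q) = 0"
proof -
  have "(\<integral>y. y a * y b * y c * y d \<partial>Q) = (\<integral>y. - (y a * y b * y c * y d) \<partial>Q)"
    using sign_flip[of "\<lambda>y. y a * y b * y c * y d" a] assms by simp
  then show ?thesis by simp
qed

lemma paired_moment:
  assumes "a \<in> {1..p}" "c \<in> {1..p}" "d \<in> {1..p}"
  shows "(\<integral>y. y a * y a * y c * y d \<partial>Q) = (if c = d then if a = c then e4 else e22 else 0)"
proof -
  consider "c = d" | "c \<noteq> d" "c \<noteq> a" | "c \<noteq> d" "d \<noteq> a" by blast
  then show ?thesis
  proof cases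
    case 1 then show ?thesis using moment_4[of a] moment_22[of a c] assms by auto
  next
    case 2 then show ?thesis using odd_moment[of c a a d] assms by (simp add: mult_ac)
  next
    case 3 then show ?thesis using odd_moment[of d a a c] assms by (simp add: mult_ac)
  qed
qed

text \<open>
  An index that occurs exactly once makes the moment vanish by a sign flip, so the indices
  must pair up. This is Wick's formula with the weight \<open>e22\<close>, corrected on the full diagonal.
\<close>

lemma fourth_moment_tensor:
  assumes "a \<in> {1..p}" "b \<in> {1..p}" "c \<in> {1..p}" "d \<in> {1..p}"
  shows "(\<integral>y. y a * y b * y c * y d \<partial>Q) =
    e22 * (of_bool (a = b \<and> c = d) + of_bool (a = c \<and> b = d) + of_bool (a = d \<and> b = c))
    + (e4 - 3 * e22) * of_bool (a = b \<and> a = c \<and> a = d)"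
proof -
  consider "a \<notin> {b, c, d}" | "a = b" | "a = c" | "a = d" by blast
  then show ?thesis
  proof cases
    case 1 then show ?thesis using odd_moment[OF assms] by auto
  next
    case 2 then show ?thesis using paired_moment[of a c d] assms by auto
  next
    case 3
    then show ?thesis using paired_moment[of a b d] assms by (auto simp: mult_ac)
  next
    case 4
    then show ?thesis using paired_moment[of a b c] assms by (auto simp: mult_ac)
  qed
qed

text \<open>
  Multiply the second moment of the first coordinate by \<open>\<Sum>y\<^sub>k\<^sup>2 = 1\<close>.
\<close>

lemma e_relation: assumes p: "2 \<le> p" shows "e4 + (real p - 1) * e22 = 1 / real p"
proof -
  have a: "1 \<in> {1..p}" using p by auto
  have "1 / real p = (\<integral>y. y 1 * y 1 \<partial>Q)" using second_moment[OF a a] by simp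
  also have "\<dots> = (\<integral>y. (\<Sum>k=1..p. y 1 * y 1 * y k * y k) \<partial>Q)"
  proof (rule integral_cong_AE)
    show "AE y in Q. y 1 * y 1 = (\<Sum>k=1..p. y 1 * y 1 * y k * y k)"
      using AE_sphere
    proof eventually_elim
      case (elim y)
      have "(\<Sum>k=1..p. y 1 * y 1 * y k * y k) = y 1 * y 1 * (\<Sum>k=1..p. (y k)\<^sup>2)"
        by (simp add: sum_distrib_left power2_eq_square mult.assoc)
      then show ?case using sphere_sum[OF elim] by simp
    qed
  qed (use a in measurable)
  also have "\<dots> = (\<Sum>k=1..p. \<integral>y. y 1 * y 1 * y k * y k \<partial>Q)"
    using int_monomial(1) a by (subst Bochner_Integration.integral_sum) auto
  also have "\<dots> = (\<Sum>k=1..p. if 1 = k then e4 else e22)"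
    using a by (intro sum.cong refl) (subst paired_moment, auto)
  also have "\<dots> = e4 + (\<Sum>k\<in>{1..p} - {1}. if 1 = k then e4 else e22)"
    using a by (subst sum.remove[of _ 1]) auto
  also have "(\<Sum>k\<in>{1..p} - {1}. if 1 = k then e4 else e22) = (\<Sum>k\<in>{1..p} - {1}. e22)"
    by (rule sum.cong) auto
  also have "\<dots> = (real p - 1) * e22"
    using a p by (simp add: card_Diff_singleton of_nat_diff)
  finally show ?thesis by simp
qed

lemma e4_nonneg: "0 \<le> e4" and e22_nonneg: "0 \<le> e22"
  unfolding e4_def e22_def by (intro Bochner_Integration.integral_nonneg; simp)+

lemma e4_le: assumes "2 \<le> p" shows "e4 \<le> 1 / real p"
proof -
  have "0 \<le> (real p - 1) * e22" using assms e22_nonneg by simp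
  with e_relation[OF assms] show ?thesis by linarith
qed

lemma e22_le: assumes p: "2 \<le> p" shows "e22 \<le> 2 / (real p)\<^sup>2"
proof -
  have "real p / 2 * e22 \<le> (real p - 1) * e22"
    using p e22_nonneg by (intro mult_right_mono) auto
  also have "\<dots> \<le> 1 / real p" using e_relation[OF p] e4_nonneg by linarith
  finally show ?thesis using p by (simp add: field_simps power2_eq_square)
qed

abbreviation ip :: "(nat \<Rightarrow> real) \<Rightarrow> (nat \<Rightarrow> real) \<Rightarrow> real" where "ip \<equiv> vec_inner p"

text \<open>
  The part of \<open>(x \<bullet> y)\<^sup>2\<close> that survives averaging over the signs of the coordinates.
\<close>

definition overlap :: "(nat \<Rightarrow> real) \<Rightarrow> (nat \<Rightarrow> real) \<Rightarrow> real" where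
  "overlap x y = (\<Sum>k=1..p. (x k)\<^sup>2 * (y k)\<^sup>2)"

lemma ip_sq: "(ip x y)\<^sup>2 = (\<Sum>a=1..p. \<Sum>b=1..p. x a * x b * (y a * y b))"
  by (simp add: vec_inner_def power2_eq_square sum_product mult_ac)

lemma ip_sq_mean: "(\<integral>y. (ip x y)\<^sup>2 \<partial>Q) = (\<Sum>k=1..p. (x k)\<^sup>2) / real p"
proof -
  have "(\<integral>y. (ip x y)\<^sup>2 \<partial>Q) = (\<Sum>a=1..p. \<Sum>b=1..p. x a * x b * (\<integral>y. y a * y b \<partial>Q))"
    unfolding ip_sq using int_monomial(2)
    by (subst Bochner_Integration.integral_sum, force intro!: Bochner_Integration.integrable_sum integrable_mult_right)
       (auto intro!: sum.cong simp: Bochner_Integration.integral_sum)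
  also have "\<dots> = (\<Sum>a=1..p. \<Sum>b=1..p. if a = b then x a * x a / real p else 0)"
    by (intro sum.cong refl) (auto simp: second_moment)
  also have "\<dots> = (\<Sum>a=1..p. (x a)\<^sup>2 / real p)"
    by (intro sum.cong refl) (simp add: power2_eq_square)
  finally show ?thesis by (simp add: sum_divide_distrib)
qed

text \<open>
  The moment tensor is contracted with \<open>x \<otimes> x \<otimes> z \<otimes> z\<close>. The three pairings give
  \<open>\<bar>x\<bar>\<^sup>2 \<bar>z\<bar>\<^sup>2 = 1\<close> and twice \<open>(x \<bullet> z)\<^sup>2\<close>, the full diagonal gives the overlap.
\<close>

lemma ip_sq_product_mean:
  assumes x: "x \<in> unit_sphere p" and z: "z \<in> unit_sphere p"
  shows "(\<integral>y. (ip x y)\<^sup>2 * (ip z y)\<^sup>2 \<partial>Q) = e22 * (1 + 2 * (ip x z)\<^sup>2) + (e4 - 3 * e22) * overlap x z"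
proof -
  let ?I = "{1..p}"
  let ?c = "\<lambda>a b c d. x a * x b * z c * z d"
  have "(ip x y)\<^sup>2 * (ip z y)\<^sup>2 = (\<Sum>a\<in>?I. \<Sum>b\<in>?I. \<Sum>c\<in>?I. \<Sum>d\<in>?I. ?c a b c d * (y a * y b * y c * y d))" for y
    unfolding ip_sq by (simp only: sum_distrib_right, simp only: sum_distrib_left) (simp only: mult_ac)
  then have "(\<integral>y. (ip x y)\<^sup>2 * (ip z y)\<^sup>2 \<partial>Q) = (\<integral>y. (\<Sum>a\<in>?I. \<Sum>b\<in>?I. \<Sum>c\<in>?I. \<Sum>d\<in>?I. ?c a b c d * (y a * y b * y c * y d)) \<partial>Q)"
    by simp
  also have "\<dots> = (\<Sum>a\<in>?I. \<Sum>b\<in>?I. \<Sum>c\<in>?I. \<Sum>d\<in>?I. ?c a b c d * (\<integral>y. y a * y b * y c * y d \<partial>Q))"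
    by (rule trans[OF Bochner_Integration.integral_sum],
        (intro Bochner_Integration.integrable_sum integrable_mult_right int_monomial(1); assumption),
        rule sum.cong[OF refl])+ simp
  also have "\<dots> = (\<Sum>a\<in>?I. \<Sum>b\<in>?I. \<Sum>c\<in>?I. \<Sum>d\<in>?I.
      e22 * ((if a = b then if c = d then ?c a b c d else 0 else 0)
           + (if a = c then if b = d then ?c a b c d else 0 else 0)
           + (if a = d then if b = c then ?c a b c d else 0 else 0))
      + (e4 - 3 * e22) * (if a = b then if a = c then if a = d then ?c a b c d else 0 else 0 else 0))"
    by (intro sum.cong refl, subst fourth_moment_tensor) (auto simp: algebra_simps)
  also have "\<dots> = e22 * ((\<Sum>a\<in>?I. \<Sum>c\<in>?I. ?c a a c c) + (\<Sum>a\<in>?I. \<Sum>b\<in>?I. ?c a b a b) + (\<Sum>a\<in>?I. \<Sum>b\<in>?I. ?c a b b a))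
      + (e4 - 3 * e22) * (\<Sum>a\<in>?I. ?c a a a a)"
  proof -
    have 1: "(\<Sum>a\<in>?I. \<Sum>b\<in>?I. \<Sum>c\<in>?I. \<Sum>d\<in>?I. if a = b then if c = d then ?c a b c d else 0 else 0) = (\<Sum>a\<in>?I. \<Sum>c\<in>?I. ?c a a c c)"
    proof (rule sum.cong[OF refl])
      fix a assume a: "a \<in> ?I"
      have "(\<Sum>b\<in>?I. \<Sum>c\<in>?I. \<Sum>d\<in>?I. if a = b then if c = d then ?c a b c d else 0 else 0) =
        (\<Sum>b\<in>?I. if a = b then \<Sum>c\<in>?I. ?c a b c c else 0)"
        by (intro sum.cong refl) auto
      then show "(\<Sum>b\<in>?I. \<Sum>c\<in>?I. \<Sum>d\<in>?I. if a = b then if c = d then ?c a b c d else 0 else 0) = (\<Sum>c\<in>?I. ?c a a c c)"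
        using a by simp
    qed
    have 2: "(\<Sum>a\<in>?I. \<Sum>b\<in>?I. \<Sum>c\<in>?I. \<Sum>d\<in>?I. if a = c then if b = d then ?c a b c d else 0 else 0) = (\<Sum>a\<in>?I. \<Sum>b\<in>?I. ?c a b a b)"
    proof (intro sum.cong refl)
      fix a b assume a: "a \<in> ?I" and b: "b \<in> ?I"
      have "(\<Sum>c\<in>?I. \<Sum>d\<in>?I. if a = c then if b = d then ?c a b c d else 0 else 0) =
        (\<Sum>c\<in>?I. if a = c then ?c a b c b else 0)"
        using b by (intro sum.cong refl) auto
      then show "(\<Sum>c\<in>?I. \<Sum>d\<in>?I. if a = c then if b = d then ?c a b c d else 0 else 0) = ?c a b a b"
        using a by simp
    qed
    have 3: "(\<Sum>a\<in>?I. \<Sum>b\<in>?I. \<Sum>c\<in>?I. \<Sum>d\<in>?I. if a = d then if b = c then ?c a b c d else 0 else 0) = (\<Sum>a\<in>?I. \<Sum>b\<in>?I. ?c a b b a)"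
    proof (intro sum.cong refl)
      fix a b assume a: "a \<in> ?I" and b: "b \<in> ?I"
      have "(\<Sum>c\<in>?I. \<Sum>d\<in>?I. if a = d then if b = c then ?c a b c d else 0 else 0) =
        (\<Sum>c\<in>?I. if b = c then ?c a b c a else 0)"
        using a by (intro sum.cong refl) auto
      then show "(\<Sum>c\<in>?I. \<Sum>d\<in>?I. if a = d then if b = c then ?c a b c d else 0 else 0) = ?c a b b a"
        using b by simp
    qed
    have 4: "(\<Sum>a\<in>?I. \<Sum>b\<in>?I. \<Sum>c\<in>?I. \<Sum>d\<in>?I. if a = b then if a = c then if a = d then ?c a b c d else 0 else 0 else 0) = (\<Sum>a\<in>?I. ?c a a a a)"
    proof (intro sum.cong refl)
      fix a assume a: "a \<in> ?I"
      have d: "(\<Sum>d\<in>?I. if a = b then if a = c then if a = d then ?c a b c d else 0 else 0 else 0) =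
          (if a = c then if a = b then ?c a b c a else 0 else 0)" for b c
        using a by (cases "a = b"; cases "a = c"; simp)
      have c: "(\<Sum>c\<in>?I. if a = c then if a = b then ?c a b c a else 0 else 0) =
          (if a = b then ?c a b a a else 0)" for b using a by simp
      show "(\<Sum>b\<in>?I. \<Sum>c\<in>?I. \<Sum>d\<in>?I. if a = b then if a = c then if a = d then ?c a b c d else 0 else 0 else 0) = ?c a a a a"
        using a by (simp only: d c) simp
    qed
    show ?thesis by (simp only: sum.distrib sum_distrib_left[symmetric] 1 2 3 4)
  qed
  also have "(\<Sum>a\<in>?I. \<Sum>c\<in>?I. ?c a a c c) = 1"
  proof -
    have "(\<Sum>a\<in>?I. \<Sum>c\<in>?I. ?c a a c c) = (\<Sum>a\<in>?I. (x a)\<^sup>2) * (\<Sum>c\<in>?I. (z c)\<^sup>2)"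
      by (simp add: sum_product power2_eq_square mult_ac)
    then show ?thesis using sphere_sum x z by simp
  qed
  also have "(\<Sum>a\<in>?I. \<Sum>b\<in>?I. ?c a b a b) = (ip x z)\<^sup>2" by (simp add: ip_sq mult_ac)
  also have "(\<Sum>a\<in>?I. \<Sum>b\<in>?I. ?c a b b a) = (ip x z)\<^sup>2" by (simp add: ip_sq mult_ac)
  also have "(\<Sum>a\<in>?I. ?c a a a a) = overlap x z"
    by (simp add: overlap_def power2_eq_square mult_ac)
  finally show ?thesis by simp
qed

lemma ip_sq_le_1: assumes x: "x \<in> unit_sphere p" and y: "y \<in> unit_sphere p" shows "(ip x y)\<^sup>2 \<le> 1"
  using Cauchy_Schwarz_ineq_sum[of x y "{1..p}"] sphere_sum[OF x] sphere_sum[OF y]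
  by (simp add: vec_inner_def)

lemma overlap_bounds: assumes x: "x \<in> unit_sphere p" and y: "y \<in> unit_sphere p"
  shows "0 \<le> overlap x y" "overlap x y \<le> 1"
proof -
  show "0 \<le> overlap x y" unfolding overlap_def by (intro sum_nonneg) simp
  have "overlap x y \<le> (\<Sum>k=1..p. (x k)\<^sup>2 * 1)"
    unfolding overlap_def using sphere_coord_le_1[OF y] by (intro sum_mono mult_left_mono) auto
  then show "overlap x y \<le> 1" using sphere_sum[OF x] by simp
qed

lemma overlap_mean: assumes x: "x \<in> unit_sphere p" shows "(\<integral>y. overlap x y \<partial>Q) = 1 / real p"
proof -
  have "(\<integral>y. overlap x y \<partial>Q) = (\<Sum>k=1..p. (x k)\<^sup>2 * (\<integral>y. y k * y k \<partial>Q))"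
    unfolding overlap_def using int_monomial(2)
    by (subst Bochner_Integration.integral_sum) (auto simp: power2_eq_square)
  also have "\<dots> = (\<Sum>k=1..p. (x k)\<^sup>2 * (1 / real p))"
    by (intro sum.cong refl) (simp add: second_moment)
  also have "\<dots> = 1 / real p" unfolding sum_distrib_right[symmetric] using sphere_sum[OF x] by simp
  finally show ?thesis .
qed

lemma self_overlap_mean: "(\<integral>x. overlap x x \<partial>Q) = real p * e4"
proof -
  have "(\<integral>x. overlap x x \<partial>Q) = (\<Sum>k=1..p. \<integral>y. y k * y k * y k * y k \<partial>Q)"
    unfolding overlap_def using int_monomial(1)
    by (subst Bochner_Integration.integral_sum) (auto simp: power2_eq_square mult.assoc)
  also have "\<dots> = (\<Sum>k=1..p. e4)" by (intro sum.cong refl moment_4)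
  finally show ?thesis by simp
qed

end

section \<open>The kernel of squared inner products\<close>

context spherical
begin

text \<open>
  Off the sphere, a null set, the kernel is set to zero. This makes it bounded and degenerate at every
  point, not only almost everywhere. The factor \<open>c\<close> will be \<open>1/\<surd>n\<close>.
\<close>

definition ker :: "real \<Rightarrow> (nat \<Rightarrow> real) \<Rightarrow> (nat \<Rightarrow> real) \<Rightarrow> real" where
  "ker c x y = c * (if x \<in> unit_sphere p \<and> y \<in> unit_sphere p then (ip x y)\<^sup>2 - 1 / real p else 0)"

lemma ip_meas [measurable (raw)]:
  assumes [measurable]: "f \<in> L \<rightarrow>\<^sub>M Bp" "g \<in> L \<rightarrow>\<^sub>M Bp"
  shows "(\<lambda>z. ip (f z) (g z)) \<in> borel_measurable L"
  unfolding vec_inner_def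
  by (intro borel_measurable_sum borel_measurable_times)
     (auto intro!: measurable_compose[OF _ measurable_component_singleton] assms)

lemma ip_commute: "ip x y = ip y x" by (simp add: vec_inner_def mult.commute)

lemma ker_bound: assumes "0 \<le> c" shows "\<bar>ker c x y\<bar> \<le> c"
proof (cases "x \<in> unit_sphere p \<and> y \<in> unit_sphere p")
  case True
  have "1 / real p \<le> 1" "0 \<le> 1 / real p" using p_pos by (auto simp: divide_le_eq)
  moreover have "0 \<le> (ip x y)\<^sup>2" "(ip x y)\<^sup>2 \<le> 1" using ip_sq_le_1 True by auto
  ultimately have "\<bar>(ip x y)\<^sup>2 - 1 / real p\<bar> \<le> 1" by linarith
  then show ?thesis using True assms by (simp add: ker_def abs_mult mult_left_le)
qed (use assms in \<open>auto simp: ker_def\<close>)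

lemma int_ip_sq: "integrable Q (\<lambda>y. (ip x y)\<^sup>2)"
  unfolding ip_sq using int_monomial(2)
  by (intro Bochner_Integration.integrable_sum integrable_mult_right) auto

lemma sphere_space: "x \<in> unit_sphere p \<Longrightarrow> x \<in> space Bp"
  by (auto simp: unit_sphere_def space_PiM PiE_def)

lemma ker_degenerate: "(\<integral>y. ker c x y \<partial>Q) = 0"
proof (cases "x \<in> unit_sphere p")
  case True
  note [measurable] = measurable_const[OF sphere_space[OF True]]
  have "(\<integral>y. ker c x y \<partial>Q) = (\<integral>y. c * ((ip x y)\<^sup>2 - 1 / real p) \<partial>Q)"
  proof (rule integral_cong_AE)
    show "AE y in Q. ker c x y = c * ((ip x y)\<^sup>2 - 1 / real p)"
      using AE_sphere by eventually_elim (simp add: ker_def True)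
  qed (unfold ker_def, measurable)
  also have "\<dots> = c * ((\<integral>y. (ip x y)\<^sup>2 \<partial>Q) - 1 / real p)"
    using int_ip_sq by (simp add: Q.prob_space)
  finally show ?thesis using ip_sq_mean sphere_sum[OF True] by simp
qed (simp add: ker_def)

lemma ker_kernel: assumes "0 \<le> c" shows "degenerate_kernel Q (ker c) c"
proof
  show "(\<lambda>(x, y). ker c x y) \<in> borel_measurable (Q \<Otimes>\<^sub>M Q)" unfolding ker_def by measurable
  show "ker c x y = ker c y x" for x y by (simp add: ker_def ip_commute conj_commute)
qed (use ker_bound[OF assms] ker_degenerate in auto)

context
  fixes c :: real
  assumes c: "0 \<le> c" and p2: "2 \<le> p"
begin

interpretation K: degenerate_kernel Q "ker c" c by (rule ker_kernel[OF c])

lemma G_sphere: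
  assumes x: "x \<in> unit_sphere p" and z: "z \<in> unit_sphere p"
  shows "K.G x z = c\<^sup>2 * (e22 * (1 + 2 * (ip x z)\<^sup>2) + (e4 - 3 * e22) * overlap x z - 1 / (real p)\<^sup>2)"
proof -
  note [measurable] = sphere_space[OF x] sphere_space[OF z]
  have int: "integrable Q (\<lambda>y. (ip x y)\<^sup>2 * (ip z y)\<^sup>2)"
  proof (rule Q.integrable_const_bound[where B = 1])
    show "AE y in Q. norm ((ip x y)\<^sup>2 * (ip z y)\<^sup>2) \<le> 1"
      using AE_sphere by eventually_elim (auto intro!: mult_le_one ip_sq_le_1 x z simp: abs_mult)
  qed measurable
  have "K.G x z = (\<integral>y. c\<^sup>2 * ((ip x y)\<^sup>2 * (ip z y)\<^sup>2 - (ip x y)\<^sup>2 / real p - (ip z y)\<^sup>2 / real p + 1 / (real p)\<^sup>2) \<partial>Q)"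
    unfolding K.G_def
  proof (rule integral_cong_AE)
    show "AE y in Q. ker c x y * ker c z y = c\<^sup>2 * ((ip x y)\<^sup>2 * (ip z y)\<^sup>2 - (ip x y)\<^sup>2 / real p - (ip z y)\<^sup>2 / real p + 1 / (real p)\<^sup>2)"
      using AE_sphere
      by eventually_elim (simp add: ker_def x z power2_eq_square algebra_simps)
  qed (unfold ker_def, measurable)
  also have "\<dots> = c\<^sup>2 * ((\<integral>y. (ip x y)\<^sup>2 * (ip z y)\<^sup>2 \<partial>Q) - (\<integral>y. (ip x y)\<^sup>2 \<partial>Q) / real p - (\<integral>y. (ip z y)\<^sup>2 \<partial>Q) / real p + 1 / (real p)\<^sup>2)"
    using int int_ip_sq[of x] int_ip_sq[of z] by (simp add: Q.prob_space)
  also have "\<dots> = c\<^sup>2 * (e22 * (1 + 2 * (ip x z)\<^sup>2) + (e4 - 3 * e22) * overlap x z - 1 / (real p)\<^sup>2)"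
    unfolding ip_sq_product_mean[OF x z] ip_sq_mean sphere_sum[OF x] sphere_sum[OF z]
    by (simp add: power2_eq_square)
  finally show ?thesis .
qed

lemma ip_self: "x \<in> unit_sphere p \<Longrightarrow> ip x x = 1"
  using sphere_sum[of x] by (simp add: vec_inner_def power2_eq_square)

lemma overlap_meas [measurable (raw)]:
  assumes [measurable]: "f \<in> L \<rightarrow>\<^sub>M Bp" "g \<in> L \<rightarrow>\<^sub>M Bp"
  shows "(\<lambda>z. overlap (f z) (g z)) \<in> borel_measurable L"
  unfolding overlap_def
  by (intro borel_measurable_sum borel_measurable_times borel_measurable_power)
     (auto intro!: measurable_compose[OF _ measurable_component_singleton] assms)

lemma int_overlap: "integrable Q (\<lambda>x. overlap x x)" "x \<in> unit_sphere p \<Longrightarrow> integrable Q (overlap x)"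
proof -
  show "integrable Q (\<lambda>x. overlap x x)"
    using AE_sphere overlap_bounds by (intro Q.integrable_const_bound[where B = 1]) auto
  show "integrable Q (overlap x)" if x: "x \<in> unit_sphere p"
    using AE_sphere overlap_bounds[OF x] sphere_space[OF x]
    by (intro Q.integrable_const_bound[where B = 1]) auto
qed

lemma \<tau>_value: "K.\<tau> = c\<^sup>2 * (3 * e22 + (e4 - 3 * e22) * (real p * e4) - 1 / (real p)\<^sup>2)"
proof -
  have "K.\<tau> = (\<integral>x. K.G x x \<partial>Q)" unfolding K.\<tau>_def K.G_diag ..
  also have "\<dots> = (\<integral>x. c\<^sup>2 * (3 * e22 + (e4 - 3 * e22) * overlap x x - 1 / (real p)\<^sup>2) \<partial>Q)"
  proof (rule integral_cong_AE)
    show "AE x in Q. K.G x x = c\<^sup>2 * (3 * e22 + (e4 - 3 * e22) * overlap x x - 1 / (real p)\<^sup>2)"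
      using AE_sphere by eventually_elim (simp add: G_sphere ip_self)
    interpret KG: degenerate_kernel Q K.G "c\<^sup>2" by (rule K.G_kernel)
    show "(\<lambda>x. K.G x x) \<in> borel_measurable Q" by measurable
  qed measurable
  also have "\<dots> = c\<^sup>2 * (3 * e22 + (e4 - 3 * e22) * (real p * e4) - 1 / (real p)\<^sup>2)"
    using int_overlap(1) by (simp add: Q.prob_space self_overlap_mean)
  finally show ?thesis .
qed

text \<open>
  The kernel is bounded by \<open>c\<close>.
\<close>

lemma m4_le: "K.m4 \<le> c\<^sup>2 * K.\<tau>"
proof -
  have pw: "(ker c x y) ^ 4 \<le> c\<^sup>2 * (ker c x y)\<^sup>2" for x y
  proof -
    have "(ker c x y) ^ 4 = (ker c x y)\<^sup>2 * (ker c x y)\<^sup>2" by (simp flip: power_add)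
    also have "\<dots> \<le> c\<^sup>2 * (ker c x y)\<^sup>2"
      using ker_bound[OF c] c by (intro mult_right_mono) (auto simp: abs_le_square_iff[symmetric])
    finally show ?thesis .
  qed
  have ib: "integrable Q (\<lambda>y. (ker c x y) ^ r)" if "x \<in> space Q" for x r
    using that power_mono[OF ker_bound[OF c], where n = r]
    by (intro Q.integrable_bounded[where C = "c ^ r"]) (auto simp: power_abs)
  have ob: "integrable Q (\<lambda>x. \<integral>y. (ker c x y) ^ r \<partial>Q)" for r
  proof (rule Q.integrable_bounded[where C = "c ^ r"])
    fix x assume x: "x \<in> space Q"
    show "norm (\<integral>y. (ker c x y) ^ r \<partial>Q) \<le> c ^ r"
      using x power_mono[OF ker_bound[OF c], where n = r]
      by (intro Q.norm_integral_le_bound) (auto simp: power_abs)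
  qed measurable
  have "K.m4 \<le> (\<integral>x. c\<^sup>2 * (\<integral>y. (ker c x y)\<^sup>2 \<partial>Q) \<partial>Q)"
    unfolding K.m4_def
  proof (rule integral_mono)
    fix x assume x: "x \<in> space Q"
    have "(\<integral>y. (ker c x y) ^ 4 \<partial>Q) \<le> (\<integral>y. c\<^sup>2 * (ker c x y)\<^sup>2 \<partial>Q)"
      using ib[OF x] by (intro integral_mono pw) auto
    then show "(\<integral>y. (ker c x y) ^ 4 \<partial>Q) \<le> c\<^sup>2 * (\<integral>y. (ker c x y)\<^sup>2 \<partial>Q)" by simp
  qed (use ob in auto)
  then show ?thesis by (simp add: K.\<tau>_def)
qed

text \<open>
  The conditional second moment of the kernel is at most \<open>c\<^sup>2/p\<close> for every point of the
  sphere, because \<open>(x \<bullet> y)\<^sup>4 \<le> (x \<bullet> y)\<^sup>2\<close> and the latter has mean \<open>1/p\<close>.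
\<close>

lemma \<kappa>_le: "K.\<kappa> \<le> c ^ 4 / (real p)\<^sup>2"
proof -
  have "AE x in Q. (\<integral>y. (ker c x y)\<^sup>2 \<partial>Q) \<le> c\<^sup>2 / real p"
    using AE_sphere
  proof eventually_elim
    case (elim x)
    have "(\<integral>y. (ker c x y)\<^sup>2 \<partial>Q) = c\<^sup>2 * ((\<integral>y. (ip x y)\<^sup>2 * (ip x y)\<^sup>2 \<partial>Q) - 1 / (real p)\<^sup>2)"
      unfolding K.G_diag[symmetric] G_sphere[OF elim elim] ip_sq_product_mean[OF elim elim] by simp
    also have "\<dots> \<le> c\<^sup>2 * (\<integral>y. (ip x y)\<^sup>2 * (ip x y)\<^sup>2 \<partial>Q)" by (intro mult_left_mono) auto
    also have "\<dots> \<le> c\<^sup>2 * (\<integral>y. (ip x y)\<^sup>2 \<partial>Q)"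
    proof (intro mult_left_mono integral_mono_AE')
      show "AE y in Q. (ip x y)\<^sup>2 * (ip x y)\<^sup>2 \<le> (ip x y)\<^sup>2"
        using AE_sphere by eventually_elim (intro mult_left_le ip_sq_le_1[OF elim], auto)
    qed (auto intro: int_ip_sq)
    finally show ?case using ip_sq_mean[of x] sphere_sum[OF elim] by simp
  qed
  then have *: "AE x in Q. (\<integral>y. (ker c x y)\<^sup>2 \<partial>Q)\<^sup>2 \<le> (c\<^sup>2 / real p)\<^sup>2"
    by eventually_elim (intro power_mono Bochner_Integration.integral_nonneg, auto)
  have "K.\<kappa> \<le> (\<integral>x. (c\<^sup>2 / real p)\<^sup>2 \<partial>Q)"
    unfolding K.\<kappa>_def by (rule integral_mono_AE') (use * in auto)
  also have "\<dots> = c ^ 4 / (real p)\<^sup>2" by (simp add: Q.prob_space power_divide flip: power_mult)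
  finally show ?thesis .
qed

text \<open>
  By the formula for \<open>G\<close> on the sphere, its size is governed by \<open>overlap / p\<close>, up to terms of order
  \<open>1/p\<^sup>2\<close>. The overlap lies in \<open>[0, 1]\<close> and has mean \<open>1/p\<close>, whence the third
  power of \<open>p\<close>.
\<close>

lemma g2_le: "K.g2 \<le> c ^ 4 * (168 / real p ^ 3)"
proof -
  define P where "P = real p"
  have P: "2 \<le> P" "0 < P" using p2 by (auto simp: P_def)
  (* A bound for the square of the three summands of G, linear in the squared inner product i and
     the overlap A because both lie in [0, 1]. The constants are 3 * 2\<^sup>2, 3 * 4\<^sup>2 and
     3 * 6\<^sup>2. *)
  define r where "r i A = 12 / P ^ 4 + 48 / P ^ 4 * i + 108 / P\<^sup>2 * A" for i A :: real
  have pw: "(K.G x z)\<^sup>2 \<le> c ^ 4 * r ((ip x z)\<^sup>2) (overlap x z)"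
    if x: "x \<in> unit_sphere p" and z: "z \<in> unit_sphere p" for x z
  proof -
    let ?i = "(ip x z)\<^sup>2" and ?A = "overlap x z"
    have i: "0 \<le> ?i" "?i \<le> 1" using ip_sq_le_1[OF x z] by auto
    note A = overlap_bounds[OF x z]
    have e: "0 \<le> e22" "e22 \<le> 2 / P\<^sup>2" "0 \<le> e4" "e4 \<le> 1 / P"
      using e22_nonneg e22_le[OF p2] e4_nonneg e4_le[OF p2] by (auto simp: P_def)
    have "1 / P\<^sup>2 \<le> 2 / P\<^sup>2" by (intro divide_right_mono) auto
    then have u1: "\<bar>e22 - 1 / P\<^sup>2\<bar> \<le> 2 / P\<^sup>2" using e by (auto simp: abs_le_iff)
    have "2 / P\<^sup>2 \<le> 1 / P" using P by (simp add: field_simps power2_eq_square)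
    moreover have "6 / P = 6 * (1 / P)" "1 / P > 0" using P by auto
    ultimately have u3: "\<bar>e4 - 3 * e22\<bar> \<le> 6 / P" using e by (auto simp: abs_le_iff)
    have "(e22 - 1 / P\<^sup>2)\<^sup>2 \<le> (2 / P\<^sup>2)\<^sup>2" using power_mono[OF u1, where n = 2] by simp
    then have s1: "(e22 - 1 / P\<^sup>2)\<^sup>2 \<le> 4 / P ^ 4" by (simp add: power_divide flip: power_mult)
    have "e22\<^sup>2 \<le> (2 / P\<^sup>2)\<^sup>2" using e by (intro power_mono)
    then have e22sq: "e22\<^sup>2 \<le> 4 / P ^ 4" by (simp add: power_divide flip: power_mult)
    have "?i\<^sup>2 \<le> ?i" "?A\<^sup>2 \<le> ?A" using i A by (auto simp: power2_eq_square intro!: mult_left_le)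
    have "(2 * e22 * ?i)\<^sup>2 = 4 * (e22\<^sup>2 * ?i\<^sup>2)" by (simp add: power_mult_distrib)
    also have "\<dots> \<le> 4 * (4 / P ^ 4 * ?i)"
      using e22sq \<open>?i\<^sup>2 \<le> ?i\<close> P i by (intro mult_left_mono mult_mono) auto
    finally have s2: "(2 * e22 * ?i)\<^sup>2 \<le> 16 / P ^ 4 * ?i" by simp
    have "(e4 - 3 * e22)\<^sup>2 \<le> (6 / P)\<^sup>2" using power_mono[OF u3, where n = 2] by simp
    then have "(e4 - 3 * e22)\<^sup>2 \<le> 36 / P\<^sup>2" by (simp add: power_divide)
    then have s3: "((e4 - 3 * e22) * ?A)\<^sup>2 \<le> 36 / P\<^sup>2 * ?A"
      unfolding power_mult_distrib using \<open>?A\<^sup>2 \<le> ?A\<close> P A by (intro mult_mono) auto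
    have sq3: "(a + b + d)\<^sup>2 \<le> 3 * (a\<^sup>2 + b\<^sup>2 + d\<^sup>2)" for a b d :: real
      using zero_le_power2[of "a - b"] zero_le_power2[of "a - d"] zero_le_power2[of "b - d"]
      by (simp add: power2_eq_square algebra_simps)
    have "K.G x z = c\<^sup>2 * ((e22 - 1 / P\<^sup>2) + 2 * e22 * ?i + (e4 - 3 * e22) * ?A)"
      unfolding G_sphere[OF x z] P_def by (simp add: algebra_simps)
    then have "(K.G x z)\<^sup>2 = c ^ 4 * ((e22 - 1 / P\<^sup>2) + 2 * e22 * ?i + (e4 - 3 * e22) * ?A)\<^sup>2"
      by (simp add: power_mult_distrib flip: power_mult)
    also have "\<dots> \<le> c ^ 4 * (3 * ((e22 - 1 / P\<^sup>2)\<^sup>2 + (2 * e22 * ?i)\<^sup>2 + ((e4 - 3 * e22) * ?A)\<^sup>2))"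
      by (intro mult_left_mono sq3) simp
    also have "\<dots> \<le> c ^ 4 * (3 * (4 / P ^ 4 + 16 / P ^ 4 * ?i + 36 / P\<^sup>2 * ?A))"
      by (intro mult_left_mono add_mono s1 s2 s3) simp_all
    also have "\<dots> = c ^ 4 * r ?i ?A" by (simp add: r_def algebra_simps)
    finally show ?thesis .
  qed
  have inner: "(\<integral>z. (K.G x z)\<^sup>2 \<partial>Q) \<le> c ^ 4 * (168 / P ^ 3)" if x: "x \<in> unit_sphere p" for x
  proof -
    have ri: "integrable Q (\<lambda>z. c ^ 4 * r ((ip x z)\<^sup>2) (overlap x z))"
      unfolding r_def using int_ip_sq[of x] int_overlap(2)[OF x] by auto
    have "(\<integral>z. (K.G x z)\<^sup>2 \<partial>Q) \<le> (\<integral>z. c ^ 4 * r ((ip x z)\<^sup>2) (overlap x z) \<partial>Q)"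
    proof (rule integral_mono_AE'[OF ri])
      show "AE z in Q. (K.G x z)\<^sup>2 \<le> c ^ 4 * r ((ip x z)\<^sup>2) (overlap x z)"
        using AE_sphere by eventually_elim (rule pw[OF x])
      show "AE z in Q. 0 \<le> c ^ 4 * r ((ip x z)\<^sup>2) (overlap x z)"
        using AE_sphere by eventually_elim (rule order_trans[OF zero_le_power2 pw[OF x]])
    qed
    also have "\<dots> = c ^ 4 * r (1 / P) (1 / P)"
      unfolding r_def using int_ip_sq[of x] int_overlap(2)[OF x]
      by (simp add: Q.prob_space ip_sq_mean sphere_sum[OF x] overlap_mean[OF x] P_def mult.commute)
    also have "\<dots> \<le> c ^ 4 * (168 / P ^ 3)"
    proof (rule mult_left_mono)
      have "1 / P ^ 4 \<le> 1 / P ^ 3" "1 / P ^ 5 \<le> 1 / P ^ 3"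
        using P by (intro divide_left_mono power_increasing mult_pos_pos zero_less_power; simp)+
      then have "12 * (1 / P ^ 4) + 48 * (1 / P ^ 5) + 108 * (1 / P ^ 3) \<le> 168 * (1 / P ^ 3)" by linarith
      then show "r (1 / P) (1 / P) \<le> 168 / P ^ 3"
        using power_add[of P 4 1] power_add[of P 2 1] by (simp add: r_def)
    qed simp
    finally show ?thesis .
  qed
  have "K.g2 \<le> (\<integral>x. c ^ 4 * (168 / P ^ 3) \<partial>Q)"
    unfolding K.g2_def
  proof (rule integral_mono_AE')
    show "AE x in Q. (\<integral>z. (K.G x z)\<^sup>2 \<partial>Q) \<le> c ^ 4 * (168 / P ^ 3)"
      using AE_sphere by eventually_elim (rule inner)
  qed (use P in auto)
  then show ?thesis by (simp add: Q.prob_space P_def)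
qed

end
end

section \<open>The limit law\<close>

lemma char_normal_law:
  assumes v: "0 < v"
  shows "char (normal_law 0 v) t = exp (- (t\<^sup>2 / 2) * v)" and "real_distribution (normal_law 0 v)"
proof -
  interpret S: prob_space std_normal_distribution by (rule prob_space_normal_density) simp
  have "distributed std_normal_distribution lborel (\<lambda>x. x) std_normal_density"
    by (simp add: distributed_def distr_id2)
  from S.normal_density_affine[OF this, of "sqrt v" 0]
  have "distributed std_normal_distribution lborel (\<lambda>x. sqrt v * x) (normal_density 0 (sqrt v))"
    using v by simp
  then have *: "normal_law 0 v = distr std_normal_distribution lborel (\<lambda>x. sqrt v * x)"
    by (simp add: distributed_def normal_law_def)
  have "char (normal_law 0 v) t = (\<integral>x. iexp (t * (sqrt v * x)) \<partial>std_normal_distribution)"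
    unfolding char_def * by (subst integral_distr) auto
  also have "\<dots> = char std_normal_distribution (t * sqrt v)" by (simp add: char_def mult.assoc)
  also have "\<dots> = exp (- (t\<^sup>2 / 2) * v)"
    using v by (simp add: char_std_normal_distribution power_mult_distrib)
  finally show "char (normal_law 0 v) t = exp (- (t\<^sup>2 / 2) * v)" .
  show "real_distribution (normal_law 0 v)"
    using v prob_space_normal_density[of "sqrt v" 0]
    by (auto simp: real_distribution_def real_distribution_axioms_def normal_law_def)
qed

lemma sum_pairs_eq:
  fixes f :: "nat \<Rightarrow> nat \<Rightarrow> real"
  shows "(\<Sum>(i, j) \<in> {(i, j). 1 \<le> i \<and> i < j \<and> j \<le> n}. f i j) = (\<Sum>j=1..n. \<Sum>i=1..<j. f i j)"
proof -
  have "(\<Sum>j=1..n. \<Sum>i=1..<j. f i j) = (\<Sum>(j, i)\<in>Sigma {1..n} (\<lambda>j. {1..<j}). f i j)"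
    by (rule sum.Sigma) auto
  also have "\<dots> = (\<Sum>(i, j) \<in> {(i, j). 1 \<le> i \<and> i < j \<and> j \<le> n}. f i j)"
    by (rule sum.reindex_bij_witness[where i = prod.swap and j = prod.swap]) auto
  finally show ?thesis by simp
qed

text \<open>
  If \<open>\<mu>\<close> had an atom at zero, the zero vector, which normalisation leaves at zero, would have positive
  probability.
\<close>

lemma no_atom_at_zero:
  assumes \<mu>: "prob_space \<mu>" "sets \<mu> = sets borel" and p: "0 < p"
    and sph: "AE x in spherical_law \<mu> p. x \<in> unit_sphere p"
  shows "AE x in \<mu>. x \<noteq> 0"
proof -
  interpret prob_space \<mu> by fact
  note \<mu>(2) [measurable_cong, simp]
  have sp [simp]: "space \<mu> = UNIV" using sets_eq_imp_space_eq[OF \<mu>(2)] by simp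
  interpret P: product_sigma_finite "\<lambda>_ :: nat. \<mu>"
    by (simp add: product_sigma_finite_def sigma_finite_measure_axioms)
  let ?A = "Pi\<^sub>E {1..p} (\<lambda>_. {0 :: real})"
  let ?Y = "\<lambda>x. \<lambda>k\<in>{1..p}. x k / vec_norm p x"
  have Ym: "?Y \<in> powM \<mu> p \<rightarrow>\<^sub>M Pi\<^sub>M {1..p} (\<lambda>_. borel)" unfolding vec_norm_def by measurable
  have "AE x in powM \<mu> p. ?Y x \<in> unit_sphere p"
    using sph unfolding spherical_law_def by (rule AE_distrD[OF Ym])
  then have "AE x in powM \<mu> p. \<not> x \<in> ?A"
  proof eventually_elim
    case (elim x)
    show ?case
    proof
      assume "x \<in> ?A"
      then have "vec_norm p (?Y x) = 0" by (auto simp: vec_norm_def PiE_iff)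
      with elim show False by (simp add: unit_sphere_def)
    qed
  qed
  then have ae: "AE x in powM \<mu> p. x \<notin> ?A" by simp
  have A: "?A \<in> sets (powM \<mu> p)" by (rule sets_PiM_I_finite) auto
  have "{x \<in> space (powM \<mu> p). \<not> x \<notin> ?A} = ?A"
    using sets.sets_into_space[OF A] by (auto simp del: PiE_iff)
  from AE_iff_measurable[OF A this] ae have "emeasure (powM \<mu> p) ?A = 0" by (simp only:)
  moreover have "emeasure (powM \<mu> p) ?A = (\<Prod>i\<in>{1..p}. emeasure \<mu> {0})"
    by (rule P.emeasure_PiM) auto
  ultimately have "emeasure \<mu> {0} = 0" using p by (simp add: power_0_left split: if_splits)
  then show ?thesis by (subst AE_iff_measurable[OF _ refl]) auto
qed

theorem theorem2:
  fixes \<alpha> \<gamma> :: real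
    and \<mu> :: "real measure"
    and p :: "nat \<Rightarrow> nat"
    and M :: "nat \<Rightarrow> 'a measure"
    and X :: "nat \<Rightarrow> nat \<Rightarrow> 'a \<Rightarrow> (nat \<Rightarrow> real)"
  assumes "0 < \<alpha>" and "\<alpha> < 2"
    and "real_law \<mu>" and "symmetric_law \<mu>" and "regularly_varying \<mu> \<alpha>"
    and "\<And>n. 0 < p n"
    and "0 < \<gamma>" and "(\<lambda>n. real (p n) / real n) \<longlonglongrightarrow> \<gamma>"
    and "\<And>n. AE x in spherical_law \<mu> (p n). x \<in> unit_sphere (p n)"
    and "\<And>n. prob_space (M n)"
    and "\<And>n. prob_space.indep_vars (M n) (\<lambda>_. Pi\<^sub>M {1..p n} (\<lambda>_. borel)) (X n) {1..n}"
    and "\<And>n i. i \<in> {1..n} \<Longrightarrow>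
           distr (M n) (Pi\<^sub>M {1..p n} (\<lambda>_. borel)) (X n i) = spherical_law \<mu> (p n)"
  shows "weak_conv_m
           (\<lambda>n. distr (M n) borel
              (\<lambda>\<omega>. sqrt (real n) / real (p n) * B_stat (p n) n (\<lambda>i. X n i \<omega>)))
           (normal_law 0 ((2 - \<alpha>)\<^sup>2 / (8 * \<gamma>)))"
proof -
  note pos_p = assms(6) and \<gamma> = assms(7) and p_ratio = assms(8) and prob_M = assms(10)
    and indep = assms(11) and laws = assms(12)
  have law: "prob_space \<mu>" "sets \<mu> = sets borel" using assms(3) by (auto simp: real_law_def)
  have nz: "AE x in \<mu>. x \<noteq> 0" by (rule no_atom_at_zero[OF law pos_p assms(9)])
  interpret R: nonzero_rv_law \<mu> \<alpha>
    using law nz assms(1,2,5) by (auto simp: nonzero_rv_law_def nonzero_rv_law_axioms_def rv_law_def rv_law_axioms_def)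
  have sph: "spherical \<mu> (p n)" for n
    using law nz pos_p assms(4) by (auto simp: spherical_def spherical_axioms_def symmetric_law_def)
  define c where "c n = 1 / sqrt (real n)" for n
  have c0: "0 \<le> c n" for n by (simp add: c_def)
  define Q where "Q n = spherical_law \<mu> (p n)" for n
  define h where "h n = spherical.ker (p n) (c n)" for n
  have K: "degenerate_kernel (Q n) (h n) (c n)" for n
    unfolding Q_def h_def by (rule spherical.ker_kernel[OF sph c0])
  define v where "v = (2 - \<alpha>)\<^sup>2 / (8 * \<gamma>)"
  have v: "0 < v" using assms(2) \<gamma> by (simp add: v_def)
  have inv_n: "(\<lambda>n. 1 / real n) \<longlonglongrightarrow> 0" by (rule lim_1_over_n)
  have pn: "filterlim (\<lambda>n. real (p n)) at_top sequentially"
  proof -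
    have "filterlim (\<lambda>n. real (p n) / real n * real n) at_top sequentially"
      by (rule filterlim_tendsto_pos_mult_at_top[OF p_ratio \<gamma> filterlim_real_sequentially])
    moreover have "eventually (\<lambda>n. real (p n) / real n * real n = real (p n)) sequentially"
      using eventually_gt_at_top[of 0] by eventually_elim simp
    ultimately show ?thesis by (subst (asm) filterlim_cong[OF refl refl])
  qed
  then have pn_nat: "filterlim p at_top sequentially"
    by (simp add: filterlim_sequentially_iff_filterlim_real)
  have inv_p: "(\<lambda>n. 1 / real (p n)) \<longlonglongrightarrow> 0"
    using tendsto_divide_0[OF tendsto_const filterlim_at_top_imp_at_infinity[OF pn]] .
  have np: "(\<lambda>n. real n / real (p n)) \<longlonglongrightarrow> 1 / \<gamma>"
    using tendsto_divide[OF tendsto_const p_ratio, of 1] \<gamma> by simp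
  have p2: "eventually (\<lambda>n. 2 \<le> p n \<and> 0 < n) sequentially"
    by (rule eventually_conj[OF filterlim_at_top[THEN iffD1, OF pn_nat, rule_format] eventually_gt_at_top])
  define E where "E n = spherical.e4 \<mu> (p n)" for n
  define F where "F n = spherical.e22 \<mu> (p n)" for n
  have E_lim: "(\<lambda>n. real (p n) * E n) \<longlonglongrightarrow> 1 - \<alpha> / 2"
  proof -
    have "E n = (\<integral>x. R.w (p n) 1 x ^ 2 \<partial>powM \<mu> (p n))" for n
    proof -
      interpret spherical \<mu> "p n" by (rule sph)
      have 1: "1 \<in> {1..p n}" using pos_p[of n] by auto
      have "E n = (\<integral>x. (Y x 1) ^ 4 \<partial>powM \<mu> (p n))"
        unfolding E_def e4_def Q_eq using 1 by (subst integral_distr) auto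
      also have "\<dots> = (\<integral>x. R.w (p n) 1 x ^ 2 \<partial>powM \<mu> (p n))"
      proof (rule Bochner_Integration.integral_cong[OF refl])
        fix x :: "nat \<Rightarrow> real"
        have "(Y x 1) ^ 4 = ((Y x 1)\<^sup>2)\<^sup>2" by (simp flip: power_mult)
        also have "(Y x 1)\<^sup>2 = R.w (p n) 1 x"
          using 1 by (simp add: Y_def vec_norm_def power_divide sum_nonneg)
        finally show "(Y x 1) ^ 4 = R.w (p n) 1 x ^ 2" .
      qed
      finally show ?thesis .
    qed
    then show ?thesis using filterlim_compose[OF R.self_normalised_fourth_moment_limit pn_nat] by simp
  qed
  (* The squared coordinates sum to one, so mixed moments are of order 1 / p\<^sup>2. *)
  have F_lim: "(\<lambda>n. real (p n) * F n) \<longlonglongrightarrow> 0"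
  proof (rule tendsto_sandwich)
    show "eventually (\<lambda>n. 0 \<le> real (p n) * F n) sequentially"
      using spherical.e22_nonneg[OF sph] by (simp add: F_def)
    show "eventually (\<lambda>n. real (p n) * F n \<le> 2 * (1 / real (p n))) sequentially"
      using p2
    proof eventually_elim
      case (elim n)
      have "real (p n) * F n \<le> real (p n) * (2 / (real (p n))\<^sup>2)"
        using spherical.e22_le[OF sph[of n]] elim by (intro mult_left_mono) (auto simp: F_def)
      then show ?case using elim by (simp add: power2_eq_square)
    qed
    show "(\<lambda>n. 2 * (1 / real (p n))) \<longlonglongrightarrow> 0" using tendsto_mult_left[OF inv_p, of 2] by simp
  qed simp
  have c2: "(c n)\<^sup>2 = 1 / real n" and c4: "c n ^ 4 = 1 / (real n)\<^sup>2" for n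
  proof -
    show *: "(c n)\<^sup>2 = 1 / real n" by (simp add: c_def power_divide)
    have "c n ^ 4 = ((c n)\<^sup>2)\<^sup>2" by (simp flip: power_mult)
    then show "c n ^ 4 = 1 / (real n)\<^sup>2" by (simp only: * power_divide power_one)
  qed
  have \<tau>: "(\<lambda>n. (real n)\<^sup>2 * degenerate_kernel.\<tau> (Q n) (h n) / 2) \<longlonglongrightarrow> v"
  proof -
    let ?g = "\<lambda>n. (real n / real (p n)) / 2 * (3 * (real (p n) * F n)
        + (real (p n) * E n - 3 * (real (p n) * F n)) * (real (p n) * E n) - 1 / real (p n))"
    have "?g \<longlonglongrightarrow> (1 / \<gamma>) / 2 * (3 * 0 + ((1 - \<alpha> / 2) - 3 * 0) * (1 - \<alpha> / 2) - 0)"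
      by (intro tendsto_intros np E_lim F_lim inv_p) auto
    also have "(1 / \<gamma>) / 2 * (3 * 0 + ((1 - \<alpha> / 2) - 3 * 0) * (1 - \<alpha> / 2) - 0) = v"
      using \<gamma> by (simp add: v_def field_simps power2_eq_square)
    finally have "?g \<longlonglongrightarrow> v" .
    then show ?thesis
    proof (rule Lim_transform_eventually)
      show "eventually (\<lambda>n. ?g n = (real n)\<^sup>2 * degenerate_kernel.\<tau> (Q n) (h n) / 2) sequentially"
        using p2
      proof eventually_elim
        case (elim n)
        then have nz: "real n \<noteq> 0" "real (p n) \<noteq> 0" by auto
        have tv: "degenerate_kernel.\<tau> (Q n) (h n) =
            1 / real n * (3 * F n + (E n - 3 * F n) * (real (p n) * E n) - 1 / (real (p n))\<^sup>2)"
          unfolding Q_def h_def E_def F_def c2[symmetric] using elim by (intro spherical.\<tau>_value sph c0) auto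
        show ?case unfolding tv using nz by (simp add: field_simps power2_eq_square)
      qed
    qed
  qed
  have m4: "(\<lambda>n. (real n)\<^sup>2 * degenerate_kernel.m4 (Q n) (h n)) \<longlonglongrightarrow> 0"
  proof (rule tendsto_sandwich)
    show "eventually (\<lambda>n. 0 \<le> (real n)\<^sup>2 * degenerate_kernel.m4 (Q n) (h n)) sequentially"
      using degenerate_kernel.m4_nonneg[OF K] by simp
    show "eventually (\<lambda>n. (real n)\<^sup>2 * degenerate_kernel.m4 (Q n) (h n) \<le>
        2 * (1 / real n) * ((real n)\<^sup>2 * degenerate_kernel.\<tau> (Q n) (h n) / 2)) sequentially"
      using p2
    proof eventually_elim
      case (elim n)
      have "(real n)\<^sup>2 * degenerate_kernel.m4 (Q n) (h n) \<le> (real n)\<^sup>2 * ((c n)\<^sup>2 * degenerate_kernel.\<tau> (Q n) (h n))"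
        unfolding Q_def h_def using elim by (intro mult_left_mono spherical.m4_le[OF sph c0]) auto
      then show ?case by (simp add: c2)
    qed
    show "(\<lambda>n. 2 * (1 / real n) * ((real n)\<^sup>2 * degenerate_kernel.\<tau> (Q n) (h n) / 2)) \<longlonglongrightarrow> 0"
      using tendsto_mult[OF tendsto_mult_left[OF inv_n, of 2] \<tau>] by simp
  qed simp
  have \<kappa>: "(\<lambda>n. real n ^ 3 * degenerate_kernel.\<kappa> (Q n) (h n)) \<longlonglongrightarrow> 0"
  proof (rule tendsto_sandwich)
    show "eventually (\<lambda>n. 0 \<le> real n ^ 3 * degenerate_kernel.\<kappa> (Q n) (h n)) sequentially"
      using degenerate_kernel.\<kappa>_nonneg[OF K] by simp
    show "eventually (\<lambda>n. real n ^ 3 * degenerate_kernel.\<kappa> (Q n) (h n) \<le>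
        (real n / real (p n)) * (1 / real (p n))) sequentially"
      using p2
    proof eventually_elim
      case (elim n)
      have "real n ^ 3 * degenerate_kernel.\<kappa> (Q n) (h n) \<le> real n ^ 3 * (c n ^ 4 / (real (p n))\<^sup>2)"
        unfolding Q_def h_def using elim by (intro mult_left_mono spherical.\<kappa>_le[OF sph c0]) auto
      also have "real n ^ 3 * (c n ^ 4 / (real (p n))\<^sup>2) = (real n / real (p n)) * (1 / real (p n))"
        unfolding c4 using elim by (simp add: power2_eq_square power3_eq_cube)
      finally show ?case .
    qed
    show "(\<lambda>n. (real n / real (p n)) * (1 / real (p n))) \<longlonglongrightarrow> 0"
      using tendsto_mult[OF np inv_p] by simp
  qed simp
  have g2: "(\<lambda>n. real n ^ 4 * degenerate_kernel.g2 (Q n) (h n)) \<longlonglongrightarrow> 0"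
  proof (rule tendsto_sandwich)
    show "eventually (\<lambda>n. 0 \<le> real n ^ 4 * degenerate_kernel.g2 (Q n) (h n)) sequentially"
      using degenerate_kernel.g2_nonneg[OF K] by simp
    show "eventually (\<lambda>n. real n ^ 4 * degenerate_kernel.g2 (Q n) (h n) \<le>
        168 * ((real n / real (p n)) * (real n / real (p n)) * (1 / real (p n)))) sequentially"
      using p2
    proof eventually_elim
      case (elim n)
      have "real n ^ 4 * degenerate_kernel.g2 (Q n) (h n) \<le> real n ^ 4 * (c n ^ 4 * (168 / real (p n) ^ 3))"
        unfolding Q_def h_def using elim by (intro mult_left_mono spherical.g2_le[OF sph c0]) auto
      also have "real n ^ 4 * (c n ^ 4 * (168 / real (p n) ^ 3)) =
          168 * ((real n / real (p n)) * (real n / real (p n)) * (1 / real (p n)))"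
        unfolding c4 using elim by (simp add: power2_eq_square power3_eq_cube power4_eq_xxxx mult_ac)
      finally show ?case .
    qed
    show "(\<lambda>n. 168 * ((real n / real (p n)) * (real n / real (p n)) * (1 / real (p n)))) \<longlonglongrightarrow> 0"
      using tendsto_mult_left[OF tendsto_mult[OF tendsto_mult[OF np np] inv_p], of 168] by simp
  qed simp

  let ?T = "\<lambda>n \<omega>. sqrt (real n) / real (p n) * B_stat (p n) n (\<lambda>i. X n i \<omega>)"
  have X_meas: "X n i \<in> M n \<rightarrow>\<^sub>M Pi\<^sub>M {1..p n} (\<lambda>_. borel)" if "i \<in> {1..n}" for n i
    using indep[of n] that unfolding prob_space.indep_vars_def[OF prob_M] by simp
  have T_meas: "?T n \<in> borel_measurable (M n)" for n
  proof -
    interpret spherical \<mu> "p n" by (rule sph)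
    show ?thesis unfolding B_stat_def sum_pairs_eq
      by (intro borel_measurable_times borel_measurable_const borel_measurable_sum borel_measurable_diff
          borel_measurable_power ip_meas X_meas) auto
  qed
  have T_eq: "AE \<omega> in M n. ?T n \<omega> = degenerate_kernel.U (h n) n (\<lambda>i\<in>{1..n}. X n i \<omega>)" if n: "0 < n" for n
  proof -
    interpret spherical \<mu> "p n" by (rule sph)
    interpret K: degenerate_kernel "Q n" "h n" "c n" by (rule K)
    have "AE \<omega> in M n. X n i \<omega> \<in> unit_sphere (p n)" if i: "i \<in> {1..n}" for i
      using assms(9)[of n] unfolding laws[OF i, symmetric] by (rule AE_distrD[OF X_meas[OF i]])
    then have "AE \<omega> in M n. \<forall>i\<in>{1..n}. X n i \<omega> \<in> unit_sphere (p n)" by (intro AE_finite_allI) auto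
    then show ?thesis
    proof eventually_elim
      case (elim \<omega>)
      have "?T n \<omega> = c n * (\<Sum>j=1..n. \<Sum>i=1..<j. (vec_inner (p n) (X n i \<omega>) (X n j \<omega>))\<^sup>2 - 1 / real (p n))"
      proof -
        have "sqrt (real n) / real (p n) * (real (p n) / real n) = c n"
        proof -
          have "sqrt (real n) / real n = 1 / sqrt (real n)" using n by (simp add: divide_simps)
          then show ?thesis using pos_p[of n] by (simp add: c_def)
        qed
        then show ?thesis unfolding B_stat_def sum_pairs_eq by (simp only: mult.assoc[symmetric])
      qed
      also have "\<dots> = (\<Sum>j=1..n. \<Sum>i=1..<j. h n (X n i \<omega>) (X n j \<omega>))"
        unfolding sum_distrib_left h_def using elim by (intro sum.cong refl) (auto simp: ker_def)
      also have "\<dots> = K.U n (\<lambda>i\<in>{1..n}. X n i \<omega>)"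
        unfolding K.U_def by (intro sum.cong refl) auto
      finally show ?case .
    qed
  qed
  (* The joint law of the independent vectors is the product measure on which the U-statistic was
     analysed. *)
  have char_eq: "char (distr (M n) borel (?T n)) t = degenerate_kernel.\<phi> (Q n) (h n) n t" if n: "0 < n" for n t
  proof -
    interpret M: prob_space "M n" by (rule prob_M)
    interpret spherical \<mu> "p n" by (rule sph)
    interpret K: degenerate_kernel "Q n" "h n" "c n" by (rule K)
    let ?Z = "\<lambda>\<omega>. \<lambda>i\<in>{1..n}. X n i \<omega>"
    have Zm: "?Z \<in> M n \<rightarrow>\<^sub>M Pi\<^sub>M {1..n} (\<lambda>_. Bp)" by (rule measurable_restrict) (rule X_meas)
    have "distr (M n) (Pi\<^sub>M {1..n} (\<lambda>_. Bp)) ?Z = Pi\<^sub>M {1..n} (\<lambda>i. distr (M n) Bp (X n i))"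
      using n indep[of n] X_meas by (subst M.indep_vars_iff_distr_eq_PiM'[symmetric]) auto
    also have "\<dots> = powM (Q n) n" using laws by (intro PiM_cong) (auto simp: Q_def)
    finally have joint: "distr (M n) (Pi\<^sub>M {1..n} (\<lambda>_. Bp)) ?Z = powM (Q n) n" .
    have sets_eq: "sets (powM (Q n) n) = sets (Pi\<^sub>M {1..n} (\<lambda>_. Bp))"
      unfolding joint[symmetric] by simp
    have Um: "K.U n \<in> borel_measurable (Pi\<^sub>M {1..n} (\<lambda>_. Bp))"
      using K.U_meas[of n] measurable_cong_sets[OF sets_eq refl] by blast
    have "K.\<phi> n t = (\<integral>\<omega>. iexp (t * K.U n (?Z \<omega>)) \<partial>M n)"
      unfolding K.\<phi>_def joint[symmetric] 
      by (intro integral_distr Zm measurable_compose[OF Um, of "\<lambda>u. iexp (t * u)" borel]) measurable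
    also have "\<dots> = (\<integral>\<omega>. iexp (t * ?T n \<omega>) \<partial>M n)"
    proof (rule integral_cong_AE)
      show "(\<lambda>\<omega>. iexp (t * K.U n (?Z \<omega>))) \<in> borel_measurable (M n)"
        by (rule measurable_compose[OF measurable_compose[OF Zm Um], of "\<lambda>u. iexp (t * u)"]) measurable
      show "(\<lambda>\<omega>. iexp (t * ?T n \<omega>)) \<in> borel_measurable (M n)"
        by (rule measurable_compose[OF T_meas[of n], of "\<lambda>u. iexp (t * u)"]) measurable
      show "AE \<omega> in M n. iexp (t * K.U n (?Z \<omega>)) = iexp (t * ?T n \<omega>)"
        using T_eq[OF n] by eventually_elim simp
    qed
    also have "\<dots> = char (distr (M n) borel (?T n)) t"
      unfolding char_def using T_meas[of n] by (subst integral_distr) auto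
    finally show ?thesis ..
  qed
  show ?thesis unfolding v_def[symmetric]
  proof (rule levy_continuity)
    show "real_distribution (distr (M n) borel (?T n))" for n
      using prob_space.prob_space_distr[OF prob_M T_meas]
      by (auto simp: real_distribution_def real_distribution_axioms_def)
    show "real_distribution (normal_law 0 v)" by (rule char_normal_law[OF v])
    fix t
    have "(\<lambda>n. degenerate_kernel.\<phi> (Q n) (h n) n t) \<longlonglongrightarrow> exp (- (t\<^sup>2 / 2) * v)"
      by (rule degenerate_U_statistic_clt[OF K \<tau> m4 \<kappa> g2])
    moreover have "eventually (\<lambda>n. degenerate_kernel.\<phi> (Q n) (h n) n t = char (distr (M n) borel (?T n)) t) sequentially"
      using eventually_gt_at_top[of 0] by eventually_elim (rule char_eq[symmetric])
    ultimately show "(\<lambda>n. char (distr (M n) borel (?T n)) t) \<longlonglongrightarrow> char (normal_law 0 v) t"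
      unfolding char_normal_law(1)[OF v] by (rule Lim_transform_eventually)
  qed
qed

end
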